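(* Let $\Omega\subset\mathbb{R}^d$ ($d\ge 1$) be a bounded, convex, open set, let $p$ satisfy $1<p<\infty$ if $d=1,2$ and $1<p<\frac{d+2}{d-2}$ if $d\ge 3$, and let $1<\gamma<\frac{p+1}{p-1}$. Let $\phi\in H^1_0(\Omega)$, $\phi\neq 0$, be a solution of $-\phi+\Delta\phi+|\phi|^{p-1}\phi=0$ in $\Omega$, $\phi|_{\partial\Omega}=0$. Assume that the spectrum of the operator $T_\phi:H^1_0(\Omega)\to H^1_0(\Omega)$, $T_\phi h=\mathcal{L}^{-1}(p|\phi|^{p-1}h)$, satisfies $\sigma(T_\phi)\setminus(-\infty,1)=\{p\}$ and that the eigenvalue $p$ of $T_\phi$ has algebraic multiplicity one. Then there exist a neighborhood $\mathcal{N}$ of $\phi$ in $H^1_0(\Omega)$ and a constant $\theta\in(0,1)$ such that for all $u_0\in\mathcal{N}$ the sequence $\{u_n\}_{n=0}^\infty$ defined by $u_{n+1}=\mathcal{A}(u_n)$ satisfies $$\|u_n-\phi\|_{H^1}\le\theta^n\|u_0-\phi\|_{H^1}\quad\text{for all } n\ge 0.$$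
   Context: All functions are real valued and $\Omega$ is nonempty. $\langle\cdot,\cdot\rangle$ is the $L^2(\Omega)$ inner product (extended to the duality between $H^{-1}$ and $H^1_0$). $H^1_0(\Omega)$ carries the inner product $\langle f,g\rangle_{H^1}=\int_\Omega fg+\nabla f\cdot\nabla g$ with norm $\|\cdot\|_{H^1}$. $\mathcal{L}=I-\Delta:H^1_0(\Omega)\to H^{-1}(\Omega)$ (Dirichlet boundary conditions), and $\mathcal{L}^{-1}$ is its inverse. For $u\in H^1_0(\Omega)$, $u\ne0$, set $$M[u]=\frac{\langle\mathcal{L}u,u\rangle}{\langle|u|^{p-1}u,u\rangle}=\frac{\|u\|_{H^1}^2}{\|u\|_{L^{p+1}}^{p+1}},\qquad \mathcal{A}(u)=M[u]^\gamma\,\mathcal{L}^{-1}(|u|^{p-1}u).$$ A solution $\phi\in H^1_0(\Omega)$ of the equation is understood in the weak sense: $\int_\Omega\nabla\phi\cdot\nabla v+\phi v-|\phi|^{p-1}\phi v=0$ for all $v\in H^1_0(\Omega)$. *)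

theory Defs
  imports "HOL-Analysis.Analysis"
begin

section \<open>Square-integrable functions modulo equality almost everywhere\<close>

text \<open>Borel representatives lose nothing: every Lebesgue measurable function agrees almost
  everywhere with a Borel measurable one.\<close>

definition square_integrable :: "('a::euclidean_space \<Rightarrow> 'b::euclidean_space) \<Rightarrow> bool" where
  "square_integrable f \<longleftrightarrow>
     f \<in> borel_measurable lborel \<and> integrable lborel (\<lambda>x. (norm (f x))\<^sup>2)"

definition l2_rel :: "('a::euclidean_space \<Rightarrow> 'b::euclidean_space) \<Rightarrow> ('a \<Rightarrow> 'b) \<Rightarrow> bool" where
  "l2_rel f g \<longleftrightarrow> square_integrable f \<and> square_integrable g \<and> (AE x in lborel. f x = g x)"

lemma square_integrable_zero: "square_integrable (\<lambda>x. 0)"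
  by (simp add: square_integrable_def)

lemma square_integrable_add:
  assumes "square_integrable f" "square_integrable g"
  shows "square_integrable (\<lambda>x. f x + g x)"
  unfolding square_integrable_def
proof
  show m: "(\<lambda>x. f x + g x) \<in> borel_measurable lborel"
    using assms by (auto simp: square_integrable_def)
  have *: "(norm (a + b))\<^sup>2 \<le> 2 * (norm a)\<^sup>2 + 2 * (norm b)\<^sup>2" for a b :: 'b
  proof -
    have "(norm (a + b))\<^sup>2 \<le> (norm a + norm b)\<^sup>2"
      by (simp add: norm_triangle_ineq power_mono)
    also have "\<dots> \<le> 2 * (norm a)\<^sup>2 + 2 * (norm b)\<^sup>2"
      using zero_le_power2[of "norm a - norm b"] by (simp add: power2_eq_square algebra_simps)
    finally show ?thesis .
  qed
  show "integrable lborel (\<lambda>x. (norm (f x + g x))\<^sup>2)"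
    by (rule Bochner_Integration.integrable_bound
          [where f = "\<lambda>x. 2 * (norm (f x))\<^sup>2 + 2 * (norm (g x))\<^sup>2"])
       (use assms m * in \<open>auto simp: square_integrable_def\<close>)
qed

lemma square_integrable_scaleR:
  assumes "square_integrable f"
  shows "square_integrable (\<lambda>x. c *\<^sub>R f x)"
  using assms by (auto simp: square_integrable_def power_mult_distrib)

lemma square_integrable_uminus:
  assumes "square_integrable f"
  shows "square_integrable (\<lambda>x. - f x)"
  using assms by (auto simp: square_integrable_def)

lemma square_integrable_diff:
  assumes "square_integrable f" "square_integrable g"
  shows "square_integrable (\<lambda>x. f x - g x)"
  using square_integrable_add[OF assms(1) square_integrable_uminus[OF assms(2)]] by simp

lemma square_integrable_inner:
  assumes "square_integrable f" "square_integrable g"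
  shows "integrable lborel (\<lambda>x. f x \<bullet> g x)"
proof -
  have *: "\<bar>a \<bullet> b\<bar> \<le> (norm a)\<^sup>2 + (norm b)\<^sup>2" for a b :: 'b
  proof -
    have "\<bar>a \<bullet> b\<bar> \<le> norm a * norm b"
      by (rule Cauchy_Schwarz_ineq2)
    also have "\<dots> \<le> (norm a)\<^sup>2 + (norm b)\<^sup>2"
      using zero_le_power2[of "norm a - norm b"] zero_le_power2[of "norm a"]
        zero_le_power2[of "norm b"] unfolding power2_diff by linarith
    finally show ?thesis .
  qed
  show ?thesis
    by (rule Bochner_Integration.integrable_bound
          [where f = "\<lambda>x. (norm (f x))\<^sup>2 + (norm (g x))\<^sup>2"])
       (use assms * in \<open>auto simp: square_integrable_def\<close>)
qed

quotient_type (overloaded) ('a, 'b) l2 =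
  "'a::euclidean_space \<Rightarrow> 'b::euclidean_space" / partial: l2_rel
proof (rule part_equivpI)
  show "\<exists>f::'a \<Rightarrow> 'b. l2_rel f f"
    using square_integrable_zero by (auto simp: l2_rel_def)
  show "symp (l2_rel :: ('a \<Rightarrow> 'b) \<Rightarrow> _)"
    by (auto simp: symp_def l2_rel_def)
  show "transp (l2_rel :: ('a \<Rightarrow> 'b) \<Rightarrow> _)"
    unfolding transp_def l2_rel_def by auto
qed

instantiation l2 :: (euclidean_space, euclidean_space) real_vector
begin

lift_definition zero_l2 :: "('a, 'b) l2" is "\<lambda>x. 0"
  by (simp add: l2_rel_def square_integrable_zero)

lift_definition plus_l2 :: "('a, 'b) l2 \<Rightarrow> ('a, 'b) l2 \<Rightarrow> ('a, 'b) l2" is "\<lambda>f g x. f x + g x"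
  by (auto simp: l2_rel_def intro: square_integrable_add)

lift_definition uminus_l2 :: "('a, 'b) l2 \<Rightarrow> ('a, 'b) l2" is "\<lambda>f x. - f x"
  by (auto simp: l2_rel_def intro: square_integrable_uminus)

lift_definition minus_l2 :: "('a, 'b) l2 \<Rightarrow> ('a, 'b) l2 \<Rightarrow> ('a, 'b) l2" is "\<lambda>f g x. f x - g x"
  by (auto simp: l2_rel_def intro: square_integrable_diff)

lift_definition scaleR_l2 :: "real \<Rightarrow> ('a, 'b) l2 \<Rightarrow> ('a, 'b) l2" is "\<lambda>c f x. c *\<^sub>R f x"
  by (auto simp: l2_rel_def intro: square_integrable_scaleR)

instance
  by standard
    (transfer; auto simp: l2_rel_def algebra_simps
      intro!: square_integrable_zero square_integrable_add square_integrable_diff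
        square_integrable_uminus square_integrable_scaleR)+

end

instantiation l2 :: (euclidean_space, euclidean_space) real_inner
begin

lift_definition inner_l2 :: "('a, 'b) l2 \<Rightarrow> ('a, 'b) l2 \<Rightarrow> real"
  is "\<lambda>f g. \<integral>x. f x \<bullet> g x \<partial>lborel"
  unfolding l2_rel_def square_integrable_def
  by (elim conjE, rule integral_cong_AE) auto

definition norm_l2 :: "('a, 'b) l2 \<Rightarrow> real" where
  "norm_l2 U = sqrt (U \<bullet> U)"

definition sgn_l2 :: "('a, 'b) l2 \<Rightarrow> ('a, 'b) l2" where
  "sgn_l2 U = U /\<^sub>R norm U"

definition dist_l2 :: "('a, 'b) l2 \<Rightarrow> ('a, 'b) l2 \<Rightarrow> real" where
  "dist_l2 U V = norm (U - V)"

definition uniformity_l2 :: "(('a, 'b) l2 \<times> ('a, 'b) l2) filter" where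
  "uniformity_l2 = (INF e\<in>{0<..}. principal {(U, V). dist U V < e})"

definition open_l2 :: "('a, 'b) l2 set \<Rightarrow> bool" where
  "open_l2 S \<longleftrightarrow> (\<forall>U\<in>S. \<forall>\<^sub>F (U', V) in uniformity. U' = U \<longrightarrow> V \<in> S)"

instance
proof
  fix U V W :: "('a, 'b) l2" and c :: real
  show "U \<bullet> V = V \<bullet> U"
    by transfer (simp add: inner_commute)
  show "(U + V) \<bullet> W = U \<bullet> W + V \<bullet> W"
    by transfer (simp add: inner_add_left l2_rel_def square_integrable_inner)
  show "(c *\<^sub>R U) \<bullet> V = c * (U \<bullet> V)"
    by transfer simp
  show "0 \<le> U \<bullet> U"
    by transfer simp
  show "U \<bullet> U = 0 \<longleftrightarrow> U = 0"
  proof transfer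
    fix f :: "'a \<Rightarrow> 'b"
    assume "l2_rel f f"
    then have f: "square_integrable f"
      by (simp add: l2_rel_def)
    have "(\<integral>x. f x \<bullet> f x \<partial>lborel) = 0 \<longleftrightarrow> (AE x in lborel. f x \<bullet> f x = 0)"
      by (rule integral_nonneg_eq_0_iff_AE) (use square_integrable_inner[OF f f] in auto)
    then show "((\<integral>x. f x \<bullet> f x \<partial>lborel) = 0) = l2_rel f (\<lambda>x. 0)"
      using f by (simp add: l2_rel_def square_integrable_zero)
  qed
qed (auto simp: norm_l2_def sgn_l2_def dist_l2_def uniformity_l2_def open_l2_def)

end


section \<open>The Sobolev space of functions vanishing on the boundary\<close>

primrec Ck :: "nat \<Rightarrow> ('a::euclidean_space \<Rightarrow> real) \<Rightarrow> bool" where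
  "Ck 0 v \<longleftrightarrow> continuous_on UNIV v"
| "Ck (Suc k) v \<longleftrightarrow>
     (\<forall>x. v differentiable (at x)) \<and> (\<forall>b\<in>Basis. Ck k (\<lambda>x. frechet_derivative v (at x) b))"

definition gradient :: "('a::euclidean_space \<Rightarrow> real) \<Rightarrow> 'a \<Rightarrow> 'a" where
  "gradient v x = (\<Sum>b\<in>Basis. frechet_derivative v (at x) b *\<^sub>R b)"

text \<open>Smooth functions with compact support in \<open>\<Omega>\<close>, extended by zero to the whole space.\<close>

definition test_function :: "'a::euclidean_space set \<Rightarrow> ('a \<Rightarrow> real) \<Rightarrow> bool" where
  "test_function \<Omega> v \<longleftrightarrow>
     (\<forall>k. Ck k v) \<and> compact (closure {x. v x \<noteq> 0}) \<and> closure {x. v x \<noteq> 0} \<subseteq> \<Omega>"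

lemma test_function_square_integrable:
  fixes v :: "'a::euclidean_space \<Rightarrow> real"
  assumes "test_function \<Omega> v"
  shows "square_integrable (\<lambda>x. (v x, gradient v x))"
proof -
  define K where "K = closure {x. v x \<noteq> 0}"
  have K: "compact K" "closed K"
    using assms by (auto simp: test_function_def K_def)
  have C: "Ck 0 v" "Ck (Suc 0) v"
    using assms by (auto simp: test_function_def)
  have cont: "continuous_on UNIV (\<lambda>x. (v x, gradient v x))"
    unfolding gradient_def by (intro continuous_intros) (use C in auto)
  have out: "(v x, gradient v x) = 0" if "x \<notin> K" for x
  proof -
    have "(v has_derivative (\<lambda>_. 0)) (at x)"
    proof (rule has_derivative_transform_within_open)
      show "((\<lambda>_. 0) has_derivative (\<lambda>_. 0)) (at x)" by simp
      show "open (- K)" using K by auto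
      show "x \<in> - K" using that by simp
      show "0 = v y" if "y \<in> - K" for y
        using that closure_subset[of "{x. v x \<noteq> 0}"] by (auto simp: K_def)
    qed
    then have "frechet_derivative v (at x) = (\<lambda>_. 0)"
      using frechet_derivative_at by metis
    moreover have "v x = 0"
      using that closure_subset[of "{x. v x \<noteq> 0}"] by (auto simp: K_def)
    ultimately show ?thesis
      by (simp add: gradient_def zero_prod_def)
  qed
  have int: "integrable lborel (\<lambda>x. indicator K x *\<^sub>R (norm (v x, gradient v x))\<^sup>2)"
    by (rule borel_integrable_compact[OF K(1)])
       (intro continuous_intros continuous_on_subset[OF cont], simp)
  have eq: "indicator K x *\<^sub>R (norm (v x, gradient v x))\<^sup>2 = (norm (v x, gradient v x))\<^sup>2" for x
    using out[of x] by (auto simp: indicator_def)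
  have "(\<lambda>x. (v x, gradient v x)) \<in> borel_measurable lborel"
    using borel_measurable_continuous_onI[OF cont] by simp
  then show ?thesis
    using int unfolding square_integrable_def eq by (rule conjI)
qed

text \<open>An element \<open>u\<close> of the Sobolev space is carried together with its weak gradient, as the
  square-integrable function \<open>x \<mapsto> (u x, \<nabla>u x)\<close>, extended by zero outside \<open>\<Omega>\<close>. The \<open>L\<^sup>2\<close> inner
  product of such pairs is the integral of \<open>u v + \<nabla>u \<bullet> \<nabla>v\<close>, so inner product, norm and topology
  of the type \<open>l2\<close> are those of \<open>H\<^sup>1\<close>, and \<open>H10 \<Omega>\<close> is the closure of the test functions in
  that norm. Weak gradients being unique, the pair is determined by its first component; in
  particular it is zero iff \<open>u\<close> is zero almost everywhere.\<close>

type_synonym 'a sobolev = "('a, real \<times> 'a) l2"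

definition fn :: "'a::euclidean_space sobolev \<Rightarrow> 'a \<Rightarrow> real" where
  "fn u x = fst (rep_l2 u x)"

definition grad :: "'a::euclidean_space sobolev \<Rightarrow> 'a \<Rightarrow> 'a" where
  "grad u x = snd (rep_l2 u x)"

definition H10 :: "'a::euclidean_space set \<Rightarrow> 'a sobolev set" where
  "H10 \<Omega> = closure {abs_l2 (\<lambda>x. (v x, gradient v x)) |v. test_function \<Omega> v}"

lemma rep_l2_square_integrable: "square_integrable (rep_l2 u)"
  using Quotient3_rep_reflp[OF Quotient3_l2, of u] by (simp add: l2_rel_def)

lemma sobolev_inner:
  "u \<bullet> v = (\<integral>x. fn u x * fn v x + grad u x \<bullet> grad v x \<partial>lborel)"
  by (simp add: inner_l2.rep_eq fn_def grad_def inner_prod_def)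


section \<open>The operator, its inverse, and the iteration\<close>

text \<open>Elements of the dual \<open>H\<^sup>-\<^sup>1\<close> are functionals on \<open>H10 \<Omega>\<close>, made extensional by
  \<^const>\<open>restrict\<close>; application is the duality pairing. \<open>as_dual \<Omega> f\<close> is the functional given by
  a function \<open>f\<close> through the \<open>L\<^sup>2(\<Omega>)\<close> pairing, and \<open>Lop \<Omega>\<close> is \<open>I - \<Delta>\<close> in weak form.\<close>

definition as_dual ::
  "'a::euclidean_space set \<Rightarrow> ('a \<Rightarrow> real) \<Rightarrow> 'a sobolev \<Rightarrow> real" where
  "as_dual \<Omega> f = (\<lambda>v\<in>H10 \<Omega>. LINT x:\<Omega>|lborel. f x * fn v x)"

definition Lop :: "'a::euclidean_space set \<Rightarrow> 'a sobolev \<Rightarrow> 'a sobolev \<Rightarrow> real" where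
  "Lop \<Omega> u = (\<lambda>v\<in>H10 \<Omega>. LINT x:\<Omega>|lborel. fn u x * fn v x + grad u x \<bullet> grad v x)"

definition Linv :: "'a::euclidean_space set \<Rightarrow> ('a sobolev \<Rightarrow> real) \<Rightarrow> 'a sobolev" where
  "Linv \<Omega> = inv_into (H10 \<Omega>) (Lop \<Omega>)"

definition nonlin :: "real \<Rightarrow> 'a::euclidean_space sobolev \<Rightarrow> 'a \<Rightarrow> real" where
  "nonlin p u x = \<bar>fn u x\<bar> powr (p - 1) * fn u x"

definition Mfun :: "'a::euclidean_space set \<Rightarrow> real \<Rightarrow> 'a sobolev \<Rightarrow> real" where
  "Mfun \<Omega> p u = Lop \<Omega> u u / as_dual \<Omega> (nonlin p u) u"

definition Aop :: "'a::euclidean_space set \<Rightarrow> real \<Rightarrow> real \<Rightarrow> 'a sobolev \<Rightarrow> 'a sobolev" where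
  "Aop \<Omega> p \<gamma> u = (Mfun \<Omega> p u powr \<gamma>) *\<^sub>R Linv \<Omega> (as_dual \<Omega> (nonlin p u))"

definition weak_solution :: "'a::euclidean_space set \<Rightarrow> real \<Rightarrow> 'a sobolev \<Rightarrow> bool" where
  "weak_solution \<Omega> p \<phi> \<longleftrightarrow> \<phi> \<in> H10 \<Omega> \<and>
     (\<forall>v\<in>H10 \<Omega>. (LINT x:\<Omega>|lborel.
        grad \<phi> x \<bullet> grad v x + fn \<phi> x * fn v x - \<bar>fn \<phi> x\<bar> powr (p - 1) * fn \<phi> x * fn v x) = 0)"

definition Tphi ::
  "'a::euclidean_space set \<Rightarrow> real \<Rightarrow> 'a sobolev \<Rightarrow> 'a sobolev \<Rightarrow> 'a sobolev" where
  "Tphi \<Omega> p \<phi> h = Linv \<Omega> (as_dual \<Omega> (\<lambda>x. p * \<bar>fn \<phi> x\<bar> powr (p - 1) * fn h x))"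


section \<open>Spectrum and algebraic multiplicity\<close>

text \<open>For a linear operator \<open>T\<close> on a subspace \<open>S\<close> of a real normed space.\<close>

definition spectrum_on :: "'v::real_normed_vector set \<Rightarrow> ('v \<Rightarrow> 'v) \<Rightarrow> real set" where
  "spectrum_on S T = {\<mu>. \<not> (\<exists>R C.
     (\<forall>x\<in>S. R x \<in> S \<and> R (T x - \<mu> *\<^sub>R x) = x \<and> T (R x) - \<mu> *\<^sub>R R x = x) \<and>
     (\<forall>x\<in>S. norm (R x) \<le> C * norm x))}"

definition algebraic_multiplicity_on ::
  "'v::real_normed_vector set \<Rightarrow> ('v \<Rightarrow> 'v) \<Rightarrow> real \<Rightarrow> nat" where
  "algebraic_multiplicity_on S T \<mu> =
     dim {x \<in> S. \<exists>k. ((\<lambda>y. T y - \<mu> *\<^sub>R y) ^^ k) x = 0}"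

end

theory Submission
  imports Defs
begin

text \<open>
  The iteration map \<open>\<A>\<close> fixes \<open>\<phi>\<close>, so it suffices that its derivative there is a strict contraction in
  the Sobolev norm; every \<open>\<theta>\<close> between the norm of the derivative and one then works on a small
  ball.

  In the inner product of \<open>H\<^sub>0\<^sup>1\<close>, inverting \<open>I - \<Delta>\<close> is Riesz representation, and the derivative of
  \<open>G u = \<L>\<^sup>-\<^sup>1 (\<bar>u\<bar>\<^sup>p\<^sup>-\<^sup>1 u)\<close> at \<open>\<phi>\<close> is \<open>T = T\<^sub>\<phi>\<close>, a nonnegative symmetric operator with \<open>T \<phi> = p \<phi>\<close>
  (\<open>G_linearisation\<close>). The factor \<open>M\<^sup>\<gamma>\<close> equals one at \<open>\<phi>\<close>, and its derivative is
  \<open>\<gamma> (1 - p) \<langle>\<phi>, h\<rangle> / \<parallel>\<phi>\<parallel>\<^sup>2\<close> (\<open>multiplier_has_derivative\<close>). Hence the derivative of \<open>\<A>\<close> multiplies \<open>\<phi>\<close> by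
  \<open>p - \<gamma> (p - 1)\<close>, which lies in \<open>(-1, 1)\<close> by the choice of \<open>\<gamma>\<close>, and is \<open>T\<close> on the orthogonal complement
  of \<open>\<phi>\<close> (\<open>Aop_derivative_contraction\<close>).

  It remains to bound \<open>T\<close> on that complement by a constant less than one
  (\<open>contraction_on_complement_of_simple_eigenvector\<close>). The hypotheses say that from \<open>1\<close> upwards the
  spectrum is the simple eigenvalue \<open>p\<close>. What has to be excluded is spectrum at \<open>p\<close> remaining after
  \<open>\<phi>\<close> is split off. The gap below \<open>p\<close> excludes it: \<open>A = p - T\<close> satisfies \<open>A\<^sup>2 \<ge> \<epsilon> A\<close>, so its form
  is at least \<open>\<epsilon>\<close> on its range, and the range is dense in the complement of the kernel. A
  point \<open>\<mu>\<close> of the resolvent set enters through a lower bound for \<open>\<parallel>T x - \<mu> x\<parallel>\<close>, which turns into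
  inequalities between quadratic forms.

  The analytic input is the subcritical embedding of \<open>H\<^sub>0\<^sup>1\<close> into \<open>L\<^sup>p\<^sup>+\<^sup>1\<close> (\<open>Sobolev_inequality\<close>). It is
  obtained by bootstrapping: a bound in \<open>L\<^sup>q\<close> and the fact that a translation by \<open>z\<close> moves \<open>v\<close> in \<open>L\<^sup>2\<close> by
  at most \<open>\<bar>z\<bar> \<parallel>\<nabla>v\<parallel>\<close> give a decay of the level sets of \<open>v\<close> that improves the exponent
  (\<open>level_set_estimate\<close>, \<open>integrability_gain\<close>), and finitely many steps reach every subcritical one.
\<close>

section \<open>Riesz representation on a closed subspace\<close>

lemma subspace_closure:
  fixes S :: "'v::real_normed_vector set"
  assumes S: "subspace S"
  shows "subspace (closure S)"
proof (rule subspaceI)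
  show "0 \<in> closure S"
    using closure_subset[of S] subspace_0[OF S] by auto
  show "x + y \<in> closure S" if xy: "x \<in> closure S" "y \<in> closure S" for x y
  proof -
    obtain f g where "\<And>n. f n \<in> S" "f \<longlonglongrightarrow> x" "\<And>n. g n \<in> S" "g \<longlonglongrightarrow> y"
      using xy unfolding closure_sequential by blast
    then show ?thesis
      unfolding closure_sequential using subspace_add[OF S]
      by (intro exI[of _ "\<lambda>n. f n + g n"]) (auto intro: tendsto_add)
  qed
  show "c *\<^sub>R x \<in> closure S" if x: "x \<in> closure S" for c x
  proof -
    obtain f where "\<And>n. f n \<in> S" "f \<longlonglongrightarrow> x"
      using x unfolding closure_sequential by blast
    then show ?thesis
      unfolding closure_sequential using subspace_scale[OF S]
      by (intro exI[of _ "\<lambda>n. c *\<^sub>R f n"]) (auto intro: tendsto_scaleR)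
  qed
qed

lemma tendsto_zero_of_norm_le:
  fixes f :: "nat \<Rightarrow> 'b::real_normed_vector" and x :: "nat \<Rightarrow> 'c::real_normed_vector"
  assumes "\<And>n. norm (f n) \<le> C * norm (w - x n)" and "x \<longlonglongrightarrow> w"
  shows "f \<longlonglongrightarrow> 0"
proof (rule Lim_null_comparison)
  show "\<forall>\<^sub>F n in sequentially. norm (f n) \<le> C * norm (w - x n)"
    using assms(1) by (rule always_eventually[OF allI])
  have "(\<lambda>n. C * norm (w - x n)) \<longlonglongrightarrow> C * norm (w - w)"
    by (intro tendsto_intros assms(2))
  then show "(\<lambda>n. C * norm (w - x n)) \<longlonglongrightarrow> 0" by simp
qed

lemma quadratic_nonneg_imp_discriminant:
  fixes a b c :: real
  assumes "\<And>t. 0 \<le> a + 2 * b * t + c * t\<^sup>2"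
  shows "b\<^sup>2 \<le> a * c"
proof (cases "c = 0")
  case True
  have "b = 0"
  proof (rule ccontr)
    assume "b \<noteq> 0"
    then show False
      using assms[of "- (a + 1) / (2 * b)"] True by (simp add: field_simps)
  qed
  with True show ?thesis by simp
next
  case False
  have "0 \<le> c"
  proof (rule ccontr)
    assume c: "\<not> 0 \<le> c"
    have "0 \<le> a + c * t\<^sup>2" for t
      using assms[of t] assms[of "-t"] by simp
    moreover have "c * (sqrt ((\<bar>a\<bar> + 1) / (- c)))\<^sup>2 = - (\<bar>a\<bar> + 1)"
    proof -
      have "0 \<le> (\<bar>a\<bar> + 1) / (- c)" using c by (intro divide_nonneg_pos) auto
      then have "(sqrt ((\<bar>a\<bar> + 1) / (- c)))\<^sup>2 = (\<bar>a\<bar> + 1) / (- c)" by (rule real_sqrt_pow2)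
      then show ?thesis using c by simp
    qed
    ultimately show False
      using abs_ge_self[of a] by (smt (verit))
  qed
  with False have "0 < c" by simp
  then show ?thesis
    using assms[of "- b / c"] by (simp add: field_simps power2_eq_square)
qed

text \<open>The representing vector minimises \<open>\<parallel>v\<parallel>\<^sup>2 - 2 l v\<close>; by the parallelogram law every minimising
  sequence is Cauchy.\<close>

theorem riesz_representation_on:
  fixes H :: "'v::{real_inner,complete_space} set" and l :: "'v \<Rightarrow> real"
  assumes H: "subspace H" "closed H"
    and add: "\<And>x y. x \<in> H \<Longrightarrow> y \<in> H \<Longrightarrow> l (x + y) = l x + l y"
    and scale: "\<And>c x. x \<in> H \<Longrightarrow> l (c *\<^sub>R x) = c * l x"
    and bound: "\<And>x. x \<in> H \<Longrightarrow> \<bar>l x\<bar> \<le> C * norm x"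
  shows "\<exists>w\<in>H. \<forall>v\<in>H. w \<bullet> v = l v"
proof -
  define J where "J v = v \<bullet> v - 2 * l v" for v
  define m where "m = (INF v\<in>H. J v)"
  have zero: "0 \<in> H" using H(1) by (simp add: subspace_0)
  have lower: "- C\<^sup>2 \<le> J v" if "v \<in> H" for v
  proof -
    have "0 \<le> (norm v - C)\<^sup>2" by simp
    then show ?thesis
      using bound[OF that] unfolding J_def dot_square_norm
      by (simp add: power2_eq_square algebra_simps)
  qed
  have bdd: "bdd_below (J ` H)"
    using lower by (rule bdd_belowI2)
  have m_le: "m \<le> J v" if "v \<in> H" for v
    unfolding m_def using bdd that by (rule cINF_lower)
  have par: "(norm (x - y))\<^sup>2 \<le> 2 * (J x - m) + 2 * (J y - m)" if "x \<in> H" "y \<in> H" for x y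
  proof -
    let ?z = "(1/2) *\<^sub>R (x + y)"
    have z: "?z \<in> H" using that H(1) by (simp add: subspace_add subspace_scale)
    have "l ?z = (l x + l y) / 2"
      using that H(1) by (simp add: scale add subspace_add)
    then have "J x + J y = 2 * J ?z + (norm (x - y))\<^sup>2 / 2"
      unfolding J_def power2_norm_eq_inner
      by (simp add: inner_add_left inner_add_right inner_diff_left inner_diff_right inner_commute
          field_simps)
    with m_le[OF z] show ?thesis by (simp add: field_simps)
  qed
  have "\<exists>x\<in>H. J x < m + 1 / (real n + 1)" for n
  proof -
    have "m < m + 1 / (real n + 1)" by simp
    then show ?thesis
      unfolding m_def using cINF_less_iff[OF _ bdd] zero by blast
  qed
  then obtain x where x: "\<And>n. x n \<in> H" "\<And>n. J (x n) < m + 1 / (real n + 1)"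
    by metis
  have "Cauchy x"
  proof (rule CauchyI)
    fix e :: real assume "0 < e"
    then obtain N :: nat where N: "4 / e\<^sup>2 < real N" using reals_Archimedean2 by blast
    have "norm (x i - x j) < e" if "N \<le> i" "N \<le> j" for i j
    proof -
      have s: "J (x k) < m + e\<^sup>2 / 4" if "N \<le> k" for k
      proof -
        have "4 / e\<^sup>2 < real k + 1" using N that by linarith
        then have "1 / (real k + 1) < e\<^sup>2 / 4" using \<open>0 < e\<close> by (simp add: field_simps)
        with x(2)[of k] show ?thesis by linarith
      qed
      have "(norm (x i - x j))\<^sup>2 < e\<^sup>2"
        using par[OF x(1) x(1), of i j] s[OF that(1)] s[OF that(2)] by argo
      then show ?thesis using \<open>0 < e\<close> by (simp add: power2_less_imp_less)
    qed
    then show "\<exists>M. \<forall>m\<ge>M. \<forall>n\<ge>M. norm (x m - x n) < e" by blast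
  qed
  then obtain w where w: "x \<longlonglongrightarrow> w" using Cauchy_convergent convergent_def by blast
  have wH: "w \<in> H" using H(2) x(1) w by (rule closed_sequentially)
  have "norm (l w - l (x n)) \<le> C * norm (w - x n)" for n
  proof -
    have "l w = l (w - x n) + l (x n)"
      using add[of "w - x n" "x n"] wH x(1) H(1) by (simp add: subspace_diff)
    then show ?thesis using bound[of "w - x n"] wH x(1) H(1) by (simp add: subspace_diff)
  qed
  then have "(\<lambda>n. l w - l (x n)) \<longlonglongrightarrow> 0" using w by (rule tendsto_zero_of_norm_le)
  from tendsto_diff[OF tendsto_const[of "l w"] this]
  have lim_l: "(\<lambda>n. l (x n)) \<longlonglongrightarrow> l w" by simp
  have Jw: "J w \<le> m"
  proof (rule LIMSEQ_le)
    show "(\<lambda>n. J (x n)) \<longlonglongrightarrow> J w"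
      unfolding J_def by (intro tendsto_intros w lim_l)
    show "(\<lambda>n. m + 1 / (real n + 1)) \<longlonglongrightarrow> m"
      using tendsto_add[OF tendsto_const LIMSEQ_inverse_real_of_nat, of m]
      by (simp add: inverse_eq_divide add.commute)
    show "\<exists>N. \<forall>n\<ge>N. J (x n) \<le> m + 1 / (real n + 1)"
      using x(2) less_imp_le by blast
  qed
  have "w \<bullet> v = l v" if v: "v \<in> H" for v
  proof -
    have "0 \<le> 0 + 2 * (w \<bullet> v - l v) * t + (v \<bullet> v) * t\<^sup>2" for t
    proof -
      have "w + t *\<^sub>R v \<in> H" using wH v H(1) by (simp add: subspace_add subspace_scale)
      then have "J w \<le> J (w + t *\<^sub>R v)" using m_le Jw by fastforce
      moreover have "J (w + t *\<^sub>R v) = J w + 2 * (w \<bullet> v - l v) * t + (v \<bullet> v) * t\<^sup>2"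
        unfolding J_def using wH v H(1)
        by (simp add: add scale subspace_scale algebra_simps inner_commute power2_eq_square)
      ultimately show ?thesis by simp
    qed
    from quadratic_nonneg_imp_discriminant[OF this] show ?thesis by simp
  qed
  with wH show ?thesis by blast
qed

section \<open>Symmetric operators on a closed subspace\<close>

definition bounded_below_on :: "'v::real_normed_vector set \<Rightarrow> ('v \<Rightarrow> 'v) \<Rightarrow> bool" where
  "bounded_below_on H S \<longleftrightarrow> (\<exists>c>0. \<forall>x\<in>H. c * norm x \<le> norm (S x))"

lemma bounded_below_on_compose:
  assumes "bounded_below_on H S" "bounded_below_on H T" "\<And>x. x \<in> H \<Longrightarrow> T x \<in> H"
  shows "bounded_below_on H (\<lambda>x. S (T x))"
proof -
  obtain c d where "0 < c" "0 < d" and cd: "\<And>x. x \<in> H \<Longrightarrow> c * norm x \<le> norm (S x)"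
    "\<And>x. x \<in> H \<Longrightarrow> d * norm x \<le> norm (T x)"
    using assms by (auto simp: bounded_below_on_def)
  moreover have "c * d * norm x \<le> norm (S (T x))" if "x \<in> H" for x
    using order.trans[OF mult_left_mono[OF cd(2)[OF that], of c] cd(1)[OF assms(3)[OF that]]] \<open>0 < c\<close>
    by (simp add: mult.assoc)
  ultimately show ?thesis
    unfolding bounded_below_on_def by (intro exI[of _ "c * d"]) simp
qed

text \<open>The operator is only constrained on the carrier \<open>H\<close>: operators built from weak formulations have
  no meaningful values outside the space on which the problem is posed.\<close>

locale symmetric_operator_on =
  fixes H :: "'v::{real_inner,complete_space} set" and T :: "'v \<Rightarrow> 'v"
  assumes subspace: "subspace H" and closed: "closed H"
    and maps: "x \<in> H \<Longrightarrow> T x \<in> H"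
    and add: "x \<in> H \<Longrightarrow> y \<in> H \<Longrightarrow> T (x + y) = T x + T y"
    and scale: "x \<in> H \<Longrightarrow> T (c *\<^sub>R x) = c *\<^sub>R T x"
    and symmetric: "x \<in> H \<Longrightarrow> y \<in> H \<Longrightarrow> T x \<bullet> y = x \<bullet> T y"
    and bounded: "\<exists>B. \<forall>x\<in>H. norm (T x) \<le> B * norm x"
begin

lemma diff: "x \<in> H \<Longrightarrow> y \<in> H \<Longrightarrow> T (x - y) = T x - T y"
  using add[of x "- y"] scale[of y "-1"] subspace by (simp add: subspace_neg)

lemma pos_bound:
  obtains B where "0 < B" "\<And>x. x \<in> H \<Longrightarrow> norm (T x) \<le> B * norm x"
proof -
  obtain B where B: "\<And>x. x \<in> H \<Longrightarrow> norm (T x) \<le> B * norm x" using bounded by blast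
  show ?thesis
  proof (rule that[of "\<bar>B\<bar> + 1"])
    fix x assume "x \<in> H"
    moreover have "B * norm x \<le> (\<bar>B\<bar> + 1) * norm x" by (intro mult_right_mono) auto
    ultimately show "norm (T x) \<le> (\<bar>B\<bar> + 1) * norm x" using B by fastforce
  qed simp
qed

lemma shift: "symmetric_operator_on H (\<lambda>x. T x - \<mu> *\<^sub>R x)"
proof unfold_locales
  obtain B where B: "\<And>x. x \<in> H \<Longrightarrow> norm (T x) \<le> B * norm x" using bounded by blast
  have "norm (T x - \<mu> *\<^sub>R x) \<le> (B + \<bar>\<mu>\<bar>) * norm x" if "x \<in> H" for x
    using norm_triangle_ineq4[of "T x" "\<mu> *\<^sub>R x"] B[OF that] by (simp add: distrib_right)
  then show "\<exists>B. \<forall>x\<in>H. norm (T x - \<mu> *\<^sub>R x) \<le> B * norm x" by blast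
qed (use subspace closed in \<open>auto simp: maps add scale symmetric subspace_diff subspace_scale
  inner_diff_left inner_diff_right algebra_simps\<close>)

lemma minus: "symmetric_operator_on H (\<lambda>x. - T x)"
  by unfold_locales (use subspace closed bounded in \<open>auto simp: maps add scale symmetric subspace_neg\<close>)

lemma square: "symmetric_operator_on H (\<lambda>x. T (T x))"
proof unfold_locales
  obtain B where B: "0 < B" "\<And>x. x \<in> H \<Longrightarrow> norm (T x) \<le> B * norm x" using pos_bound by blast
  have "norm (T (T x)) \<le> (B * B) * norm x" if "x \<in> H" for x
    using order.trans[OF B(2)[OF maps[OF that]] mult_left_mono[OF B(2)[OF that], of B]] B(1)
    by (simp add: mult.assoc)
  then show "\<exists>B. \<forall>x\<in>H. norm (T (T x)) \<le> B * norm x" by blast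
qed (use subspace closed in \<open>auto simp: maps add scale symmetric\<close>)

lemma form_Cauchy_Schwarz:
  assumes nonneg: "\<And>x. x \<in> H \<Longrightarrow> 0 \<le> T x \<bullet> x" and "x \<in> H" "y \<in> H"
  shows "(T x \<bullet> y)\<^sup>2 \<le> (T x \<bullet> x) * (T y \<bullet> y)"
proof (rule quadratic_nonneg_imp_discriminant)
  fix t
  have "T (x + t *\<^sub>R y) \<bullet> (x + t *\<^sub>R y) = T x \<bullet> x + 2 * (T x \<bullet> y) * t + (T y \<bullet> y) * t\<^sup>2"
    using assms(2,3) subspace symmetric[of y x]
    by (simp add: add scale subspace_scale algebra_simps inner_commute power2_eq_square)
  moreover have "x + t *\<^sub>R y \<in> H"
    using assms(2,3) subspace by (simp add: subspace_add subspace_scale)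
  ultimately show "0 \<le> T x \<bullet> x + 2 * (T x \<bullet> y) * t + (T y \<bullet> y) * t\<^sup>2"
    using nonneg by metis
qed

text \<open>The Cauchy-Schwarz inequality of the form, applied to \<open>x\<close> and \<open>T x\<close>, bounds \<open>\<parallel>T x\<parallel>\<^sup>2\<close> by the
  value of the form at \<open>x\<close>.\<close>

lemma norm_le_form:
  assumes nonneg: "\<And>x. x \<in> H \<Longrightarrow> 0 \<le> T x \<bullet> x"
    and upper: "T (T x) \<bullet> T x \<le> b * (T x \<bullet> T x)" and x: "x \<in> H"
  shows "(norm (T x))\<^sup>2 \<le> b * (T x \<bullet> x)"
proof (cases "T x = 0")
  case False
  have "(T x \<bullet> T x)\<^sup>2 \<le> (T x \<bullet> x) * (T (T x) \<bullet> T x)"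
    using form_Cauchy_Schwarz[OF nonneg x maps[OF x]] by simp
  also have "\<dots> \<le> (T x \<bullet> x) * (b * (T x \<bullet> T x))"
    using upper nonneg[OF x] by (rule mult_left_mono)
  finally have "(T x \<bullet> T x) * (T x \<bullet> T x) \<le> (b * (T x \<bullet> x)) * (T x \<bullet> T x)"
    by (simp add: power2_eq_square algebra_simps)
  then have "T x \<bullet> T x \<le> b * (T x \<bullet> x)"
    using False by (simp add: mult_le_cancel_right)
  then show ?thesis by (simp add: power2_norm_eq_inner)
qed simp

text \<open>An upper bound \<open>B\<close> of the operator gives \<open>\<parallel>T x\<parallel>\<^sup>2 \<le> B (T x \<bullet> x)\<close> by the preceding inequality, so a
  lower bound for \<open>\<parallel>T x\<parallel>\<close> is inherited by the form. This is how regular points of the spectrum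
  turn into inequalities between forms.\<close>

lemma bounded_below_imp_coercive:
  assumes nonneg: "\<And>x. x \<in> H \<Longrightarrow> 0 \<le> T x \<bullet> x" and "bounded_below_on H T"
  shows "\<exists>c>0. \<forall>x\<in>H. c * (x \<bullet> x) \<le> T x \<bullet> x"
proof -
  obtain c where c: "0 < c" "\<And>x. x \<in> H \<Longrightarrow> c * norm x \<le> norm (T x)"
    using assms(2) by (auto simp: bounded_below_on_def)
  obtain B where B: "0 < B" "\<And>x. x \<in> H \<Longrightarrow> norm (T x) \<le> B * norm x" using pos_bound by blast
  have "c\<^sup>2 / B * (x \<bullet> x) \<le> T x \<bullet> x" if x: "x \<in> H" for x
  proof -
    have "T y \<bullet> y \<le> B * (y \<bullet> y)" if "y \<in> H" for y
      using norm_cauchy_schwarz[of "T y" y] mult_right_mono[OF B(2)[OF that] norm_ge_zero[of y]]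
      by (simp add: dot_square_norm power2_eq_square)
    from norm_le_form[OF nonneg this x] x maps have "(norm (T x))\<^sup>2 \<le> B * (T x \<bullet> x)" by blast
    moreover have "(c * norm x)\<^sup>2 \<le> (norm (T x))\<^sup>2"
      using c x by (intro power_mono) auto
    ultimately show ?thesis
      using B(1) by (simp add: dot_square_norm power_mult_distrib field_simps)
  qed
  then show ?thesis using c(1) B(1) by (intro exI[of _ "c\<^sup>2 / B"]) simp
qed

text \<open>Let \<open>m\<close> be the infimum of the form on the unit sphere. If \<open>T - m\<close> were bounded below, its form
  would be coercive and the infimum not optimal.\<close>

lemma bottom_of_form:
  assumes \<phi>: "\<phi> \<in> H" "\<phi> \<noteq> 0"
  obtains m where "\<And>x. x \<in> H \<Longrightarrow> m * (x \<bullet> x) \<le> T x \<bullet> x"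
    "\<not> bounded_below_on H (\<lambda>x. T x - m *\<^sub>R x)"
proof -
  define Q where "Q x = T x \<bullet> x / (x \<bullet> x)" for x
  define m where "m = (INF x\<in>H - {0}. Q x)"
  obtain B where B: "0 < B" "\<And>x. x \<in> H \<Longrightarrow> norm (T x) \<le> B * norm x" using pos_bound by blast
  have "- B \<le> Q x" if "x \<in> H - {0}" for x
  proof -
    have "\<bar>T x \<bullet> x\<bar> \<le> B * (x \<bullet> x)"
      using order.trans[OF Cauchy_Schwarz_ineq2[of "T x" x]
          mult_right_mono[OF B(2)[of x] norm_ge_zero[of x]]] that
      by (simp add: dot_square_norm power2_eq_square mult.assoc)
    moreover have "0 < x \<bullet> x" using that by simp
    ultimately show ?thesis unfolding Q_def by (simp add: field_simps)
  qed
  then have bdd: "bdd_below (Q ` (H - {0}))" by (rule bdd_belowI2)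
  have low: "m * (x \<bullet> x) \<le> T x \<bullet> x" if "x \<in> H" for x
  proof (cases "x = 0")
    case False
    then have "m \<le> Q x" unfolding m_def using bdd that by (intro cINF_lower) auto
    moreover have "0 < x \<bullet> x" using False by simp
    ultimately show ?thesis unfolding Q_def by (simp add: field_simps)
  qed simp
  interpret S: symmetric_operator_on H "\<lambda>x. T x - m *\<^sub>R x" by (rule shift)
  have "\<not> bounded_below_on H (\<lambda>x. T x - m *\<^sub>R x)"
  proof
    assume "bounded_below_on H (\<lambda>x. T x - m *\<^sub>R x)"
    then obtain c where c: "0 < c" "\<And>x. x \<in> H \<Longrightarrow> c * (x \<bullet> x) \<le> (T x - m *\<^sub>R x) \<bullet> x"
      using S.bounded_below_imp_coercive low by (auto simp: inner_diff_left)
    have "m + c \<le> Q x" if "x \<in> H - {0}" for x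
    proof -
      have "0 < x \<bullet> x" using that by simp
      then show ?thesis using c(2)[of x] that unfolding Q_def
        by (simp add: field_simps inner_diff_left)
    qed
    then have "m + c \<le> m"
      unfolding m_def using \<phi> by (intro cINF_greatest) auto
    with c(1) show False by simp
  qed
  with low show ?thesis by (rule that)
qed

text \<open>Let \<open>\<mu>\<close> be the midpoint of the gap and \<open>m\<close> the bottom of \<open>(T - \<mu>)\<^sup>2\<close>. If \<open>m\<close> were nonnegative and
  less than the square of half the gap, then \<open>(T - \<mu>)\<^sup>2 - m\<close> would factor through the two points
  \<open>\<mu> \<plusminus> \<surd>m\<close> of the gap and be bounded below, which the bottom of a form forbids. So \<open>m\<close> is at least
  that square; expanding gives \<open>(T - a) (T - b) \<ge> 0\<close>.\<close>

lemma spectral_gap: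
  assumes gap: "\<And>\<mu>. a < \<mu> \<Longrightarrow> \<mu> < b \<Longrightarrow> bounded_below_on H (\<lambda>x. T x - \<mu> *\<^sub>R x)"
    and "a < b" and x: "x \<in> H"
  shows "0 \<le> T x \<bullet> T x - (a + b) * (T x \<bullet> x) + a * b * (x \<bullet> x)"
proof (cases "x = 0")
  case True
  then show ?thesis using scale[OF x, of 0] by simp
next
  case False
  define \<mu> \<rho> where "\<mu> = (a + b) / 2" and "\<rho> = (b - a) / 2"
  interpret U: symmetric_operator_on H "\<lambda>x. T x - \<mu> *\<^sub>R x" by (rule shift)
  let ?U = "\<lambda>x. T x - \<mu> *\<^sub>R x"
  interpret W: symmetric_operator_on H "\<lambda>x. ?U (?U x)" by (rule U.square)
  obtain m where m: "\<And>x. x \<in> H \<Longrightarrow> m * (x \<bullet> x) \<le> ?U (?U x) \<bullet> x"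
    and nb: "\<not> bounded_below_on H (\<lambda>x. ?U (?U x) - m *\<^sub>R x)"
    using W.bottom_of_form[OF x False] by blast
  have "\<rho>\<^sup>2 \<le> m"
  proof (rule ccontr)
    assume less: "\<not> \<rho>\<^sup>2 \<le> m"
    define c where "c = sqrt \<bar>m\<bar>"
    show False
    proof (cases "0 \<le> m")
      case True
      then have c: "0 \<le> c" "c\<^sup>2 = m" by (simp_all add: c_def)
      then have "c < \<rho>"
        using less \<open>a < b\<close> power_mono[of \<rho> c 2] by (force simp: \<rho>_def)
      then have "bounded_below_on H (\<lambda>x. T x - (\<mu> + c) *\<^sub>R x)"
        "bounded_below_on H (\<lambda>x. T x - (\<mu> - c) *\<^sub>R x)"
        using c \<open>a < b\<close> by (auto intro!: gap simp: \<mu>_def \<rho>_def field_simps)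
      then have "bounded_below_on H (\<lambda>x. T (T x - (\<mu> - c) *\<^sub>R x) - (\<mu> + c) *\<^sub>R (T x - (\<mu> - c) *\<^sub>R x))"
        by (rule bounded_below_on_compose) (use maps subspace in \<open>simp add: subspace_diff subspace_scale\<close>)
      moreover have "T (T x - (\<mu> - c) *\<^sub>R x) - (\<mu> + c) *\<^sub>R (T x - (\<mu> - c) *\<^sub>R x)
          = ?U (?U x) - m *\<^sub>R x" if "x \<in> H" for x
        using that subspace unfolding c(2)[symmetric]
        by (simp add: diff scale maps subspace_scale subspace_diff scaleR_diff_left
            scaleR_diff_right scaleR_add_left power2_eq_square) (simp add: algebra_simps)
      ultimately show False using nb by (simp add: bounded_below_on_def)
    next
      case False
      \<comment> \<open>A square has a nonnegative form, so every negative number is regular for it.\<close>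
      have "- m * norm x \<le> norm (?U (?U x) - m *\<^sub>R x)" if "x \<in> H" for x
      proof -
        have "- m * (x \<bullet> x) \<le> (?U (?U x) - m *\<^sub>R x) \<bullet> x"
          using U.symmetric[OF U.maps[OF that] that] inner_ge_zero[of "?U x"]
          by (simp add: inner_diff_left)
        also have "\<dots> \<le> norm (?U (?U x) - m *\<^sub>R x) * norm x" by (rule norm_cauchy_schwarz)
        finally have "(- m * norm x) * norm x \<le> norm (?U (?U x) - m *\<^sub>R x) * norm x"
          by (simp add: dot_square_norm power2_eq_square)
        then show ?thesis
            using mult_right_le_imp_le[of "- m * norm x" "norm x"] by (cases "x = 0") auto
      qed
      then show False
        using nb False unfolding bounded_below_on_def by (meson neg_0_less_iff_less not_le)
    qed
  qed
  then have "\<rho>\<^sup>2 * (x \<bullet> x) \<le> ?U (?U x) \<bullet> x"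
    using m[OF x] mult_right_mono[of "\<rho>\<^sup>2" m "x \<bullet> x"] by simp
  also have "\<dots> = ?U x \<bullet> ?U x" using U.symmetric[OF U.maps[OF x] x] by simp
  also have "\<dots> = T x \<bullet> T x - 2 * \<mu> * (T x \<bullet> x) + \<mu>\<^sup>2 * (x \<bullet> x)"
    by (simp add: algebra_simps inner_commute power2_eq_square)
  finally show ?thesis
    unfolding \<mu>_def \<rho>_def by (simp add: field_simps power2_eq_square)
qed

text \<open>The point \<open>1\<close> is regular, so the gap below \<open>p\<close> reaches down to some \<open>a < 1\<close>. With
  \<open>A = p - T \<ge> 0\<close> the gap says \<open>A\<^sup>2 \<ge> (p - a) A\<close>. The Cauchy-Schwarz inequality of the form of \<open>A\<close>
  turns this into the lower bound \<open>p - a\<close> for the form on the range of \<open>A\<close>, which is dense in the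
  complement of the kernel. On that complement the form of \<open>T\<close> is therefore at most \<open>a\<close>, and for a
  nonnegative operator this bounds the norm.\<close>

theorem contraction_on_complement_of_simple_eigenvector:
  assumes nonneg: "\<And>x. x \<in> H \<Longrightarrow> 0 \<le> T x \<bullet> x"
    and \<phi>: "\<phi> \<in> H" "\<phi> \<noteq> 0" "T \<phi> = p *\<^sub>R \<phi>" and p: "1 < p"
    and regular: "\<And>\<mu>. 1 \<le> \<mu> \<Longrightarrow> \<mu> \<noteq> p \<Longrightarrow> bounded_below_on H (\<lambda>x. T x - \<mu> *\<^sub>R x)"
    and simple: "\<And>x. x \<in> H \<Longrightarrow> T x = p *\<^sub>R x \<Longrightarrow> x \<in> span {\<phi>}"
  obtains a where "0 \<le> a" "a < 1" "\<And>y. y \<in> H \<Longrightarrow> y \<bullet> \<phi> = 0 \<Longrightarrow> norm (T y) \<le> a * norm y"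
proof -
  obtain c where c: "0 < c" "\<And>x. x \<in> H \<Longrightarrow> c * norm x \<le> norm (T x - 1 *\<^sub>R x)"
    using regular[of 1] p by (auto simp: bounded_below_on_def)
  \<comment> \<open>Half of the lower bound \<open>c\<close> at \<open>1\<close> survives a shift by \<open>c / 2\<close>; the cap keeps \<open>a\<close> nonnegative.\<close>
  define a where "a = 1 - min c 1 / 2"
  have a: "0 \<le> a" "a < 1" using c(1) by (auto simp: a_def)
  have gap: "bounded_below_on H (\<lambda>x. T x - \<mu> *\<^sub>R x)" if "a < \<mu>" "\<mu> < p" for \<mu>
  proof (cases "1 \<le> \<mu>")
    case True
    with that show ?thesis by (intro regular) auto
  next
    case False
    have "c / 2 * norm x \<le> norm (T x - \<mu> *\<^sub>R x)" if "x \<in> H" for x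
    proof -
      have "norm (T x - 1 *\<^sub>R x) \<le> norm (T x - \<mu> *\<^sub>R x) + norm ((1 - \<mu>) *\<^sub>R x)"
        using norm_triangle_ineq4[of "T x - \<mu> *\<^sub>R x" "(1 - \<mu>) *\<^sub>R x"] by (simp add: algebra_simps)
      moreover have "norm ((1 - \<mu>) *\<^sub>R x) \<le> c / 2 * norm x"
      proof -
        have "\<bar>1 - \<mu>\<bar> \<le> c / 2" using False \<open>a < \<mu>\<close> by (simp add: a_def)
        then show ?thesis using mult_right_mono[of "\<bar>1 - \<mu>\<bar>" "c / 2" "norm x"] by simp
      qed
      ultimately show ?thesis using c(2)[OF that] by simp
    qed
    then show ?thesis using c(1) unfolding bounded_below_on_def by (intro exI[of _ "c / 2"]) auto
  qed
  \<comment> \<open>The top of the form is a point of the approximate spectrum, hence is \<open>p\<close> or lies below \<open>1\<close>.\<close>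
  have upper: "T x \<bullet> x \<le> p * (x \<bullet> x)" if x: "x \<in> H" for x
  proof -
    interpret N: symmetric_operator_on H "\<lambda>x. - T x" by (rule minus)
    obtain m where m: "\<And>x. x \<in> H \<Longrightarrow> m * (x \<bullet> x) \<le> - T x \<bullet> x"
      and nb: "\<not> bounded_below_on H (\<lambda>x. - T x - m *\<^sub>R x)"
      using N.bottom_of_form[OF \<phi>(1,2)] by blast
    have "norm (- T x - m *\<^sub>R x) = norm (T x - (- m) *\<^sub>R x)" for x
      using norm_minus_cancel[of "T x - (- m) *\<^sub>R x"] by (simp add: algebra_simps)
    then have "\<not> bounded_below_on H (\<lambda>x. T x - (- m) *\<^sub>R x)"
      using nb unfolding bounded_below_on_def by simp
    then have "- m \<le> p" using regular[of "- m"] p by (cases "1 \<le> - m") auto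
    then have "- p * (x \<bullet> x) \<le> m * (x \<bullet> x)" by (intro mult_right_mono) auto
    with m[OF x] show ?thesis by simp
  qed
  define A where "A x = - (T x - p *\<^sub>R x)" for x
  interpret S: symmetric_operator_on H "\<lambda>x. T x - p *\<^sub>R x" by (rule shift)
  interpret A: symmetric_operator_on H A unfolding A_def by (rule S.minus)
  define \<epsilon> where "\<epsilon> = p - a"
  have \<epsilon>: "0 < \<epsilon>" using a p by (simp add: \<epsilon>_def)
  have A_nonneg: "0 \<le> A x \<bullet> x" if "x \<in> H" for x
    using upper[OF that] by (simp add: A_def inner_diff_left)
  have A_gap: "\<epsilon> * (A x \<bullet> x) \<le> A x \<bullet> A x" if "x \<in> H" for x
    using spectral_gap[OF gap _ that, of a p] a p
    by (simp add: A_def \<epsilon>_def algebra_simps inner_commute power2_eq_square)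
  have on_range: "\<epsilon> * (A x \<bullet> A x) \<le> A (A x) \<bullet> A x" if x: "x \<in> H" for x
  proof (cases "A x = 0")
    case False
    have "(A x \<bullet> A x)\<^sup>2 * \<epsilon> \<le> (A x \<bullet> x) * (A (A x) \<bullet> A x) * \<epsilon>"
      using A.form_Cauchy_Schwarz[OF A_nonneg x A.maps[OF x]] \<epsilon> by simp
    also have "\<dots> = (\<epsilon> * (A x \<bullet> x)) * (A (A x) \<bullet> A x)" by simp
    also have "\<dots> \<le> (A x \<bullet> A x) * (A (A x) \<bullet> A x)"
      using A_gap[OF x] A_nonneg[OF A.maps[OF x]] by (rule mult_right_mono)
    finally have "(A x \<bullet> A x) * (\<epsilon> * (A x \<bullet> A x)) \<le> (A x \<bullet> A x) * (A (A x) \<bullet> A x)"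
      by (simp add: power2_eq_square algebra_simps)
    then show ?thesis using False by (simp add: mult_le_cancel_left)
  qed simp
  define W where "W = closure (A ` H)"
  have AH: "subspace (A ` H)"
  proof (rule subspaceI)
    have "A 0 = 0" using A.scale[of 0 0] subspace_0[OF subspace] by simp
    then show "0 \<in> A ` H" using subspace_0[OF subspace] by (metis imageI)
    show "u + v \<in> A ` H" if uv: "u \<in> A ` H" "v \<in> A ` H" for u v
    proof -
      obtain x y where xy: "x \<in> H" "y \<in> H" "u = A x" "v = A y" using uv by blast
      then have "u + v = A (x + y)" by (simp add: A.add)
      then show ?thesis using xy subspace_add[OF subspace] by blast
    qed
    show "k *\<^sub>R u \<in> A ` H" if u: "u \<in> A ` H" for k u
    proof -
      obtain x where x: "x \<in> H" "u = A x" using u by blast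
      then have "k *\<^sub>R u = A (k *\<^sub>R x)" by (simp add: A.scale)
      then show ?thesis using x subspace_scale[OF subspace] by blast
    qed
  qed
  have W: "subspace W" "closed W"
    unfolding W_def using subspace_closure[OF AH] by simp_all
  have "A ` H \<subseteq> H" using A.maps by blast
  then have WH: "W \<subseteq> H" unfolding W_def using closed by (rule closure_minimal)
  have W_seq: "\<exists>z. (\<forall>n. z n \<in> H) \<and> (\<lambda>n. A (z n)) \<longlonglongrightarrow> y" if "y \<in> W" for y
  proof -
    have "\<exists>s. (\<forall>n. s n \<in> A ` H) \<and> s \<longlonglongrightarrow> y"
      using that unfolding W_def closure_sequential .
    then obtain s where s: "\<forall>n. s n \<in> A ` H" "s \<longlonglongrightarrow> y" by (elim exE conjE)
    have "\<forall>n. \<exists>z. z \<in> H \<and> A z = s n"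
    proof
      fix n
      have "s n \<in> A ` H" using s(1) by (rule spec)
      then show "\<exists>z. z \<in> H \<and> A z = s n" by (rule imageE) (simp add: exI)
    qed
    then have "\<exists>z. \<forall>n. z n \<in> H \<and> A (z n) = s n" by (rule choice)
    then obtain z where z: "\<forall>n. z n \<in> H \<and> A (z n) = s n" by (rule exE)
    then show ?thesis using s(2) by (intro exI[of _ z]) simp
  qed
  have W_orth: "y \<bullet> \<phi> = 0" if yW: "y \<in> W" for y
  proof -
    obtain z where z: "\<And>n. z n \<in> H" "(\<lambda>n. A (z n)) \<longlonglongrightarrow> y" using W_seq[OF yW] by blast
    have "(\<lambda>n. A (z n) \<bullet> \<phi>) \<longlonglongrightarrow> y \<bullet> \<phi>" by (intro tendsto_intros z)
    moreover have "A (z n) \<bullet> \<phi> = 0" for n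
      using A.symmetric[OF z(1) \<phi>(1), of n] \<phi>(3) by (simp add: A_def)
    ultimately show ?thesis by (simp add: LIMSEQ_const_iff)
  qed
  \<comment> \<open>The part of \<open>y\<close> orthogonal to the range of \<open>A\<close> lies in the kernel of \<open>A\<close>, which is spanned by \<open>\<phi>\<close>.\<close>
  have dense: "y \<in> W" if y: "y \<in> H" "y \<bullet> \<phi> = 0" for y
  proof -
    have "\<exists>w\<in>W. \<forall>v\<in>W. w \<bullet> v = y \<bullet> v"
      by (rule riesz_representation_on[OF W, where C = "norm y"])
        (simp_all add: inner_add_right Cauchy_Schwarz_ineq2)
    then obtain w where w: "w \<in> W" "\<And>v. v \<in> W \<Longrightarrow> w \<bullet> v = y \<bullet> v" by blast
    define z where "z = y - w"
    have z: "z \<in> H" using y w(1) WH subspace by (auto simp: z_def subspace_diff)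
    have "A z \<bullet> A z = z \<bullet> A (A z)" using A.symmetric[OF z A.maps[OF z]] .
    also have "\<dots> = 0"
    proof -
      have "A (A z) \<in> W" using closure_subset[of "A ` H"] A.maps[OF z] by (auto simp: W_def)
      then show ?thesis using w(2) by (simp add: z_def inner_diff_left)
    qed
    finally have "A z = 0" by (simp only: inner_eq_zero_iff)
    then have "T z = p *\<^sub>R z" by (simp add: A_def)
    then obtain k where k: "z = k *\<^sub>R \<phi>" using simple[OF z] by (auto simp: span_singleton)
    have "z \<bullet> \<phi> = 0" using y(2) W_orth[OF w(1)] by (simp add: z_def inner_diff_left)
    then have "z = 0" using k \<phi>(2) by simp
    then show ?thesis using w(1) by (simp add: z_def)
  qed
  have on_complement: "T y \<bullet> y \<le> a * (y \<bullet> y)" if y: "y \<in> H" "y \<bullet> \<phi> = 0" for y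
  proof -
    obtain z where z: "\<And>n. z n \<in> H" "(\<lambda>n. A (z n)) \<longlonglongrightarrow> y" using W_seq[OF dense[OF y]] by blast
    obtain B where B: "0 < B" "\<And>x. x \<in> H \<Longrightarrow> norm (A x) \<le> B * norm x" using A.pos_bound by blast
    have "norm (A y - A (A (z n))) \<le> B * norm (y - A (z n))" for n
      using B(2)[of "y - A (z n)"] y(1) A.maps[OF z(1)] subspace
      by (simp add: A.diff subspace_diff)
    then have "(\<lambda>n. A y - A (A (z n))) \<longlonglongrightarrow> 0" using z(2) by (rule tendsto_zero_of_norm_le)
    from tendsto_diff[OF tendsto_const[of "A y"] this]
    have "(\<lambda>n. A (A (z n))) \<longlonglongrightarrow> A y" by (simp only: diff_diff_eq2 add_diff_cancel_left' diff_zero)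
    then have "(\<lambda>n. A (A (z n)) \<bullet> A (z n)) \<longlonglongrightarrow> A y \<bullet> y" by (intro tendsto_intros z)
    moreover have "(\<lambda>n. \<epsilon> * (A (z n) \<bullet> A (z n))) \<longlonglongrightarrow> \<epsilon> * (y \<bullet> y)" by (intro tendsto_intros z)
    ultimately have "\<epsilon> * (y \<bullet> y) \<le> A y \<bullet> y"
      using on_range[OF z(1)] by (intro LIMSEQ_le) auto
    then show ?thesis by (simp add: A_def \<epsilon>_def inner_diff_left algebra_simps)
  qed
  have "norm (T y) \<le> a * norm y" if y: "y \<in> H" "y \<bullet> \<phi> = 0" for y
  proof -
    have "T y \<bullet> \<phi> = 0" using symmetric[OF y(1) \<phi>(1)] \<phi>(3) y(2) by simp
    then have "(norm (T y))\<^sup>2 \<le> a * (T y \<bullet> y)"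
      using norm_le_form[OF nonneg on_complement y(1)] maps[OF y(1)] by blast
    also have "\<dots> \<le> a * (a * (y \<bullet> y))"
      using on_complement[OF y] a(1) by (rule mult_left_mono)
    finally have "(norm (T y))\<^sup>2 \<le> (a * norm y)\<^sup>2"
      by (simp add: dot_square_norm power2_eq_square algebra_simps)
    then show ?thesis by (rule power2_le_imp_le) (simp add: a(1))
  qed
  then show ?thesis using that[OF a] by blast
qed

end

section \<open>Completeness of the space of square-integrable functions\<close>

lemma nn_integral_le_of_AE_limit:
  fixes F :: "nat \<Rightarrow> 'a \<Rightarrow> ennreal"
  assumes "\<And>n. F n \<in> borel_measurable M"
    and lim: "AE x in M. (\<lambda>n. F n x) \<longlonglongrightarrow> G x"
    and bound: "\<And>n. N \<le> n \<Longrightarrow> (\<integral>\<^sup>+x. F n x \<partial>M) \<le> c"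
  shows "(\<integral>\<^sup>+x. G x \<partial>M) \<le> c"
proof -
  have "(\<integral>\<^sup>+x. G x \<partial>M) = (\<integral>\<^sup>+x. liminf (\<lambda>n. F n x) \<partial>M)"
    using lim by (intro nn_integral_cong_AE) (auto elim!: eventually_mono dest!: lim_imp_Liminf[rotated])
  also have "\<dots> \<le> liminf (\<lambda>n. \<integral>\<^sup>+x. F n x \<partial>M)"
    using assms(1) by (rule nn_integral_liminf)
  also have "\<dots> \<le> c"
  proof -
    have "liminf (\<lambda>n. \<integral>\<^sup>+x. F n x \<partial>M) \<le> limsup (\<lambda>n. \<integral>\<^sup>+x. F n x \<partial>M)"
      by (rule Liminf_le_Limsup) simp
    also have "\<dots> \<le> c"
      using bound by (intro Limsup_bounded) (auto simp: eventually_sequentially)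
    finally show ?thesis .
  qed
  finally show ?thesis .
qed

lemma abs_rep_l2: "abs_l2 (rep_l2 u) = u"
  by (rule Quotient3_abs_rep[OF Quotient3_l2])

lemma rep_abs_l2:
  assumes "square_integrable f"
  shows "AE x in lborel. rep_l2 (abs_l2 f) x = f x"
  using rep_abs_rsp_left[OF Quotient3_l2, of f f] assms by (auto simp: l2_rel_def)

lemma rep_l2_measurable [measurable]: "rep_l2 u \<in> borel_measurable borel"
  using rep_l2_square_integrable[of u] by (simp add: square_integrable_def)

lemma abs_l2_add:
  assumes "square_integrable f" "square_integrable g"
  shows "abs_l2 f + abs_l2 g = abs_l2 (\<lambda>x. f x + g x)"
  by (rule plus_l2.abs_eq) (use assms in \<open>auto simp: l2_rel_def\<close>)

lemma abs_l2_diff: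
  assumes "square_integrable f" "square_integrable g"
  shows "abs_l2 f - abs_l2 g = abs_l2 (\<lambda>x. f x - g x)"
  by (rule minus_l2.abs_eq) (use assms in \<open>auto simp: l2_rel_def\<close>)

lemma abs_l2_scaleR:
  assumes "square_integrable f"
  shows "c *\<^sub>R abs_l2 f = abs_l2 (\<lambda>x. c *\<^sub>R f x)"
  by (rule scaleR_l2.abs_eq) (use assms in \<open>auto simp: l2_rel_def\<close>)

lemma rep_l2_add: "AE x in lborel. rep_l2 (u + v) x = rep_l2 u x + rep_l2 v x"
  using rep_abs_l2[OF square_integrable_add[OF rep_l2_square_integrable rep_l2_square_integrable], of u v]
  by (simp add: abs_l2_add[OF rep_l2_square_integrable rep_l2_square_integrable, symmetric] abs_rep_l2)

lemma rep_l2_diff: "AE x in lborel. rep_l2 (u - v) x = rep_l2 u x - rep_l2 v x"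
  using rep_abs_l2[OF square_integrable_diff[OF rep_l2_square_integrable rep_l2_square_integrable], of u v]
  by (simp add: abs_l2_diff[OF rep_l2_square_integrable rep_l2_square_integrable, symmetric] abs_rep_l2)

lemma rep_l2_scaleR: "AE x in lborel. rep_l2 (c *\<^sub>R u) x = c *\<^sub>R rep_l2 u x"
  using rep_abs_l2[OF square_integrable_scaleR[OF rep_l2_square_integrable], of c u]
  by (simp add: abs_l2_scaleR[OF rep_l2_square_integrable, symmetric] abs_rep_l2)

lemma norm_l2_power2: "ennreal ((norm u)\<^sup>2) = (\<integral>\<^sup>+x. ennreal ((norm (rep_l2 u x))\<^sup>2) \<partial>lborel)"
proof -
  have "(norm u)\<^sup>2 = (\<integral>x. (norm (rep_l2 u x))\<^sup>2 \<partial>lborel)"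
    by (simp add: power2_norm_eq_inner inner_l2.rep_eq)
  then show ?thesis
    using rep_l2_square_integrable[of u]
    by (simp add: nn_integral_eq_integral square_integrable_def)
qed

lemma norm_l2_diff_power2:
  "ennreal ((norm (u - v))\<^sup>2) = (\<integral>\<^sup>+x. ennreal ((norm (rep_l2 u x - rep_l2 v x))\<^sup>2) \<partial>lborel)"
  unfolding norm_l2_power2
  by (rule nn_integral_cong_AE) (use rep_l2_diff[of u v] in \<open>auto elim: eventually_mono\<close>)

lemma square_integrableI_nn_integral:
  fixes f :: "'a::euclidean_space \<Rightarrow> 'b::euclidean_space"
  assumes [measurable]: "f \<in> borel_measurable borel"
    and "(\<integral>\<^sup>+x. ennreal ((norm (f x))\<^sup>2) \<partial>lborel) < \<infinity>"
  shows "square_integrable f"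
  unfolding square_integrable_def using assms by (auto intro!: integrableI_bounded)

text \<open>The weights \<open>2 ^ n\<close> force the increments to decay geometrically, which makes them absolutely
  summable.\<close>

lemma convergent_of_summable_weighted_increments:
  fixes f :: "nat \<Rightarrow> 'b::banach"
  assumes "(\<Sum>n. ennreal (2 ^ n * (norm (f (Suc n) - f n))\<^sup>2)) < \<infinity>"
  shows "convergent f"
proof -
  have s: "summable (\<lambda>n. 2 ^ n * (norm (f (Suc n) - f n))\<^sup>2)"
    using assms by (intro summable_suminf_not_top) auto
  then have "Bseq (\<lambda>n. 2 ^ n * (norm (f (Suc n) - f n))\<^sup>2)" by (rule summable_imp_Bseq)
  then obtain C where C: "\<And>n. \<bar>2 ^ n * (norm (f (Suc n) - f n))\<^sup>2\<bar> \<le> C"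
    unfolding Bseq_def real_norm_def by blast
  have C0: "0 \<le> C" using order.trans[OF abs_ge_zero C[of 0]] .
  have "norm (f (Suc n) - f n) \<le> sqrt C * (sqrt (1/2)) ^ n" for n
  proof (rule power2_le_imp_le)
    have "((sqrt (1/2)) ^ n)\<^sup>2 = ((sqrt (1/2))\<^sup>2) ^ n"
      by (simp only: power_mult[symmetric] mult.commute)
    then have eq: "(sqrt C * (sqrt (1/2)) ^ n)\<^sup>2 = C / 2 ^ n"
      using C0 by (simp add: power_mult_distrib power_divide)
    show "(norm (f (Suc n) - f n))\<^sup>2 \<le> (sqrt C * (sqrt (1/2)) ^ n)\<^sup>2"
      unfolding eq using C[of n] by (simp add: field_simps)
  qed (use C0 in simp)
  moreover have "summable (\<lambda>n. sqrt C * (sqrt (1/2)) ^ n)"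
    by (intro summable_mult summable_geometric) (simp add: real_sqrt_divide)
  ultimately have "summable (\<lambda>n. f (Suc n) - f n)"
    by (rule summable_comparison_test'[rotated, where N = 0]) 
  then have "(\<lambda>n. \<Sum>k<n. f (Suc k) - f k) \<longlonglongrightarrow> (\<Sum>n. f (Suc n) - f n)"
    by (rule summable_LIMSEQ)
  from tendsto_add[OF this tendsto_const[of "f 0"]] show ?thesis
    by (auto simp: sum_lessThan_telescope convergent_def)
qed

text \<open>The Riesz-Fischer argument: along a subsequence whose increments have norm at most
  \<open>(1/2) ^ n\<close>, the integral of their squares weighted by \<open>2 ^ n\<close> and summed over \<open>n\<close> is finite, so the
  subsequence converges almost everywhere. Fatou's lemma makes the pointwise limit a limit in
  norm.\<close>

instance l2 :: (euclidean_space, euclidean_space) complete_space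
proof
  fix X :: "nat \<Rightarrow> ('a, 'b) l2"
  assume X: "Cauchy X"
  have "\<forall>n. \<exists>N. \<forall>i\<ge>N. \<forall>j\<ge>N. norm (X i - X j) < (1/2) ^ n"
    using CauchyD[OF X] by simp
  then obtain r where r: "\<And>n i j. r n \<le> i \<Longrightarrow> r n \<le> j \<Longrightarrow> norm (X i - X j) < (1/2) ^ n"
    by metis
  \<comment> \<open>Partial sums make the thresholds increasing and unbounded while staying above \<open>r n\<close>.\<close>
  define s where "s n = (\<Sum>k\<le>n. Suc (r k))" for n
  have s: "r n \<le> s n" "n \<le> s n" "s n \<le> s (Suc n)" for n
    using sum_mono2[of "{..n}" "{n}" "\<lambda>k. Suc (r k)"] sum_mono[of "{..n}" "\<lambda>_. 1" "\<lambda>k. Suc (r k)"]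
    by (simp_all add: s_def)
  define f where "f n = rep_l2 (X (s n))" for n
  have f_meas [measurable]: "f n \<in> borel_measurable borel" for n
    by (simp add: f_def)
  define g where "g x = lim (\<lambda>n. f n x)" for x
  have [measurable]: "g \<in> borel_measurable borel"
    unfolding g_def by (rule borel_measurable_lim_metric) simp
  have "(\<integral>\<^sup>+x. (\<Sum>n. ennreal (2 ^ n * (norm (f (Suc n) x - f n x))\<^sup>2)) \<partial>lborel) < \<infinity>"
  proof -
    have le: "(\<integral>\<^sup>+x. ennreal (2 ^ n * (norm (f (Suc n) x - f n x))\<^sup>2) \<partial>lborel) \<le> ennreal ((1/2) ^ n)" for n
    proof -
      have "norm (X (s (Suc n)) - X (s n)) \<le> (1/2) ^ n"
        using r[of n "s (Suc n)" "s n"] s[of n] by simp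
      then have "(norm (X (s (Suc n)) - X (s n)))\<^sup>2 \<le> ((1/2) ^ n)\<^sup>2" by (intro power_mono) auto
      then have "2 ^ n * (norm (X (s (Suc n)) - X (s n)))\<^sup>2 \<le> (1/2) ^ n"
        by (simp add: power2_eq_square field_simps)
      moreover have "(\<integral>\<^sup>+x. ennreal (2 ^ n * (norm (f (Suc n) x - f n x))\<^sup>2) \<partial>lborel)
          = ennreal (2 ^ n * (norm (X (s (Suc n)) - X (s n)))\<^sup>2)"
        unfolding ennreal_mult'[OF zero_le_power[OF zero_le_numeral]] norm_l2_diff_power2 f_def
        by (rule nn_integral_cmult) simp
      ultimately show ?thesis by (simp add: ennreal_leI)
    qed
    have "(\<integral>\<^sup>+x. (\<Sum>n. ennreal (2 ^ n * (norm (f (Suc n) x - f n x))\<^sup>2)) \<partial>lborel)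
        = (\<Sum>n. \<integral>\<^sup>+x. ennreal (2 ^ n * (norm (f (Suc n) x - f n x))\<^sup>2) \<partial>lborel)"
      by (rule nn_integral_suminf) simp
    also have "\<dots> \<le> (\<Sum>n. ennreal ((1/2) ^ n))"
      by (rule suminf_le[OF le]) auto
    also have "\<dots> = ennreal (\<Sum>n. (1/2) ^ n)"
      by (rule suminf_ennreal2) (auto intro: summable_geometric)
    finally show ?thesis by (simp add: le_less_trans)
  qed
  then have "AE x in lborel. (\<Sum>n. ennreal (2 ^ n * (norm (f (Suc n) x - f n x))\<^sup>2)) \<noteq> \<infinity>"
    by (intro nn_integral_noteq_infinite) auto
  then have conv: "AE x in lborel. (\<lambda>n. f n x) \<longlonglongrightarrow> g x"
    by (rule eventually_mono)
      (auto simp: g_def convergent_LIMSEQ_iff[symmetric] top.not_eq_extremum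
        intro!: convergent_of_summable_weighted_increments)
  have fatou: "(\<integral>\<^sup>+x. ennreal ((norm (g x - rep_l2 (X m) x))\<^sup>2) \<partial>lborel) \<le> ennreal (((1/2) ^ k)\<^sup>2)"
    if m: "r k \<le> m" for m k
  proof (rule nn_integral_le_of_AE_limit)
    show "AE x in lborel. (\<lambda>n. ennreal ((norm (f n x - rep_l2 (X m) x))\<^sup>2)) \<longlonglongrightarrow>
        ennreal ((norm (g x - rep_l2 (X m) x))\<^sup>2)"
      using conv by (rule eventually_mono) (intro tendsto_intros)
    fix n assume "r k \<le> n"
    then have "norm (X (s n) - X m) \<le> (1/2) ^ k"
      using r[of k "s n" m] s(2)[of n] m by simp
    then show "(\<integral>\<^sup>+x. ennreal ((norm (f n x - rep_l2 (X m) x))\<^sup>2) \<partial>lborel) \<le> ennreal (((1/2) ^ k)\<^sup>2)"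
      unfolding f_def norm_l2_diff_power2[symmetric] by (intro ennreal_leI power_mono) auto
  qed simp
  have "square_integrable (\<lambda>x. g x - rep_l2 (X (r 0)) x)"
    using fatou[of 0 "r 0"] by (intro square_integrableI_nn_integral) (auto simp: le_less_trans)
  from square_integrable_add[OF this rep_l2_square_integrable[of "X (r 0)"]]
  have g: "square_integrable g" by simp
  have "X \<longlonglongrightarrow> abs_l2 g"
  proof (rule LIMSEQ_I)
    fix e :: real assume "0 < e"
    then obtain k where k: "(1/2) ^ k < e" using real_arch_pow_inv[of e "1/2"] by auto
    have "norm (X m - abs_l2 g) < e" if "r k \<le> m" for m
    proof -
      have "ennreal ((norm (abs_l2 g - X m))\<^sup>2)
          = (\<integral>\<^sup>+x. ennreal ((norm (g x - rep_l2 (X m) x))\<^sup>2) \<partial>lborel)"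
        unfolding norm_l2_diff_power2
        by (rule nn_integral_cong_AE) (use rep_abs_l2[OF g] in \<open>auto elim: eventually_mono\<close>)
      then have "ennreal ((norm (abs_l2 g - X m))\<^sup>2) \<le> ennreal (((1/2) ^ k)\<^sup>2)"
        using fatou[OF that] by simp
      then have "(norm (abs_l2 g - X m))\<^sup>2 \<le> ((1/2) ^ k)\<^sup>2" by simp
      then have "norm (abs_l2 g - X m) \<le> (1/2) ^ k" by (rule power2_le_imp_le) simp
      with k show ?thesis by (simp add: norm_minus_commute)
    qed
    then show "\<exists>no. \<forall>n\<ge>no. norm (X n - abs_l2 g) < e" by (intro exI allI impI)
  qed
  then show "convergent X" by (auto simp: convergent_def)
qed

section \<open>Functions in the Sobolev space\<close>

lemma frechet_derivative_plus:
  assumes "v differentiable (at x)" "w differentiable (at x)"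
  shows "frechet_derivative (\<lambda>x. v x + w x) (at x)
    = (\<lambda>h. frechet_derivative v (at x) h + frechet_derivative w (at x) h)"
  using assms unfolding frechet_derivative_works
  by (intro frechet_derivative_at[symmetric] has_derivative_add)

lemma frechet_derivative_cmult:
  fixes v :: "'a::real_normed_vector \<Rightarrow> real"
  assumes "v differentiable (at x)"
  shows "frechet_derivative (\<lambda>x. c * v x) (at x) = (\<lambda>h. c * frechet_derivative v (at x) h)"
  using assms unfolding frechet_derivative_works
  by (intro frechet_derivative_at[symmetric] has_derivative_mult_right)

lemma Ck_add: "Ck k v \<Longrightarrow> Ck k w \<Longrightarrow> Ck k (\<lambda>x. v x + w x)"
proof (induction k arbitrary: v w)
  case (Suc k)
  then show ?case by (auto simp: frechet_derivative_plus)
qed (auto intro: continuous_on_add)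

lemma Ck_scale: "Ck k v \<Longrightarrow> Ck k (\<lambda>x. c * v x)"
proof (induction k arbitrary: v)
  case (Suc k)
  then show ?case by (auto simp: frechet_derivative_cmult)
qed (auto intro: continuous_intros)

lemma test_function_zero: "test_function \<Omega> (\<lambda>x. 0)"
proof -
  have "Ck k (\<lambda>x::'a. 0)" for k by (induction k) auto
  then show ?thesis by (simp add: test_function_def)
qed

lemma test_functionI_support:
  assumes "\<And>k. Ck k v" "compact K" "K \<subseteq> \<Omega>" "{x. v x \<noteq> 0} \<subseteq> K"
  shows "test_function \<Omega> v"
proof -
  have "closure {x. v x \<noteq> 0} \<subseteq> K"
    using assms by (intro closure_minimal) (auto intro: compact_imp_closed)
  then show ?thesis
    using assms unfolding test_function_def
    by (metis closed_closure closed_Int_compact inf.absorb1 subset_trans)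
qed

lemma test_function_add:
  assumes "test_function \<Omega> v" "test_function \<Omega> w"
  shows "test_function \<Omega> (\<lambda>x. v x + w x)"
proof (rule test_functionI_support[where K = "closure {x. v x \<noteq> 0} \<union> closure {x. w x \<noteq> 0}"])
  show "{x. v x + w x \<noteq> 0} \<subseteq> closure {x. v x \<noteq> 0} \<union> closure {x. w x \<noteq> 0}"
  proof
    fix x assume "x \<in> {x. v x + w x \<noteq> 0}"
    then have "x \<in> {x. v x \<noteq> 0} \<or> x \<in> {x. w x \<noteq> 0}" by auto
    then show "x \<in> closure {x. v x \<noteq> 0} \<union> closure {x. w x \<noteq> 0}"
      using closure_subset by (metis UnI1 UnI2 subsetD)
  qed
qed (use assms in \<open>auto simp: test_function_def intro: Ck_add compact_Un\<close>)

lemma test_function_scale: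
  assumes "test_function \<Omega> v"
  shows "test_function \<Omega> (\<lambda>x. c * v x)"
proof (rule test_functionI_support[where K = "closure {x. v x \<noteq> 0}"])
  show "{x. c * v x \<noteq> 0} \<subseteq> closure {x. v x \<noteq> 0}"
    using closure_subset[of "{x. v x \<noteq> 0}"] by auto
qed (use assms in \<open>auto simp: test_function_def intro: Ck_scale\<close>)

lemma test_function_differentiable:
  assumes "test_function \<Omega> v" shows "v differentiable (at x)"
  using assms unfolding test_function_def by (metis Ck.simps(2))

lemma gradient_add:
  assumes "v differentiable (at x)" "w differentiable (at x)"
  shows "gradient (\<lambda>x. v x + w x) x = gradient v x + gradient w x"
  using assms by (simp add: gradient_def frechet_derivative_plus scaleR_add_left sum.distrib)

lemma gradient_scale:
  assumes "v differentiable (at x)"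
  shows "gradient (\<lambda>x. c * v x) x = c *\<^sub>R gradient v x"
  using assms by (simp add: gradient_def frechet_derivative_cmult scaleR_sum_right)

definition of_test :: "('a::euclidean_space \<Rightarrow> real) \<Rightarrow> 'a sobolev" where
  "of_test v = abs_l2 (\<lambda>x. (v x, gradient v x))"

lemma H10_eq_closure: "H10 \<Omega> = closure (of_test ` {v. test_function \<Omega> v})"
proof -
  have "{abs_l2 (\<lambda>x. (v x, gradient v x)) |v. test_function \<Omega> v} = of_test ` {v. test_function \<Omega> v}"
    unfolding of_test_def by blast
  then show ?thesis unfolding H10_def by (rule arg_cong)
qed

lemma H10_sequence:
  assumes "u \<in> H10 \<Omega>"
  obtains v where "\<And>n. test_function \<Omega> (v n)" "(\<lambda>n. of_test (v n)) \<longlonglongrightarrow> u"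
proof -
  obtain s where s: "\<forall>n. s n \<in> of_test ` {v. test_function \<Omega> v}" "s \<longlonglongrightarrow> u"
    using assms unfolding H10_eq_closure closure_sequential by blast
  then have "\<forall>n. \<exists>v. test_function \<Omega> v \<and> s n = of_test v" by blast
  then obtain v where v: "\<And>n. test_function \<Omega> (v n)" "\<And>n. s n = of_test (v n)" by metis
  then have "s = (\<lambda>n. of_test (v n))" by blast
  then show ?thesis using that[of v] v(1) s(2) by simp
qed

lemma closed_H10: "closed (H10 \<Omega>)"
  by (simp add: H10_def)

lemma subspace_H10: "subspace (H10 \<Omega>)"
  unfolding H10_eq_closure
proof (rule subspace_closure, rule subspaceI)
  have [simp]: "gradient (\<lambda>x. 0) = (\<lambda>x::'a. 0)"
    by (simp add: gradient_def frechet_derivative_const fun_eq_iff)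
  have "of_test (\<lambda>x::'a. 0) = 0"
    unfolding of_test_def by (simp add: zero_l2.abs_eq zero_prod_def)
  then show "(0::'a sobolev) \<in> of_test ` {v. test_function \<Omega> v}"
    using test_function_zero by (metis imageI mem_Collect_eq)
next
  fix x y assume "x \<in> of_test ` {v. test_function \<Omega> v}" "y \<in> of_test ` {v. test_function \<Omega> v}"
  then obtain v w where vw: "test_function \<Omega> v" "test_function \<Omega> w" "x = of_test v" "y = of_test w"
    by blast
  then have "x + y = of_test (\<lambda>x. v x + w x)"
    by (simp add: of_test_def abs_l2_add[OF test_function_square_integrable test_function_square_integrable]
        gradient_add test_function_differentiable)
  then show "x + y \<in> of_test ` {v. test_function \<Omega> v}"
    using test_function_add[OF vw(1,2)] by blast
next
  fix c x assume "x \<in> of_test ` {v. test_function \<Omega> v}"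
  then obtain v where v: "test_function \<Omega> v" "x = of_test v" by blast
  then have "c *\<^sub>R x = of_test (\<lambda>x. c * v x)"
    by (simp add: of_test_def abs_l2_scaleR[OF test_function_square_integrable]
        gradient_scale test_function_differentiable)
  then show "c *\<^sub>R x \<in> of_test ` {v. test_function \<Omega> v}"
    using test_function_scale[OF v(1)] by blast
qed

lemma rep_of_test:
  assumes "test_function \<Omega> v"
  shows "AE x in lborel. rep_l2 (of_test v) x = (v x, gradient v x)"
  unfolding of_test_def using test_function_square_integrable[OF assms] by (rule rep_abs_l2)

lemma test_function_outside:
  assumes "test_function \<Omega> v" "x \<notin> \<Omega>"
  shows "v x = 0" "gradient v x = 0"
proof -
  let ?K = "closure {x. v x \<noteq> 0}"
  have x: "x \<notin> ?K" using assms by (auto simp: test_function_def)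
  then show "v x = 0" using closure_subset[of "{x. v x \<noteq> 0}"] by auto
  have "(v has_derivative (\<lambda>_. 0)) (at x)"
  proof (rule has_derivative_transform_within_open)
    show "((\<lambda>_. 0) has_derivative (\<lambda>_. 0)) (at x)" by simp
    show "open (- ?K)" "x \<in> - ?K" using x by auto
    show "0 = v y" if "y \<in> - ?K" for y
      using that closure_subset[of "{x. v x \<noteq> 0}"] by auto
  qed
  then have "frechet_derivative v (at x) = (\<lambda>_. 0)" using frechet_derivative_at by metis
  then show "gradient v x = 0" by (simp add: gradient_def)
qed

text \<open>Off \<open>\<Omega>\<close> the difference of \<open>u\<close> and an approximating test function is \<open>u\<close> itself, so the square
  of the norm of that difference bounds the integral of \<open>\<bar>u\<bar>\<^sup>2\<close> there.\<close>

lemma H10_outside: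
  fixes u :: "'a::euclidean_space sobolev"
  assumes u: "u \<in> H10 \<Omega>" and [measurable]: "\<Omega> \<in> sets borel"
  shows "AE x in lborel. x \<notin> \<Omega> \<longrightarrow> rep_l2 u x = 0"
proof -
  obtain v where v: "\<And>n. test_function \<Omega> (v n)" "(\<lambda>n. of_test (v n)) \<longlonglongrightarrow> u"
    using H10_sequence[OF u] by blast
  let ?I = "\<integral>\<^sup>+x. ennreal ((norm (rep_l2 u x))\<^sup>2) * indicator (- \<Omega>) x \<partial>lborel"
  have "?I \<le> ennreal ((norm (u - of_test (v n)))\<^sup>2)" for n
    unfolding norm_l2_diff_power2
  proof (rule nn_integral_mono_AE)
    show "AE x in lborel. ennreal ((norm (rep_l2 u x))\<^sup>2) * indicator (- \<Omega>) x
        \<le> ennreal ((norm (rep_l2 u x - rep_l2 (of_test (v n)) x))\<^sup>2)"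
      using rep_of_test[OF v(1)[of n]] test_function_outside[OF v(1)[of n]]
      by (auto elim!: eventually_mono simp: indicator_def zero_prod_def[symmetric])
  qed
  moreover have "(\<lambda>n. ennreal ((norm (u - of_test (v n)))\<^sup>2)) \<longlonglongrightarrow> ennreal ((norm (u - u))\<^sup>2)"
    by (intro tendsto_intros v)
  ultimately have "?I \<le> ennreal ((norm (u - u))\<^sup>2)"
    by (intro LIMSEQ_le_const) auto
  then have "?I = 0" by simp
  then have "AE x in lborel. ennreal ((norm (rep_l2 u x))\<^sup>2) * indicator (- \<Omega>) x = 0"
    by (subst (asm) nn_integral_0_iff_AE) auto
  then show ?thesis by (rule eventually_mono) (auto simp: indicator_def split: if_splits)
qed

section \<open>The subcritical Sobolev inequality\<close>

lemma test_function_has_derivative: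
  assumes "test_function \<Omega> v"
  shows "(v has_derivative (\<lambda>h. gradient v x \<bullet> h)) (at x)"
proof -
  have d: "(v has_derivative frechet_derivative v (at x)) (at x)"
    using test_function_differentiable[OF assms] by (simp add: frechet_derivative_works)
  then have lin: "linear (frechet_derivative v (at x))"
    by (rule has_derivative_linear)
  have "frechet_derivative v (at x) h = gradient v x \<bullet> h" for h
  proof -
    have "frechet_derivative v (at x) h = frechet_derivative v (at x) (\<Sum>b\<in>Basis. (h \<bullet> b) *\<^sub>R b)"
      by (simp add: euclidean_representation)
    also have "\<dots> = (\<Sum>b\<in>Basis. (h \<bullet> b) * frechet_derivative v (at x) b)"
      using lin by (simp add: linear_sum linear_scale)
    also have "\<dots> = gradient v x \<bullet> h"
      by (simp add: gradient_def inner_sum_left inner_commute[of h] mult.commute)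
    finally show ?thesis .
  qed
  then have "frechet_derivative v (at x) = (\<lambda>h. gradient v x \<bullet> h)" by (rule ext)
  with d show ?thesis by simp
qed

lemma test_function_continuous:
  assumes "test_function \<Omega> v"
  shows "continuous_on UNIV v" "continuous_on UNIV (gradient v)"
proof -
  have C: "Ck 0 v" "Ck (Suc 0) v" using assms by (auto simp: test_function_def)
  then show "continuous_on UNIV v" by simp
  show "continuous_on UNIV (gradient v)"
    unfolding gradient_def[abs_def] by (intro continuous_intros) (use C in auto)
qed

lemma test_function_measurable:
  assumes "test_function \<Omega> v"
  shows "v \<in> borel_measurable borel" "gradient v \<in> borel_measurable borel"
  using test_function_continuous[OF assms] by (auto intro: borel_measurable_continuous_onI)

lemma square_integral_le_integral_square:
  fixes g :: "real \<Rightarrow> real"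
  assumes "continuous_on {0..1} g"
  shows "(integral {0..1} g)\<^sup>2 \<le> integral {0..1} (\<lambda>t. (g t)\<^sup>2)"
proof -
  let ?c = "integral {0..1} g"
  have i: "g integrable_on {0..1}" "(\<lambda>t. (g t)\<^sup>2) integrable_on {0..1}"
    using assms by (auto intro!: integrable_continuous_interval continuous_intros)
  have "0 \<le> integral {0..1} (\<lambda>t. (g t - ?c)\<^sup>2)"
    using assms by (intro Henstock_Kurzweil_Integration.integral_nonneg integrable_continuous_interval continuous_intros) auto
  also have "(\<lambda>t. (g t - ?c)\<^sup>2) = (\<lambda>t. (g t)\<^sup>2 - 2 * ?c * g t + ?c\<^sup>2)"
    by (simp add: power2_diff fun_eq_iff algebra_simps)
  also have "integral {0..1} \<dots> = integral {0..1} (\<lambda>t. (g t)\<^sup>2) - 2 * ?c * ?c + ?c\<^sup>2"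
  proof (rule integral_unique)
    have "((\<lambda>t. (g t)\<^sup>2 - 2 * ?c * g t + ?c\<^sup>2) has_integral
        integral {0..1} (\<lambda>t. (g t)\<^sup>2) - 2 * ?c * ?c + ?c\<^sup>2 * (1 - 0)) {0..1}"
      by (intro has_integral_add has_integral_diff has_integral_mult_right integrable_integral i)
        (use has_integral_const_real[of "?c\<^sup>2" 0 1] in simp)
    then show "((\<lambda>t. (g t)\<^sup>2 - 2 * ?c * g t + ?c\<^sup>2) has_integral
        integral {0..1} (\<lambda>t. (g t)\<^sup>2) - 2 * ?c * ?c + ?c\<^sup>2) {0..1}" by simp
  qed
  finally show ?thesis by (simp add: power2_eq_square)
qed

lemma nn_integral_lborel_translate:
  fixes f :: "'a::euclidean_space \<Rightarrow> ennreal"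
  assumes [measurable]: "f \<in> borel_measurable borel"
  shows "(\<integral>\<^sup>+x. f (x + c) \<partial>lborel) = (\<integral>\<^sup>+x. f x \<partial>lborel)"
proof -
  have "(\<integral>\<^sup>+x. f x \<partial>lborel) = (\<integral>\<^sup>+x. f x \<partial>distr lborel borel ((+) c))"
    by (simp add: lborel_distr_plus)
  also have "\<dots> = (\<integral>\<^sup>+x. f (c + x) \<partial>lborel)"
    by (rule nn_integral_distr) auto
  finally show ?thesis by (simp add: add.commute)
qed

text \<open>Along the segment from \<open>x\<close> to \<open>x + z\<close> the increment is an average of directional derivatives;
  integrating over \<open>x\<close>, translation invariance removes the dependence on the point of the segment.\<close>

lemma test_function_translation_estimate:
  fixes v :: "'a::euclidean_space \<Rightarrow> real"
  assumes v: "test_function \<Omega> v"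
  shows "(\<integral>\<^sup>+x. ennreal ((v (x + z) - v x)\<^sup>2) \<partial>lborel)
    \<le> ennreal ((norm z)\<^sup>2) * (\<integral>\<^sup>+x. ennreal ((norm (gradient v x))\<^sup>2) \<partial>lborel)"
proof -
  note [measurable] = test_function_measurable[OF v]
  let ?F = "\<lambda>x t. ennreal ((norm z)\<^sup>2) * (ennreal ((norm (gradient v (x + t *\<^sub>R z)))\<^sup>2) * indicator {0..1::real} t)"
  have point: "ennreal ((v (x + z) - v x)\<^sup>2) \<le> (\<integral>\<^sup>+t. ?F x t \<partial>lborel)" for x
  proof -
    define g where "g t = gradient v (x + t *\<^sub>R z) \<bullet> z" for t
    have cont: "continuous_on S (\<lambda>t. gradient v (x + t *\<^sub>R z))" for S
      by (rule continuous_on_compose2[OF test_function_continuous(2)[OF v]]) (auto intro!: continuous_intros)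
    have "(g has_integral v (x + 1 *\<^sub>R z) - v (x + 0 *\<^sub>R z)) {0..1}"
    proof (rule fundamental_theorem_of_calculus)
      fix t :: real
      have "((\<lambda>t. v (x + t *\<^sub>R z)) has_derivative (\<lambda>h. gradient v (x + t *\<^sub>R z) \<bullet> (h *\<^sub>R z))) (at t within {0..1})"
        by (rule has_derivative_compose[OF _ test_function_has_derivative[OF v]])
          (auto intro!: derivative_eq_intros)
      then show "((\<lambda>t. v (x + t *\<^sub>R z)) has_vector_derivative g t) (at t within {0..1})"
        by (simp add: has_vector_derivative_def g_def)
    qed simp
    then have "(v (x + z) - v x)\<^sup>2 = (integral {0..1} g)\<^sup>2" by (simp add: integral_unique)
    also have "\<dots> \<le> integral {0..1} (\<lambda>t. (g t)\<^sup>2)"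
      unfolding g_def by (intro square_integral_le_integral_square continuous_intros cont)
    also have "\<dots> \<le> integral {0..1} (\<lambda>t. (norm z)\<^sup>2 * (norm (gradient v (x + t *\<^sub>R z)))\<^sup>2)"
    proof (rule integral_le)
      fix t :: real
      have "(g t)\<^sup>2 \<le> (norm (gradient v (x + t *\<^sub>R z)) * norm z)\<^sup>2"
        unfolding g_def by (rule abs_le_square_iff[THEN iffD1]) (simp add: Cauchy_Schwarz_ineq2)
      then show "(g t)\<^sup>2 \<le> (norm z)\<^sup>2 * (norm (gradient v (x + t *\<^sub>R z)))\<^sup>2"
        by (simp add: power_mult_distrib mult.commute)
    qed (auto simp: g_def intro!: integrable_continuous_interval continuous_intros cont)
    finally have le: "(v (x + z) - v x)\<^sup>2
        \<le> integral {0..1} (\<lambda>t. (norm z)\<^sup>2 * (norm (gradient v (x + t *\<^sub>R z)))\<^sup>2)" .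
    have "(\<integral>\<^sup>+t. ?F x t \<partial>lborel)
        = (\<integral>\<^sup>+t\<in>{0..1}. ennreal ((norm z)\<^sup>2 * (norm (gradient v (x + t *\<^sub>R z)))\<^sup>2) \<partial>lborel)"
      by (simp add: ennreal_mult mult.assoc)
    also have "\<dots> = ennreal (integral {0..1} (\<lambda>t. (norm z)\<^sup>2 * (norm (gradient v (x + t *\<^sub>R z)))\<^sup>2))"
    proof (rule nn_integral_has_integral_lebesgue')
      have "(\<lambda>t. (norm z)\<^sup>2 * (norm (gradient v (x + t *\<^sub>R z)))\<^sup>2) integrable_on {0..1}"
        by (intro integrable_continuous_interval continuous_intros cont)
      then show "((\<lambda>t. (norm z)\<^sup>2 * (norm (gradient v (x + t *\<^sub>R z)))\<^sup>2) has_integral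
          integral {0..1} (\<lambda>t. (norm z)\<^sup>2 * (norm (gradient v (x + t *\<^sub>R z)))\<^sup>2)) {0..1}"
        by (rule integrable_integral)
    qed simp
    finally show ?thesis using le by (simp add: ennreal_leI)
  qed
  have "(\<integral>\<^sup>+x. ennreal ((v (x + z) - v x)\<^sup>2) \<partial>lborel) \<le> (\<integral>\<^sup>+x. \<integral>\<^sup>+t. ?F x t \<partial>lborel \<partial>lborel)"
    by (intro nn_integral_mono point)
  also have "\<dots> = (\<integral>\<^sup>+t. \<integral>\<^sup>+x. ?F x t \<partial>lborel \<partial>lborel)"
    by (rule lborel_pair.Fubini'[symmetric]) measurable
  also have "\<dots> = (\<integral>\<^sup>+t. ennreal ((norm z)\<^sup>2) * (\<integral>\<^sup>+x. ennreal ((norm (gradient v x))\<^sup>2) \<partial>lborel)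
      * indicator {0..1::real} t \<partial>lborel)"
  proof (rule nn_integral_cong)
    fix t :: real
    have "(\<integral>\<^sup>+x. ennreal ((norm (gradient v (x + t *\<^sub>R z)))\<^sup>2) \<partial>lborel)
        = (\<integral>\<^sup>+x. ennreal ((norm (gradient v x))\<^sup>2) \<partial>lborel)"
      by (rule nn_integral_lborel_translate[where f = "\<lambda>x. ennreal ((norm (gradient v x))\<^sup>2)"]) measurable
    then show "(\<integral>\<^sup>+x. ?F x t \<partial>lborel) = ennreal ((norm z)\<^sup>2)
        * (\<integral>\<^sup>+x. ennreal ((norm (gradient v x))\<^sup>2) \<partial>lborel) * indicator {0..1::real} t"
      by (simp add: nn_integral_cmult nn_integral_multc mult.assoc)
  qed
  also have "\<dots> = ennreal ((norm z)\<^sup>2) * (\<integral>\<^sup>+x. ennreal ((norm (gradient v x))\<^sup>2) \<partial>lborel)"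
    by (simp add: nn_integral_cmult_indicator)
  finally show ?thesis .
qed


text \<open>By Chebyshev's inequality the set where \<open>\<bar>v\<bar> > \<tau>/2\<close> fills at most half of a ball of radius \<open>\<epsilon>\<close>. So
  around a point where \<open>\<bar>v\<bar> > \<tau>\<close>, at least half of the translations of length less than \<open>\<epsilon>\<close> change \<open>v\<close>
  by at least \<open>\<tau>/2\<close>; the translation estimate limits how often this can happen.\<close>

lemma level_set_estimate:
  fixes v :: "'a::euclidean_space \<Rightarrow> real"
  assumes v: "test_function \<Omega> v"
    and E: "(\<integral>\<^sup>+x. ennreal ((norm (gradient v x))\<^sup>2) \<partial>lborel) \<le> 1"
    and K: "(\<integral>\<^sup>+x. ennreal (\<bar>v x\<bar> powr q) \<partial>lborel) \<le> ennreal K" and "0 \<le> q"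
    and pos: "0 < \<tau>" "0 < \<epsilon>" "0 \<le> K"
    and \<epsilon>: "(2 / \<tau>) powr q * K \<le> unit_ball_vol (DIM('a)) * \<epsilon> ^ DIM('a) / 2"
  shows "emeasure lborel {x. \<tau> < \<bar>v x\<bar>} \<le> ennreal (8 * \<epsilon>\<^sup>2 / \<tau>\<^sup>2)"
proof -
  note [measurable] = test_function_measurable[OF v]
  define b where "b = unit_ball_vol (DIM('a)) * \<epsilon> ^ DIM('a)"
  have b: "0 < b" using pos by (simp add: b_def)
  define B where "B = ball (0::'a) \<epsilon>"
  have [measurable]: "B \<in> sets borel" by (simp add: B_def)
  have B: "emeasure lborel B = ennreal b"
    using pos by (simp add: emeasure_ball b_def B_def)
  let ?A = "{x. \<tau> < \<bar>v x\<bar>}" and ?A' = "{x. \<tau> / 2 < \<bar>v x\<bar>}"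
  have A': "emeasure lborel ?A' \<le> ennreal (b / 2)"
  proof -
    have "emeasure lborel ?A' = (\<integral>\<^sup>+x. indicator ?A' x \<partial>lborel)" by simp
    also have "\<dots> \<le> (\<integral>\<^sup>+x. ennreal ((2 / \<tau>) powr q) * ennreal (\<bar>v x\<bar> powr q) \<partial>lborel)"
    proof (rule nn_integral_mono)
      fix x
      have "1 \<le> (2 / \<tau>) powr q * \<bar>v x\<bar> powr q" if "\<tau> / 2 < \<bar>v x\<bar>"
      proof -
        have "1 \<le> (2 / \<tau> * \<bar>v x\<bar>) powr q"
          using that pos \<open>0 \<le> q\<close> by (intro ge_one_powr_ge_zero) (auto simp: field_simps)
        then show ?thesis using pos by (subst (asm) powr_mult) auto
      qed
      then show "indicator ?A' x \<le> ennreal ((2 / \<tau>) powr q) * ennreal (\<bar>v x\<bar> powr q)"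
        by (auto simp: indicator_def ennreal_mult[symmetric] simp flip: ennreal_1 intro!: ennreal_leI)
    qed
    also have "\<dots> = ennreal ((2 / \<tau>) powr q) * (\<integral>\<^sup>+x. ennreal (\<bar>v x\<bar> powr q) \<partial>lborel)"
      by (rule nn_integral_cmult) simp
    also have "\<dots> \<le> ennreal ((2 / \<tau>) powr q) * ennreal K"
      using K by (rule mult_left_mono) simp
    also have "\<dots> \<le> ennreal (b / 2)"
      using \<epsilon> pos by (simp add: ennreal_mult[symmetric] b_def ennreal_leI)
    finally show ?thesis .
  qed
  have lower: "ennreal (\<tau>\<^sup>2 / 4 * (b / 2)) * indicator ?A x
      \<le> (\<integral>\<^sup>+z. ennreal ((v (x + z) - v x)\<^sup>2) * indicator B z \<partial>lborel)" for x
  proof (cases "x \<in> ?A")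
    case True
    let ?D = "{z. \<tau> / 2 < \<bar>v (x + z)\<bar>}"
    have "emeasure lborel ?D = emeasure lborel ?A'"
    proof -
      have "emeasure lborel ?D = (\<integral>\<^sup>+z. indicator ?D z \<partial>lborel)"
        by (rule nn_integral_indicator[symmetric]) measurable
      also have "\<dots> = (\<integral>\<^sup>+z. indicator ?A' (z + x) \<partial>lborel)"
        by (intro nn_integral_cong) (simp add: indicator_def add.commute)
      also have "\<dots> = emeasure lborel ?A'"
        by (subst nn_integral_lborel_translate) auto
      finally show ?thesis .
    qed
    with A' have D: "emeasure lborel ?D \<le> ennreal (b / 2)" by simp
    have "ennreal b \<le> emeasure lborel (B - ?D) + emeasure lborel ?D"
      unfolding B[symmetric]
      by (rule order.trans[OF emeasure_mono emeasure_subadditive]) auto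
    also have "\<dots> \<le> emeasure lborel (B - ?D) + ennreal (b / 2)"
      using D by (rule add_left_mono)
    finally have "ennreal (b / 2) \<le> emeasure lborel (B - ?D)"
    proof -
      assume *: "ennreal b \<le> emeasure lborel (B - ?D) + ennreal (b / 2)"
      have "ennreal b = ennreal (b / 2) + ennreal (b / 2)"
        using b by (simp add: ennreal_plus[symmetric] del: ennreal_plus)
      with * show ?thesis by (simp add: add.commute ennreal_add_left_cancel_le)
    qed
    then have "ennreal (\<tau>\<^sup>2 / 4) * ennreal (b / 2) \<le> ennreal (\<tau>\<^sup>2 / 4) * emeasure lborel (B - ?D)"
      by (rule mult_left_mono) simp
    also have "\<dots> = (\<integral>\<^sup>+z. ennreal (\<tau>\<^sup>2 / 4) * indicator (B - ?D) z \<partial>lborel)"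
      by (rule nn_integral_cmult_indicator[symmetric]) measurable
    also have "\<dots> \<le> (\<integral>\<^sup>+z. ennreal ((v (x + z) - v x)\<^sup>2) * indicator B z \<partial>lborel)"
    proof (rule nn_integral_mono)
      fix z
      have "\<tau>\<^sup>2 / 4 \<le> (v (x + z) - v x)\<^sup>2" if "z \<notin> ?D"
      proof -
        have "\<bar>v x\<bar> \<le> \<bar>v (x + z)\<bar> + \<bar>v (x + z) - v x\<bar>"
          using abs_triangle_ineq2[of "v x" "v (x + z)"] by (simp add: abs_minus_commute)
        then have "\<tau> / 2 \<le> \<bar>v (x + z) - v x\<bar>" using that True by simp
        then have "(\<tau> / 2)\<^sup>2 \<le> \<bar>v (x + z) - v x\<bar>\<^sup>2" using pos by (intro power_mono) auto
        then show ?thesis by (simp add: power_divide)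
      qed
      then show "ennreal (\<tau>\<^sup>2 / 4) * indicator (B - ?D) z
          \<le> ennreal ((v (x + z) - v x)\<^sup>2) * indicator B z"
        by (auto simp: indicator_def intro!: ennreal_leI)
    qed
    finally show ?thesis using True b by (simp add: ennreal_mult[symmetric])
  qed simp
  have "ennreal (\<tau>\<^sup>2 / 4 * (b / 2)) * emeasure lborel ?A
      = (\<integral>\<^sup>+x. ennreal (\<tau>\<^sup>2 / 4 * (b / 2)) * indicator ?A x \<partial>lborel)"
    by (rule nn_integral_cmult_indicator[symmetric]) measurable
  also have "\<dots> \<le> (\<integral>\<^sup>+x. \<integral>\<^sup>+z. ennreal ((v (x + z) - v x)\<^sup>2) * indicator B z \<partial>lborel \<partial>lborel)"
    by (intro nn_integral_mono lower)
  also have "\<dots> = (\<integral>\<^sup>+z. \<integral>\<^sup>+x. ennreal ((v (x + z) - v x)\<^sup>2) * indicator B z \<partial>lborel \<partial>lborel)"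
    by (rule lborel_pair.Fubini'[symmetric]) measurable
  also have "\<dots> \<le> (\<integral>\<^sup>+z. ennreal (\<epsilon>\<^sup>2) * indicator B z \<partial>lborel)"
  proof (rule nn_integral_mono)
    fix z :: 'a
    have "(\<integral>\<^sup>+x. ennreal ((v (x + z) - v x)\<^sup>2) \<partial>lborel) \<le> ennreal (\<epsilon>\<^sup>2)" if "z \<in> B"
    proof -
      have "(\<integral>\<^sup>+x. ennreal ((v (x + z) - v x)\<^sup>2) \<partial>lborel) \<le> ennreal ((norm z)\<^sup>2) * 1"
        by (rule order.trans[OF test_function_translation_estimate[OF v] mult_left_mono[OF E]]) simp
      also have "\<dots> \<le> ennreal (\<epsilon>\<^sup>2)"
        using that by (simp add: B_def ennreal_leI power_mono)
      finally show ?thesis .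
    qed
    then show "(\<integral>\<^sup>+x. ennreal ((v (x + z) - v x)\<^sup>2) * indicator B z \<partial>lborel) \<le> ennreal (\<epsilon>\<^sup>2) * indicator B z"
      by (auto simp: indicator_def)
  qed
  also have "\<dots> = ennreal (\<epsilon>\<^sup>2) * ennreal b"
    unfolding B[symmetric] by (rule nn_integral_cmult_indicator) simp
  finally have main: "ennreal (\<tau>\<^sup>2 / 4 * (b / 2)) * emeasure lborel ?A \<le> ennreal (\<epsilon>\<^sup>2 * b)"
    using b by (simp add: ennreal_mult)
  define c where "c = \<tau>\<^sup>2 / 4 * (b / 2)"
  have c: "0 < c" using pos b by (simp add: c_def)
  then have "ennreal (1 / c) * ennreal c = 1"
    by (simp add: ennreal_mult[symmetric])
  then have "emeasure lborel ?A = ennreal (1 / c) * (ennreal c * emeasure lborel ?A)"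
    by (simp add: mult.assoc[symmetric])
  also have "\<dots> \<le> ennreal (1 / c) * ennreal (\<epsilon>\<^sup>2 * b)"
    using main unfolding c_def[symmetric] by (rule mult_left_mono) simp
  also have "\<dots> = ennreal (8 * \<epsilon>\<^sup>2 / \<tau>\<^sup>2)"
    using b pos by (simp add: c_def ennreal_mult[symmetric] field_simps)
  finally show ?thesis .
qed

text \<open>The \<open>k\<close>-th term accounts for the dyadic layer \<open>2 ^ k < \<bar>s\<bar> \<le> 2 ^ (k + 1)\<close>; where \<open>\<bar>s\<bar> \<le> 1\<close>, the
  square dominates because \<open>r \<ge> 2\<close>.\<close>

lemma powr_le_dyadic_sum:
  fixes s :: real
  assumes "2 \<le> r"
  shows "ennreal (\<bar>s\<bar> powr r)
    \<le> ennreal (s\<^sup>2) + (\<Sum>k. ennreal (2 powr ((real k + 1) * r)) * indicator {t. 2 ^ k < \<bar>t\<bar>} s)"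
proof (cases "\<bar>s\<bar> \<le> 1")
  case True
  have "\<bar>s\<bar> powr r \<le> s\<^sup>2"
  proof (cases "s = 0")
    case False
    have "\<bar>s\<bar> powr r \<le> \<bar>s\<bar> powr 2"
      using True False assms by (intro powr_mono') auto
    then show ?thesis using False by (simp add: powr_numeral)
  qed simp
  then show ?thesis by (simp add: ennreal_leI add_increasing2)
next
  case False
  obtain n where "\<bar>s\<bar> < 2 ^ n" using real_arch_pow[of 2 "\<bar>s\<bar>"] by auto
  then have ex: "\<bar>s\<bar> \<le> 2 ^ n" by simp
  define m where "m = (LEAST n. \<bar>s\<bar> \<le> 2 ^ n)"
  have m: "\<bar>s\<bar> \<le> 2 ^ m" unfolding m_def using ex by (rule LeastI)
  then have "m \<noteq> 0" using False by (intro notI) simp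
  then obtain k where k: "m = Suc k" using not0_implies_Suc by blast
  have "2 ^ k < \<bar>s\<bar>"
    using not_less_Least[of k "\<lambda>n. \<bar>s\<bar> \<le> 2 ^ n"] k by (simp add: m_def[symmetric])
  moreover have "\<bar>s\<bar> powr r \<le> 2 powr ((real k + 1) * r)"
  proof -
    have "\<bar>s\<bar> powr r \<le> (2 ^ Suc k) powr r"
      using m k assms by (intro powr_mono2) auto
    also have "\<dots> = 2 powr ((real k + 1) * r)"
      by (simp add: powr_realpow[symmetric] powr_powr add.commute del: power_Suc)
    finally show ?thesis .
  qed
  moreover define f where
    "f k = ennreal (2 powr ((real k + 1) * r)) * indicator {t. 2 ^ k < \<bar>t\<bar>} s" for k
  ultimately have "ennreal (\<bar>s\<bar> powr r) \<le> f k"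
    by (simp add: ennreal_leI)
  also have "f k \<le> (\<Sum>k. f k)"
    using sum_le_suminf[of f "{k}"] by simp
  finally show ?thesis unfolding f_def by (rule add_increasing[rotated]) simp
qed

text \<open>Normalised test functions: the integral is the square of the Sobolev norm.\<close>

definition unit_energy :: "('a::euclidean_space \<Rightarrow> real) \<Rightarrow> bool" where
  "unit_energy v \<longleftrightarrow> test_function UNIV v \<and>
     (\<integral>\<^sup>+x. ennreal ((norm (v x, gradient v x))\<^sup>2) \<partial>lborel) \<le> 1"

lemma unit_energyD:
  assumes "unit_energy v"
  shows "test_function UNIV v" "(\<integral>\<^sup>+x. ennreal ((v x)\<^sup>2) \<partial>lborel) \<le> 1"
    "(\<integral>\<^sup>+x. ennreal ((norm (gradient v x))\<^sup>2) \<partial>lborel) \<le> 1"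
proof -
  show "test_function UNIV v" using assms by (simp add: unit_energy_def)
  have *: "(\<integral>\<^sup>+x. ennreal ((norm (v x, gradient v x))\<^sup>2) \<partial>lborel) \<le> 1"
    using assms by (simp add: unit_energy_def)
  show "(\<integral>\<^sup>+x. ennreal ((v x)\<^sup>2) \<partial>lborel) \<le> 1"
    by (rule order.trans[OF nn_integral_mono *]) (auto simp: norm_Pair intro!: ennreal_leI)
  show "(\<integral>\<^sup>+x. ennreal ((norm (gradient v x))\<^sup>2) \<partial>lborel) \<le> 1"
    by (rule order.trans[OF nn_integral_mono *]) (auto simp: norm_Pair intro!: ennreal_leI)
qed

text \<open>With \<open>\<epsilon>\<close> proportional to \<open>\<tau> powr (- q / d)\<close>, the level sets of \<open>v\<close> decay like
  \<open>\<tau> powr (- (2 + 2 * q / d))\<close>, which is integrable against every smaller exponent \<open>r\<close>.\<close>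

lemma integrability_gain:
  fixes K :: real
  assumes K: "\<And>v::'a::euclidean_space \<Rightarrow> real. unit_energy v \<Longrightarrow>
      (\<integral>\<^sup>+x. ennreal (\<bar>v x\<bar> powr q) \<partial>lborel) \<le> ennreal K"
    and "0 < K" and q: "0 \<le> q" and r: "2 \<le> r" "r < 2 + 2 * q / real (DIM('a))"
  shows "\<exists>K'>0. \<forall>v::'a \<Rightarrow> real. unit_energy v \<longrightarrow>
      (\<integral>\<^sup>+x. ennreal (\<bar>v x\<bar> powr r) \<partial>lborel) \<le> ennreal K'"
proof -
  let ?d = "real (DIM('a))"
  define s where "s = 2 + 2 * q / ?d"
  \<comment> \<open>With this constant, \<open>\<epsilon>\<close> below meets the requirement of the level set estimate with equality.\<close>
  define c where "c = 2 * 2 powr q * K / unit_ball_vol ?d"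
  have ub: "0 < unit_ball_vol ?d" by simp
  have c: "0 < c" using \<open>0 < K\<close> by (simp add: c_def)
  define C where "C = 8 * (c powr (1 / ?d))\<^sup>2"
  have C: "0 < C" using c by (simp add: C_def)
  have level: "emeasure lborel {x. \<tau> < \<bar>v x\<bar>} \<le> ennreal (C * \<tau> powr (- s))"
    if v: "unit_energy v" and \<tau>: "0 < \<tau>" for v :: "'a \<Rightarrow> real" and \<tau>
  proof -
    define \<epsilon> where "\<epsilon> = (c * \<tau> powr (- q)) powr (1 / ?d)"
    have \<epsilon>: "0 < \<epsilon>" using c \<tau> by (simp add: \<epsilon>_def)
    have "\<epsilon> ^ DIM('a) = c * \<tau> powr (- q)"
      using \<epsilon> c \<tau> by (simp add: powr_realpow[symmetric] \<epsilon>_def powr_powr)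
    then have "(2 / \<tau>) powr q * K \<le> unit_ball_vol (DIM('a)) * \<epsilon> ^ DIM('a) / 2"
      using \<tau> ub by (simp add: c_def powr_divide powr_minus field_simps)
    then have "emeasure lborel {x. \<tau> < \<bar>v x\<bar>} \<le> ennreal (8 * \<epsilon>\<^sup>2 / \<tau>\<^sup>2)"
      using unit_energyD[OF v] K[OF v] q \<tau> \<epsilon> \<open>0 < K\<close> by (intro level_set_estimate) auto
    also have "8 * \<epsilon>\<^sup>2 / \<tau>\<^sup>2 = C * \<tau> powr (- s)"
    proof -
      have e1: "\<epsilon>\<^sup>2 = (c powr (1 / ?d))\<^sup>2 * (\<tau> powr (- q * (1 / ?d)))\<^sup>2"
        using c \<tau> by (simp only: \<epsilon>_def powr_mult powr_powr less_imp_le powr_ge_zero power_mult_distrib)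
      have e2: "(\<tau> powr (- q * (1 / ?d)))\<^sup>2 / \<tau>\<^sup>2 = \<tau> powr (- s)"
      proof -
        have "(\<tau> powr (- q * (1 / ?d)))\<^sup>2 / \<tau>\<^sup>2 = \<tau> powr (- q * (1 / ?d) * 2) / \<tau> powr 2"
          using \<tau> by (simp add: power2_eq_square powr_add[symmetric] mult.commute)
        also have "\<dots> = \<tau> powr (- q * (1 / ?d) * 2 - 2)" by (simp add: powr_diff)
        also have "- q * (1 / ?d) * 2 - 2 = - s" by (simp add: s_def)
        finally show ?thesis .
      qed
      show ?thesis unfolding C_def e1 e2[symmetric] by simp
    qed
    finally show ?thesis .
  qed
  define \<rho> where "\<rho> = 2 powr (r - s)"
  have \<rho>: "0 < \<rho>" "\<rho> < 1" using r by (simp_all add: \<rho>_def s_def powr_less_one)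
  define K' where "K' = 1 + (\<Sum>k. C * 2 powr r * \<rho> ^ k)"
  have sumK: "summable (\<lambda>k. C * 2 powr r * \<rho> ^ k)"
    using \<rho> by (intro summable_mult summable_geometric) auto
  have nonneg: "0 \<le> (\<Sum>k. C * 2 powr r * \<rho> ^ k)" using \<rho> C by (intro suminf_nonneg sumK) auto
  have "(\<integral>\<^sup>+x. ennreal (\<bar>v x\<bar> powr r) \<partial>lborel) \<le> ennreal K'" if v: "unit_energy v" for v :: "'a \<Rightarrow> real"
  proof -
    note [measurable] = test_function_measurable(1)[OF unit_energyD(1)[OF v]]
    let ?t = "\<lambda>k x. ennreal (2 powr ((real k + 1) * r)) * indicator {t. 2 ^ k < \<bar>t\<bar>} (v x)"
    have "(\<integral>\<^sup>+x. ennreal (\<bar>v x\<bar> powr r) \<partial>lborel) \<le> (\<integral>\<^sup>+x. ennreal ((v x)\<^sup>2) + (\<Sum>k. ?t k x) \<partial>lborel)"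
      by (intro nn_integral_mono powr_le_dyadic_sum r)
    also have "\<dots> = (\<integral>\<^sup>+x. ennreal ((v x)\<^sup>2) \<partial>lborel) + (\<integral>\<^sup>+x. (\<Sum>k. ?t k x) \<partial>lborel)"
      by (rule nn_integral_add) measurable
    also have "(\<integral>\<^sup>+x. (\<Sum>k. ?t k x) \<partial>lborel) = (\<Sum>k. \<integral>\<^sup>+x. ?t k x \<partial>lborel)"
      by (rule nn_integral_suminf) measurable
    also have "\<dots> \<le> (\<Sum>k. ennreal (C * 2 powr r * \<rho> ^ k))"
    proof (rule suminf_le)
      fix k
      have "(\<integral>\<^sup>+x. ?t k x \<partial>lborel)
          = ennreal (2 powr ((real k + 1) * r)) * emeasure lborel {x. 2 ^ k < \<bar>v x\<bar>}"
        by (subst nn_integral_cmult_indicator[symmetric]) (auto simp: indicator_def intro!: nn_integral_cong)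
      also have "\<dots> \<le> ennreal (2 powr ((real k + 1) * r)) * ennreal (C * (2 ^ k) powr (- s))"
        by (intro mult_left_mono level[OF v]) auto
      also have "\<dots> = ennreal (C * 2 powr r * \<rho> ^ k)"
      proof -
        have e: "2 powr ((real k + 1) * r) * (C * (2 ^ k) powr (- s)) = C * 2 powr r * \<rho> ^ k"
          by (simp add: \<rho>_def powr_realpow[symmetric] powr_powr powr_add[symmetric] algebra_simps)
        show ?thesis
          unfolding e[symmetric] using C by (intro ennreal_mult[symmetric]) auto
      qed
      finally show "(\<integral>\<^sup>+x. ?t k x \<partial>lborel) \<le> ennreal (C * 2 powr r * \<rho> ^ k)" .
    qed auto
    also have "\<dots> = ennreal (\<Sum>k. C * 2 powr r * \<rho> ^ k)"
      using C \<rho> by (intro suminf_ennreal2 sumK) auto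
    finally have "(\<integral>\<^sup>+x. ennreal (\<bar>v x\<bar> powr r) \<partial>lborel)
        \<le> (\<integral>\<^sup>+x. ennreal ((v x)\<^sup>2) \<partial>lborel) + ennreal (\<Sum>k. C * 2 powr r * \<rho> ^ k)"
      by (simp add: add_left_mono)
    also have "\<dots> \<le> 1 + ennreal (\<Sum>k. C * 2 powr r * \<rho> ^ k)"
      using unit_energyD(2)[OF v] by (rule add_right_mono)
    also have "\<dots> = ennreal K'"
      using nonneg by (simp add: K'_def)
    finally show ?thesis .
  qed
  moreover have "0 < K'" using nonneg by (simp add: K'_def)
  ultimately show ?thesis by blast
qed


text \<open>Iterating the gain from the exponent \<open>2\<close>: below the critical exponent the gain stays bounded
  away from zero, so every subcritical \<open>r\<close> is reached after finitely many steps.\<close>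

lemma unit_energy_Lr_bound:
  assumes r: "2 \<le> r" "r < 2 + 2 * r / real (DIM('a))"
  shows "\<exists>K>0. \<forall>v::'a::euclidean_space \<Rightarrow> real. unit_energy v \<longrightarrow>
      (\<integral>\<^sup>+x. ennreal (\<bar>v x\<bar> powr r) \<partial>lborel) \<le> ennreal K"
proof -
  let ?d = "real (DIM('a))"
  define gain where "gain t = 2 + 2 * t / ?d - t" for t :: real
  define \<eta> where "\<eta> = min (gain 2) (gain r)"
  have d: "0 < ?d" by simp
  have \<eta>: "0 < \<eta>" using r d by (simp add: \<eta>_def gain_def)
  \<comment> \<open>The gain is affine in the exponent, so on \<open>[2, r]\<close> it is smallest at an end point.\<close>
  have gain: "\<eta> \<le> gain t" if "2 \<le> t" "t \<le> r" for t
  proof (cases "2 / ?d \<le> 1")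
    case True
    have "(1 - 2 / ?d) * t \<le> (1 - 2 / ?d) * r" using True that by (intro mult_left_mono) auto
    then have "gain r \<le> gain t" by (simp add: gain_def algebra_simps)
    then show ?thesis by (simp add: \<eta>_def)
  next
    case False
    have "(2 / ?d - 1) * 2 \<le> (2 / ?d - 1) * t" using False that by (intro mult_left_mono) auto
    then have "gain 2 \<le> gain t" by (simp add: gain_def algebra_simps)
    then show ?thesis by (simp add: \<eta>_def)
  qed
  define e where "e n = min r (2 + real n * (\<eta> / 2))" for n :: nat
  have e: "2 \<le> e n" "e n \<le> r" for n using r \<eta> by (auto simp: e_def)
  have "\<exists>K>0. \<forall>v::'a \<Rightarrow> real. unit_energy v \<longrightarrow>
      (\<integral>\<^sup>+x. ennreal (\<bar>v x\<bar> powr e n) \<partial>lborel) \<le> ennreal K" for n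
  proof (induction n)
    case 0
    have "e 0 = 2" using r by (simp add: e_def)
    moreover have "\<bar>v x\<bar> powr 2 = (v x)\<^sup>2" for v :: "'a \<Rightarrow> real" and x
      by simp
    ultimately show ?case using unit_energyD(2) by (intro exI[of _ 1]) auto
  next
    case (Suc n)
    then obtain K where K: "0 < K" "\<And>v::'a \<Rightarrow> real. unit_energy v \<Longrightarrow>
      (\<integral>\<^sup>+x. ennreal (\<bar>v x\<bar> powr e n) \<partial>lborel) \<le> ennreal K" by blast
    have "e (Suc n) \<le> e n + \<eta> / 2" using \<eta> by (simp add: e_def field_simps min_def)
    also have "\<dots> < e n + gain (e n)" using gain[OF e] \<eta> by (simp add: field_simps) (smt (verit))
    finally have "e (Suc n) < 2 + 2 * e n / ?d" by (simp add: gain_def)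
    with integrability_gain[OF K(2,1) _ e(1)] e(1)[of n] show ?case by (simp add: order.trans)
  qed
  moreover obtain n :: nat where "r / (\<eta> / 2) < real n" using reals_Archimedean2 by blast
  then have "e n = r" using \<eta> r by (simp add: e_def field_simps)
  ultimately show ?thesis by metis
qed

lemma l2_AE_convergent_subsequence:
  fixes X :: "nat \<Rightarrow> ('a::euclidean_space, 'b::euclidean_space) l2"
  assumes "X \<longlonglongrightarrow> u"
  obtains k where "strict_mono (k :: nat \<Rightarrow> nat)" "AE x in lborel. (\<lambda>n. rep_l2 (X (k n)) x) \<longlonglongrightarrow> rep_l2 u x"
proof -
  let ?D = "\<lambda>n x. (norm (rep_l2 (X n) x - rep_l2 u x))\<^sup>2"
  have i: "integrable lborel (?D n)" for n
    using square_integrable_diff[OF rep_l2_square_integrable rep_l2_square_integrable, of "X n" u]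
    by (simp add: square_integrable_def)
  have D: "(\<integral>x. norm (?D n x) \<partial>lborel) = (norm (X n - u))\<^sup>2" for n
  proof -
    have "ennreal (\<integral>x. ?D n x \<partial>lborel) = ennreal ((norm (X n - u))\<^sup>2)"
      unfolding norm_l2_diff_power2 using i by (intro nn_integral_eq_integral[symmetric]) auto
    then show ?thesis by (subst (asm) ennreal_inj) auto
  qed
  have "(\<lambda>n. (norm (X n - u))\<^sup>2) \<longlonglongrightarrow> (norm (u - u))\<^sup>2" by (intro tendsto_intros assms)
  then have "(\<lambda>n. \<integral>x. norm (?D n x) \<partial>lborel) \<longlonglongrightarrow> 0" unfolding D by simp
  from tendsto_L1_AE_subseq[OF i this] obtain k :: "nat \<Rightarrow> nat" where k: "strict_mono k"
    "AE x in lborel. (\<lambda>n. ?D (k n) x) \<longlonglongrightarrow> 0" by blast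
  have "AE x in lborel. (\<lambda>n. rep_l2 (X (k n)) x) \<longlonglongrightarrow> rep_l2 u x"
    using k(2)
  proof (rule eventually_mono)
    fix x assume "(\<lambda>n. ?D (k n) x) \<longlonglongrightarrow> 0"
    then have "(\<lambda>n. sqrt (?D (k n) x)) \<longlonglongrightarrow> sqrt 0" by (rule tendsto_real_sqrt)
    then have "(\<lambda>n. norm (rep_l2 (X (k n)) x - rep_l2 u x)) \<longlonglongrightarrow> 0" by simp
    then show "(\<lambda>n. rep_l2 (X (k n)) x) \<longlonglongrightarrow> rep_l2 u x"
      using Lim_null tendsto_norm_zero_iff by blast
  qed
  with k(1) show ?thesis by (rule that)
qed

lemma fn_measurable [measurable]: "fn u \<in> borel_measurable borel"
  unfolding fn_def[abs_def]
  by (rule measurable_compose[OF rep_l2_measurable borel_measurable_continuous_onI])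
    (intro continuous_intros)

lemma fn_scaleR: "AE x in lborel. fn (c *\<^sub>R u) x = c * fn u x"
  using rep_l2_scaleR[of c u] by (auto elim!: eventually_mono simp: fn_def)

lemma fn_add: "AE x in lborel. fn (u + v) x = fn u x + fn v x"
  using rep_l2_add[of u v] by (auto elim!: eventually_mono simp: fn_def)

text \<open>The condition on \<open>r\<close> says \<open>r < 2 d / (d - 2)\<close> in dimension \<open>d \<ge> 3\<close> and holds for every \<open>r > 0\<close> in
  dimensions one and two. An element of norm less than one is a limit of test functions of norm
  at most one, and Fatou's lemma carries the bound to the limit; scaling gives the general case.\<close>

theorem Sobolev_inequality:
  assumes r: "2 \<le> r" "r < 2 + 2 * r / real (DIM('a))"
  shows "\<exists>K>0. \<forall>\<Omega>. \<forall>u\<in>H10 (\<Omega> :: 'a::euclidean_space set).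
    (\<integral>\<^sup>+x. ennreal (\<bar>fn u x\<bar> powr r) \<partial>lborel) \<le> ennreal (K * norm u powr r)"
proof -
  obtain K where K: "0 < K" "\<And>v::'a \<Rightarrow> real. unit_energy v \<Longrightarrow>
      (\<integral>\<^sup>+x. ennreal (\<bar>v x\<bar> powr r) \<partial>lborel) \<le> ennreal K"
    using unit_energy_Lr_bound[OF r] by blast
  have small: "(\<integral>\<^sup>+x. ennreal (\<bar>fn u x\<bar> powr r) \<partial>lborel) \<le> ennreal K"
    if u: "u \<in> H10 \<Omega>" and less: "norm u < 1" for u :: "'a sobolev" and \<Omega>
  proof -
    obtain v where v: "\<And>n. test_function \<Omega> (v n)" "(\<lambda>n. of_test (v n)) \<longlonglongrightarrow> u"
      using H10_sequence[OF u] by blast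
    obtain k where k: "strict_mono (k :: nat \<Rightarrow> nat)"
      "AE x in lborel. (\<lambda>n. rep_l2 (of_test (v (k n))) x) \<longlonglongrightarrow> rep_l2 u x"
      using l2_AE_convergent_subsequence[OF v(2)] by blast
    have "(\<lambda>n. norm (of_test (v (k n)))) \<longlonglongrightarrow> norm u"
      using LIMSEQ_subseq_LIMSEQ[OF tendsto_norm[OF v(2)] k(1)] by (simp add: o_def)
    then have "\<forall>\<^sub>F n in sequentially. norm (of_test (v (k n))) < 1"
      using less by (rule order_tendstoD)
    then obtain N where N: "\<And>n. N \<le> n \<Longrightarrow> norm (of_test (v (k n))) < 1"
      by (auto simp: eventually_sequentially)
    have energy: "unit_energy (v (k n))" if "N \<le> n" for n
    proof -
      have "(\<integral>\<^sup>+x. ennreal ((norm (v (k n) x, gradient (v (k n)) x))\<^sup>2) \<partial>lborel)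
          = ennreal ((norm (of_test (v (k n))))\<^sup>2)"
        unfolding norm_l2_power2
        by (rule nn_integral_cong_AE, rule eventually_mono[OF rep_of_test[OF v(1)[of "k n"]]]) simp
      also have "\<dots> \<le> 1" using N[OF that] by (simp add: power_le_one)
      finally show ?thesis using v(1) by (simp add: unit_energy_def test_function_def)
    qed
    have rep: "AE x in lborel. \<forall>n. rep_l2 (of_test (v (k n))) x = (v (k n) x, gradient (v (k n)) x)"
      using rep_of_test[OF v(1)] by (subst AE_all_countable) auto
    show ?thesis
    proof (rule nn_integral_le_of_AE_limit)
      show "(\<lambda>x. ennreal (\<bar>v (k n) x\<bar> powr r)) \<in> borel_measurable lborel" for n
        using test_function_measurable(1)[OF v(1)[of "k n"]] by simp
      show "AE x in lborel. (\<lambda>n. ennreal (\<bar>v (k n) x\<bar> powr r)) \<longlonglongrightarrow> ennreal (\<bar>fn u x\<bar> powr r)"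
        using k(2) rep
      proof eventually_elim
        case (elim x)
        then have "(\<lambda>n. v (k n) x) \<longlonglongrightarrow> fn u x"
          using tendsto_fst[OF elim(1)] by (simp add: fn_def)
        then show ?case using r by (intro tendsto_intros tendsto_powr2) auto
      qed
      show "(\<integral>\<^sup>+x. ennreal (\<bar>v (k n) x\<bar> powr r) \<partial>lborel) \<le> ennreal K" if "N \<le> n" for n
        using K(2)[OF energy[OF that]] .
    qed
  qed
  have "(\<integral>\<^sup>+x. ennreal (\<bar>fn u x\<bar> powr r) \<partial>lborel) \<le> ennreal ((2 powr r * K) * norm u powr r)"
    if u: "u \<in> H10 \<Omega>" for u :: "'a sobolev" and \<Omega>
  proof (cases "u = 0")
    case True
    have "AE x in lborel. fn u x = 0" using fn_scaleR[of 0 u] by (simp add: True)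
    then have "(\<integral>\<^sup>+x. ennreal (\<bar>fn u x\<bar> powr r) \<partial>lborel) = (\<integral>\<^sup>+(x::'a). 0 \<partial>lborel)"
      using r by (intro nn_integral_cong_AE) (auto elim!: eventually_mono)
    then show ?thesis by simp
  next
    case False
    define c where "c = 1 / (2 * norm u)"
    have c: "0 < c" using False by (simp add: c_def)
    have "(\<integral>\<^sup>+x. ennreal (\<bar>fn (c *\<^sub>R u) x\<bar> powr r) \<partial>lborel) \<le> ennreal K"
    proof (rule small)
      show "c *\<^sub>R u \<in> H10 \<Omega>" using u subspace_H10 by (rule subspace_scale[rotated])
      show "norm (c *\<^sub>R u) < 1" using False by (simp add: c_def)
    qed
    moreover have "(\<integral>\<^sup>+x. ennreal (\<bar>fn (c *\<^sub>R u) x\<bar> powr r) \<partial>lborel)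
        = (\<integral>\<^sup>+x. ennreal (c powr r) * ennreal (\<bar>fn u x\<bar> powr r) \<partial>lborel)"
      using c fn_scaleR[of c u]
      by (intro nn_integral_cong_AE) (auto elim!: eventually_mono simp: abs_mult powr_mult ennreal_mult[symmetric])
    ultimately have *: "ennreal (c powr r) * (\<integral>\<^sup>+x. ennreal (\<bar>fn u x\<bar> powr r) \<partial>lborel) \<le> ennreal K"
      by (simp add: nn_integral_cmult)
    have inv: "(1 / c) powr r * c powr r = 1"
      using c by (simp add: powr_divide)
    have "(\<integral>\<^sup>+x. ennreal (\<bar>fn u x\<bar> powr r) \<partial>lborel)
        = ennreal ((1 / c) powr r) * (ennreal (c powr r) * (\<integral>\<^sup>+x. ennreal (\<bar>fn u x\<bar> powr r) \<partial>lborel))"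
      using inv by (simp add: mult.assoc[symmetric] ennreal_mult[symmetric] del: times_divide_eq_left)
    also have "\<dots> \<le> ennreal ((1 / c) powr r) * ennreal K"
      using * by (rule mult_left_mono) simp
    also have "\<dots> = ennreal ((2 powr r * K) * norm u powr r)"
      using K(1) False by (simp add: c_def powr_mult ennreal_mult[symmetric] mult_ac)
    finally show ?thesis .
  qed
  then show ?thesis using K(1) by (intro exI[of _ "2 powr r * K"]) auto
qed

section \<open>The power nonlinearity\<close>

definition signed_power :: "real \<Rightarrow> real \<Rightarrow> real" where
  "signed_power p s = \<bar>s\<bar> powr (p - 1) * s"

lemma nonlin_eq: "nonlin p u x = signed_power p (fn u x)"
  by (simp add: nonlin_def signed_power_def)

lemma powr_minus_one_times_abs: "\<bar>s::real\<bar> powr (p - 1) * \<bar>s\<bar> = \<bar>s\<bar> powr p"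
  by (cases "s = 0") (simp_all add: powr_diff)

lemma abs_signed_power: "\<bar>signed_power p s\<bar> = \<bar>s\<bar> powr p"
  by (simp add: signed_power_def abs_mult powr_minus_one_times_abs)

lemma signed_power_mult: "signed_power p (s * t) = signed_power p s * signed_power p t"
  by (simp add: signed_power_def abs_mult powr_mult)

text \<open>Both sides are homogeneous of degree \<open>p\<close>, so it suffices to treat \<open>a = 1\<close>: there the first
  term on the right comes from differentiability for small \<open>b\<close>, the second one bounds everything
  when \<open>b\<close> is not small.\<close>

lemma signed_power_linearisation:
  assumes p: "1 < p" and "0 < e"
  shows "\<exists>C>0. \<forall>a b. \<bar>signed_power p (a + b) - signed_power p a - p * \<bar>a\<bar> powr (p - 1) * b\<bar>
    \<le> e * (\<bar>a\<bar> powr (p - 1) * \<bar>b\<bar>) + C * \<bar>b\<bar> powr p"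
proof -
  have "((\<lambda>s. signed_power p s) has_real_derivative p) (at 1)"
  proof (rule has_field_derivative_transform_within_open)
    show "((\<lambda>s. s powr p) has_real_derivative p) (at 1)"
      by (auto intro!: derivative_eq_intros)
    show "s powr p = signed_power p s" if "s \<in> {0<..}" for s :: real
      using that by (simp add: signed_power_def powr_diff)
  qed auto
  then have "((\<lambda>s. signed_power p s) has_derivative (\<lambda>h. p * h)) (at 1)"
    by (simp add: has_field_derivative_def)
  then obtain \<delta> where \<delta>: "0 < \<delta>"
    "\<And>y. \<bar>y - 1\<bar> < \<delta> \<Longrightarrow> \<bar>signed_power p y - signed_power p 1 - p * (y - 1)\<bar> \<le> e * \<bar>y - 1\<bar>"
    unfolding has_derivative_at_alt real_norm_def using \<open>0 < e\<close> by blast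
  \<comment> \<open>Where \<open>\<bar>b\<bar> \<ge> \<delta>\<close>, the three summands account for \<open>\<bar>1 + b\<bar> powr p\<close>, \<open>1\<close> and \<open>p * \<bar>b\<bar>\<close>.\<close>
  define C where "C = (1 / \<delta> + 1) powr p + (1 / \<delta>) powr p + p * \<delta> powr (1 - p)"
  have C1: "1 \<le> C"
  proof -
    have "1 \<le> (1 / \<delta> + 1) powr p" using \<delta>(1) p by (intro ge_one_powr_ge_zero) auto
    then show ?thesis using p by (simp add: C_def add_increasing2)
  qed
  have one: "\<bar>signed_power p (1 + b) - 1 - p * b\<bar> \<le> e * \<bar>b\<bar> + C * \<bar>b\<bar> powr p" for b
  proof (cases "\<bar>b\<bar> < \<delta>")
    case True
    have "\<bar>signed_power p (1 + b) - 1 - p * b\<bar> \<le> e * \<bar>b\<bar>"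
      using \<delta>(2)[of "1 + b"] True by (simp add: signed_power_def)
    moreover have "0 \<le> C * \<bar>b\<bar> powr p" using C1 by simp
    ultimately show ?thesis by simp
  next
    case False
    then have b: "\<delta> \<le> \<bar>b\<bar>" by simp
    have "\<bar>1 + b\<bar> powr p \<le> ((1 / \<delta> + 1) * \<bar>b\<bar>) powr p"
    proof (rule powr_mono2)
      have "1 \<le> 1 / \<delta> * \<bar>b\<bar>" using b \<delta>(1) by (simp add: field_simps)
      then show "\<bar>1 + b\<bar> \<le> (1 / \<delta> + 1) * \<bar>b\<bar>" unfolding distrib_right by linarith
    qed (use p in auto)
    then have 1: "\<bar>1 + b\<bar> powr p \<le> (1 / \<delta> + 1) powr p * \<bar>b\<bar> powr p"
      using \<delta>(1) by (simp add: powr_mult)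
    have "1 \<le> (1 / \<delta> * \<bar>b\<bar>) powr p"
      using b \<delta>(1) p by (intro ge_one_powr_ge_zero) (auto simp: field_simps)
    then have 2: "1 \<le> (1 / \<delta>) powr p * \<bar>b\<bar> powr p"
      using \<delta>(1) by (subst (asm) powr_mult) auto
    have "\<bar>b\<bar> powr (1 - p) \<le> \<delta> powr (1 - p)"
      using b \<delta>(1) p by (intro powr_mono2') auto
    then have "\<bar>b\<bar> powr (1 - p) * \<bar>b\<bar> powr p \<le> \<delta> powr (1 - p) * \<bar>b\<bar> powr p"
      by (intro mult_right_mono) auto
    moreover have "\<bar>b\<bar> powr (1 - p) * \<bar>b\<bar> powr p = \<bar>b\<bar>"
      using b \<delta>(1) by (simp add: powr_add[symmetric])
    ultimately have 3: "p * \<bar>b\<bar> \<le> p * \<delta> powr (1 - p) * \<bar>b\<bar> powr p"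
      using p by (simp add: mult.assoc)
    have "\<bar>signed_power p (1 + b) - 1 - p * b\<bar> \<le> \<bar>signed_power p (1 + b)\<bar> + 1 + \<bar>p * b\<bar>"
      by linarith
    also have "\<dots> = \<bar>1 + b\<bar> powr p + 1 + p * \<bar>b\<bar>"
      using p by (simp add: abs_signed_power abs_mult)
    also have "\<dots> \<le> C * \<bar>b\<bar> powr p"
      using 1 2 3 unfolding C_def distrib_right by linarith
    also have "\<dots> \<le> e * \<bar>b\<bar> + C * \<bar>b\<bar> powr p" using \<open>0 < e\<close> by simp
    finally show ?thesis .
  qed
  have "\<bar>signed_power p (a + b) - signed_power p a - p * \<bar>a\<bar> powr (p - 1) * b\<bar>
    \<le> e * (\<bar>a\<bar> powr (p - 1) * \<bar>b\<bar>) + C * \<bar>b\<bar> powr p" for a b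
  proof (cases "a = 0")
    case True
    have "1 * \<bar>b\<bar> powr p \<le> C * \<bar>b\<bar> powr p" using C1 by (intro mult_right_mono) auto
    then show ?thesis using True abs_signed_power[of p b] by (simp add: signed_power_def)
  next
    case False
    have "a + b = a * (1 + b / a)" using False by (simp add: field_simps)
    then have "signed_power p (a + b) = signed_power p a * signed_power p (1 + b / a)"
      by (metis signed_power_mult)
    moreover have "p * \<bar>a\<bar> powr (p - 1) * b = signed_power p a * (p * (b / a))"
      using False by (simp add: signed_power_def)
    ultimately have "signed_power p (a + b) - signed_power p a - p * \<bar>a\<bar> powr (p - 1) * b
        = signed_power p a * (signed_power p (1 + b / a) - 1 - p * (b / a))"
      by (simp only: right_diff_distrib mult_1_right)
    then have "\<bar>signed_power p (a + b) - signed_power p a - p * \<bar>a\<bar> powr (p - 1) * b\<bar>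
        = \<bar>a\<bar> powr p * \<bar>signed_power p (1 + b / a) - 1 - p * (b / a)\<bar>"
      by (simp only: abs_mult abs_signed_power)
    also have "\<dots> \<le> \<bar>a\<bar> powr p * (e * \<bar>b / a\<bar> + C * \<bar>b / a\<bar> powr p)"
      by (rule mult_left_mono[OF one]) simp
    also have "\<dots> = e * (\<bar>a\<bar> powr (p - 1) * \<bar>b\<bar>) + C * \<bar>b\<bar> powr p"
      using False by (simp add: powr_diff powr_divide field_simps)
    finally show ?thesis .
  qed
  then show ?thesis using C1 by (intro exI[of _ C]) auto
qed

lemma powr_mult_mult_le_sum:
  fixes x y z :: real
  assumes "0 \<le> x" "0 \<le> y" "0 \<le> z" "1 < p"
  shows "x powr (p - 1) * y * z \<le> x powr (p + 1) + y powr (p + 1) + z powr (p + 1)"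
proof -
  define m where "m = max x (max y z)"
  have m: "x \<le> m" "y \<le> m" "z \<le> m" "0 \<le> m" using assms by (auto simp: m_def)
  have "x powr (p - 1) * y * z \<le> m powr (p - 1) * m * m"
    using m assms by (intro mult_mono powr_mono2) auto
  also have "\<dots> = m powr (p + 1)"
    using m(4) by (cases "m = 0") (auto simp: powr_diff powr_add)
  also have "\<dots> \<le> x powr (p + 1) + y powr (p + 1) + z powr (p + 1)"
    unfolding m_def max_def by (auto simp: add_nonneg_nonneg)
  finally show ?thesis .
qed

section \<open>The dual pairing and the inverse operator\<close>

lemma Lop_eq_inner:
  assumes "open \<Omega>" "u \<in> H10 \<Omega>" "v \<in> H10 \<Omega>"
  shows "Lop \<Omega> u v = u \<bullet> v"
proof -
  have [measurable]: "\<Omega> \<in> sets borel" using assms(1) by simp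
  have "Lop \<Omega> u v = (\<integral>x. indicator \<Omega> x *\<^sub>R (rep_l2 u x \<bullet> rep_l2 v x) \<partial>lborel)"
    using assms(3) by (simp add: Lop_def set_lebesgue_integral_def fn_def grad_def inner_prod_def)
  also have "\<dots> = (\<integral>x. rep_l2 u x \<bullet> rep_l2 v x \<partial>lborel)"
    by (rule integral_cong_AE, measurable)
      (rule eventually_mono[OF H10_outside[OF assms(2)]], auto simp: indicator_def)
  finally show ?thesis by (simp add: inner_l2.rep_eq)
qed

lemma as_dual_eq:
  assumes "open \<Omega>" "v \<in> H10 \<Omega>" and [measurable]: "g \<in> borel_measurable borel"
  shows "as_dual \<Omega> g v = (\<integral>x. g x * fn v x \<partial>lborel)"
proof -
  have [measurable]: "\<Omega> \<in> sets borel" using assms(1) by simp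
  have "as_dual \<Omega> g v = (\<integral>x. indicator \<Omega> x *\<^sub>R (g x * fn v x) \<partial>lborel)"
    using assms(2) by (simp add: as_dual_def set_lebesgue_integral_def)
  also have "\<dots> = (\<integral>x. g x * fn v x \<partial>lborel)"
    by (rule integral_cong_AE, measurable)
      (rule eventually_mono[OF H10_outside[OF assms(2)]], auto simp: indicator_def fn_def)
  finally show ?thesis .
qed

text \<open>Under the inner product of the Sobolev space, inverting \<open>I - \<Delta>\<close> is Riesz representation.\<close>

lemma Linv_represents:
  assumes "open \<Omega>" and [measurable]: "g \<in> borel_measurable borel"
    and int: "\<And>v. v \<in> H10 \<Omega> \<Longrightarrow> integrable lborel (\<lambda>x. g x * fn v x)"
    and bound: "\<And>v. v \<in> H10 \<Omega> \<Longrightarrow> \<bar>\<integral>x. g x * fn v x \<partial>lborel\<bar> \<le> C * norm v"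
  shows "Linv \<Omega> (as_dual \<Omega> g) \<in> H10 \<Omega>"
    and "\<And>v. v \<in> H10 \<Omega> \<Longrightarrow> Linv \<Omega> (as_dual \<Omega> g) \<bullet> v = (\<integral>x. g x * fn v x \<partial>lborel)"
proof -
  have "\<exists>w\<in>H10 \<Omega>. \<forall>v\<in>H10 \<Omega>. w \<bullet> v = (\<integral>x. g x * fn v x \<partial>lborel)"
  proof (rule riesz_representation_on[OF subspace_H10 closed_H10])
    fix u v assume uv: "u \<in> H10 \<Omega>" "v \<in> H10 \<Omega>"
    have "(\<integral>x. g x * fn (u + v) x \<partial>lborel) = (\<integral>x. g x * fn u x + g x * fn v x \<partial>lborel)"
      by (rule integral_cong_AE, measurable)
        (rule eventually_mono[OF fn_add[of u v]], simp add: distrib_left)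
    then show "(\<integral>x. g x * fn (u + v) x \<partial>lborel)
        = (\<integral>x. g x * fn u x \<partial>lborel) + (\<integral>x. g x * fn v x \<partial>lborel)"
      using int uv by simp
  next
    fix c u assume u: "u \<in> H10 \<Omega>"
    have "(\<integral>x. g x * fn (c *\<^sub>R u) x \<partial>lborel) = (\<integral>x. c * (g x * fn u x) \<partial>lborel)"
      by (rule integral_cong_AE, measurable)
        (rule eventually_mono[OF fn_scaleR[of c u]], simp)
    then show "(\<integral>x. g x * fn (c *\<^sub>R u) x \<partial>lborel) = c * (\<integral>x. g x * fn u x \<partial>lborel)"
      by simp
  qed (rule bound)
  then obtain w where w: "w \<in> H10 \<Omega>" "\<And>v. v \<in> H10 \<Omega> \<Longrightarrow> w \<bullet> v = (\<integral>x. g x * fn v x \<partial>lborel)"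
    by blast
  have "Lop \<Omega> w = as_dual \<Omega> g"
  proof
    fix v
    show "Lop \<Omega> w v = as_dual \<Omega> g v"
    proof (cases "v \<in> H10 \<Omega>")
      case True
      then show ?thesis using w assms(1) by (simp add: Lop_eq_inner as_dual_eq)
    next
      case False
      then show ?thesis by (simp add: Lop_def as_dual_def)
    qed
  qed
  then have img: "as_dual \<Omega> g \<in> Lop \<Omega> ` H10 \<Omega>"
    using imageI[OF w(1), of "Lop \<Omega>"] by simp
  show in_H: "Linv \<Omega> (as_dual \<Omega> g) \<in> H10 \<Omega>"
    unfolding Linv_def using img by (rule inv_into_into)
  show "Linv \<Omega> (as_dual \<Omega> g) \<bullet> v = (\<integral>x. g x * fn v x \<partial>lborel)" if "v \<in> H10 \<Omega>" for v
  proof -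
    have "Lop \<Omega> (Linv \<Omega> (as_dual \<Omega> g)) = as_dual \<Omega> g"
      unfolding Linv_def using img by (rule f_inv_into_f)
    then show ?thesis
      using Lop_eq_inner[OF assms(1) in_H that] as_dual_eq[OF assms(1) that assms(2)] by simp
  qed
qed

text \<open>The constant \<open>K\<close> of the embedding into \<open>L\<^sup>p\<^sup>+\<^sup>1\<close> is a parameter, so that the estimates below can be
  stated with explicit constants.\<close>

locale subcritical_power =
  fixes \<Omega> :: "'a::euclidean_space set" and p K :: real
  assumes open_\<Omega>: "open \<Omega>" and p: "1 < p" and K: "0 < K"
    and Sobolev: "\<And>u. u \<in> H10 \<Omega> \<Longrightarrow>
      (\<integral>\<^sup>+x. ennreal (\<bar>fn u x\<bar> powr (p + 1)) \<partial>lborel) \<le> ennreal (K * norm u powr (p + 1))"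
begin

abbreviation H where "H \<equiv> H10 \<Omega>"

lemma subspace: "subspace H"
  by (rule subspace_H10)

lemma fn_zero: "AE x in lborel. fn (0 :: 'a sobolev) x = 0"
  using fn_scaleR[of 0 "0 :: 'a sobolev"] by simp

text \<open>A Hoelder inequality: after normalisation the product is at most the sum of the
  \<open>(p + 1)\<close>-st powers.\<close>

lemma trilinear_bound_nn:
  assumes uhv: "u \<in> H" "h \<in> H" "v \<in> H"
  shows "(\<integral>\<^sup>+x. ennreal (\<bar>fn u x\<bar> powr (p - 1) * \<bar>fn h x\<bar> * \<bar>fn v x\<bar>) \<partial>lborel)
    \<le> ennreal (3 * K * (norm u powr (p - 1) * norm h * norm v))"
proof (cases "u = 0 \<or> h = 0 \<or> v = 0")
  case True
  have "AE x in lborel. \<bar>fn u x\<bar> powr (p - 1) * \<bar>fn h x\<bar> * \<bar>fn v x\<bar> = 0"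
    using fn_zero by (rule eventually_mono) (use True in auto)
  then have "(\<integral>\<^sup>+x. ennreal (\<bar>fn u x\<bar> powr (p - 1) * \<bar>fn h x\<bar> * \<bar>fn v x\<bar>) \<partial>lborel)
      = (\<integral>\<^sup>+(x::'a). 0 \<partial>lborel)"
    by (intro nn_integral_cong_AE) (auto elim!: eventually_mono)
  then show ?thesis by simp
next
  case False
  define c where "c = norm u powr (p - 1) * norm h * norm v"
  define F where "F w x = (\<bar>fn w x\<bar> / norm w) powr (p + 1)" for w :: "'a sobolev" and x
  have [measurable]: "F w \<in> borel_measurable borel" for w unfolding F_def by measurable
  have F: "(\<integral>\<^sup>+x. ennreal (F w x) \<partial>lborel) \<le> ennreal K" if w: "w \<in> H" "w \<noteq> 0" for w
  proof -
    let ?n = "1 / norm w powr (p + 1)"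
    have "(\<integral>\<^sup>+x. ennreal (F w x) \<partial>lborel)
        = (\<integral>\<^sup>+x. ennreal ?n * ennreal (\<bar>fn w x\<bar> powr (p + 1)) \<partial>lborel)"
      by (simp add: F_def powr_divide ennreal_mult[symmetric])
    also have "\<dots> = ennreal ?n * (\<integral>\<^sup>+x. ennreal (\<bar>fn w x\<bar> powr (p + 1)) \<partial>lborel)"
      by (rule nn_integral_cmult) simp
    also have "\<dots> \<le> ennreal ?n * ennreal (K * norm w powr (p + 1))"
      using Sobolev[OF w(1)] by (rule mult_left_mono) simp
    also have "\<dots> = ennreal K"
      using K w(2) by (simp add: ennreal_mult[symmetric])
    finally show ?thesis .
  qed
  have "(\<integral>\<^sup>+x. ennreal (\<bar>fn u x\<bar> powr (p - 1) * \<bar>fn h x\<bar> * \<bar>fn v x\<bar>) \<partial>lborel)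
      \<le> (\<integral>\<^sup>+x. ennreal c * (ennreal (F u x) + ennreal (F h x) + ennreal (F v x)) \<partial>lborel)"
  proof (rule nn_integral_mono)
    fix x
    have "\<bar>fn u x\<bar> powr (p - 1) * \<bar>fn h x\<bar> * \<bar>fn v x\<bar>
        = c * ((\<bar>fn u x\<bar> / norm u) powr (p - 1) * (\<bar>fn h x\<bar> / norm h) * (\<bar>fn v x\<bar> / norm v))"
      using False by (simp add: c_def powr_divide)
    also have "\<dots> \<le> c * (F u x + F h x + F v x)"
      unfolding F_def by (intro mult_left_mono powr_mult_mult_le_sum p) (auto simp: c_def)
    finally show "ennreal (\<bar>fn u x\<bar> powr (p - 1) * \<bar>fn h x\<bar> * \<bar>fn v x\<bar>)
        \<le> ennreal c * (ennreal (F u x) + ennreal (F h x) + ennreal (F v x))"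
      by (simp add: F_def c_def ennreal_mult[symmetric] ennreal_leI flip: ennreal_plus)
  qed
  also have "\<dots> = ennreal c * ((\<integral>\<^sup>+x. ennreal (F u x) \<partial>lborel) + (\<integral>\<^sup>+x. ennreal (F h x) \<partial>lborel)
      + (\<integral>\<^sup>+x. ennreal (F v x) \<partial>lborel))"
    by (simp add: nn_integral_cmult nn_integral_add)
  also have "\<dots> \<le> ennreal c * (ennreal K + ennreal K + ennreal K)"
    using False uhv by (intro mult_left_mono add_mono F) auto
  also have "\<dots> = ennreal (3 * K * c)"
    using K by (simp add: c_def ennreal_mult[symmetric] flip: ennreal_plus)
  finally show ?thesis by (simp add: c_def)
qed

lemma trilinear_bound:
  assumes "u \<in> H" "h \<in> H" "v \<in> H"
  shows "integrable lborel (\<lambda>x. \<bar>fn u x\<bar> powr (p - 1) * \<bar>fn h x\<bar> * \<bar>fn v x\<bar>)"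
    and "(\<integral>x. \<bar>fn u x\<bar> powr (p - 1) * \<bar>fn h x\<bar> * \<bar>fn v x\<bar> \<partial>lborel)
      \<le> 3 * K * (norm u powr (p - 1) * norm h * norm v)"
proof -
  let ?f = "\<lambda>x. \<bar>fn u x\<bar> powr (p - 1) * \<bar>fn h x\<bar> * \<bar>fn v x\<bar>"
  note b = trilinear_bound_nn[OF assms]
  show i: "integrable lborel ?f"
    by (rule integrableI_nonneg) (use b in \<open>auto intro: le_less_trans\<close>)
  have "ennreal (\<integral>x. ?f x \<partial>lborel) \<le> ennreal (3 * K * (norm u powr (p - 1) * norm h * norm v))"
    using b by (subst nn_integral_eq_integral[symmetric, OF i]) auto
  then show "(\<integral>x. ?f x \<partial>lborel) \<le> 3 * K * (norm u powr (p - 1) * norm h * norm v)"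
    using K by (subst (asm) ennreal_le_iff) auto
qed

lemma pairing_bound:
  assumes [measurable]: "g \<in> borel_measurable borel"
    and g: "AE x in lborel. \<bar>g x\<bar> \<le> a * (\<bar>fn u x\<bar> powr (p - 1) * \<bar>fn h x\<bar>) + b * \<bar>fn w x\<bar> powr p"
    and ab: "0 \<le> a" "0 \<le> b" and H: "u \<in> H" "h \<in> H" "w \<in> H" "v \<in> H"
  shows "integrable lborel (\<lambda>x. g x * fn v x)"
    and "\<bar>\<integral>x. g x * fn v x \<partial>lborel\<bar>
      \<le> 3 * K * (a * (norm u powr (p - 1) * norm h) + b * norm w powr p) * norm v"
proof -
  let ?f = "\<lambda>u h x. \<bar>fn u x\<bar> powr (p - 1) * \<bar>fn h x\<bar> * \<bar>fn v x\<bar>"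
  have i: "integrable lborel (\<lambda>x. a * ?f u h x + b * ?f w w x)"
    by (intro Bochner_Integration.integrable_add integrable_mult_right trilinear_bound H)
  have le: "AE x in lborel. \<bar>g x * fn v x\<bar> \<le> a * ?f u h x + b * ?f w w x"
    using g
  proof (rule eventually_mono)
    fix x assume "\<bar>g x\<bar> \<le> a * (\<bar>fn u x\<bar> powr (p - 1) * \<bar>fn h x\<bar>) + b * \<bar>fn w x\<bar> powr p"
    from mult_right_mono[OF this, of "\<bar>fn v x\<bar>"]
    show "\<bar>g x * fn v x\<bar> \<le> a * ?f u h x + b * ?f w w x"
      by (simp add: abs_mult distrib_right powr_minus_one_times_abs mult.assoc)
  qed
  show i': "integrable lborel (\<lambda>x. g x * fn v x)"
    using i by (rule Bochner_Integration.integrable_bound)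
      (use le in \<open>auto elim!: eventually_mono intro: order.trans[OF _ abs_ge_self]\<close>)
  have "\<bar>\<integral>x. g x * fn v x \<partial>lborel\<bar> \<le> (\<integral>x. \<bar>g x * fn v x\<bar> \<partial>lborel)"
    using integral_abs_bound by blast
  also have "\<dots> \<le> (\<integral>x. a * ?f u h x + b * ?f w w x \<partial>lborel)"
    using i' i le by (intro integral_mono_AE) auto
  also have "\<dots> = a * (\<integral>x. ?f u h x \<partial>lborel) + b * (\<integral>x. ?f w w x \<partial>lborel)"
    using trilinear_bound(1) H by simp
  also have "\<dots> \<le> a * (3 * K * (norm u powr (p - 1) * norm h * norm v))
      + b * (3 * K * (norm w powr (p - 1) * norm w * norm v))"
    using ab H by (intro add_mono mult_left_mono trilinear_bound(2)) auto
  also have "\<dots> = 3 * K * (a * (norm u powr (p - 1) * norm h) + b * norm w powr p) * norm v"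
    using powr_minus_one_times_abs[of "norm w" p] by (simp add: algebra_simps)
  finally show "\<bar>\<integral>x. g x * fn v x \<partial>lborel\<bar>
      \<le> 3 * K * (a * (norm u powr (p - 1) * norm h) + b * norm w powr p) * norm v" .
qed

lemma Linv_of_pairing_bound:
  assumes [measurable]: "g \<in> borel_measurable borel"
    and g: "AE x in lborel. \<bar>g x\<bar> \<le> a * (\<bar>fn u x\<bar> powr (p - 1) * \<bar>fn h x\<bar>)"
    and ab: "0 \<le> a" and H: "u \<in> H" "h \<in> H"
  shows "Linv \<Omega> (as_dual \<Omega> g) \<in> H"
    and "\<And>v. v \<in> H \<Longrightarrow> Linv \<Omega> (as_dual \<Omega> g) \<bullet> v = (\<integral>x. g x * fn v x \<partial>lborel)"
    and "norm (Linv \<Omega> (as_dual \<Omega> g)) \<le> 3 * K * (a * (norm u powr (p - 1) * norm h))"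
proof -
  let ?w = "Linv \<Omega> (as_dual \<Omega> g)"
  have g': "AE x in lborel. \<bar>g x\<bar> \<le> a * (\<bar>fn u x\<bar> powr (p - 1) * \<bar>fn h x\<bar>) + 0 * \<bar>fn h x\<bar> powr p"
    using g by simp
  note b = pairing_bound[OF assms(1) g' ab order_refl H H(2)]
  note r = Linv_represents[OF open_\<Omega> assms(1) b]
  show w: "?w \<in> H" by (rule r(1))
  show eq: "?w \<bullet> v = (\<integral>x. g x * fn v x \<partial>lborel)" if "v \<in> H" for v
    by (rule r(2)) (use that in auto)
  have "?w \<bullet> ?w \<le> 3 * K * (a * (norm u powr (p - 1) * norm h)) * norm ?w"
    using b(2)[OF w] eq[OF w] by simp
  then have "norm ?w * norm ?w \<le> 3 * K * (a * (norm u powr (p - 1) * norm h)) * norm ?w"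
    by (simp add: dot_square_norm power2_eq_square)
  then show "norm ?w \<le> 3 * K * (a * (norm u powr (p - 1) * norm h))"
    using K ab by (cases "?w = 0") (auto dest: mult_right_le_imp_le)
qed

text \<open>The map whose fixed points are the weak solutions.\<close>

definition G :: "'a sobolev \<Rightarrow> 'a sobolev" where
  "G u = Linv \<Omega> (as_dual \<Omega> (nonlin p u))"

lemma nonlin_measurable [measurable]: "nonlin p u \<in> borel_measurable borel"
  unfolding nonlin_def[abs_def] by measurable

lemma abs_nonlin: "\<bar>nonlin p u x\<bar> = \<bar>fn u x\<bar> powr (p - 1) * \<bar>fn u x\<bar>"
  by (simp add: nonlin_def abs_mult)

lemma G:
  assumes "u \<in> H"
  shows "G u \<in> H" "\<And>v. v \<in> H \<Longrightarrow> G u \<bullet> v = (\<integral>x. nonlin p u x * fn v x \<partial>lborel)"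
  unfolding G_def
  by (rule Linv_of_pairing_bound[where a = 1 and u = u and h = u]; use assms in \<open>simp add: abs_nonlin\<close>)+

lemma Aop_eq:
  assumes "u \<in> H"
  shows "Aop \<Omega> p \<gamma> u = ((u \<bullet> u) / (G u \<bullet> u)) powr \<gamma> *\<^sub>R G u"
  using assms G(2)[OF assms assms]
  by (simp add: Aop_def Mfun_def G_def Lop_eq_inner[OF open_\<Omega>] as_dual_eq[OF open_\<Omega>])

lemma eq_in_H:
  assumes "x \<in> H" "y \<in> H" "\<And>v. v \<in> H \<Longrightarrow> x \<bullet> v = y \<bullet> v"
  shows "x = y"
proof -
  have "x - y \<in> H" using assms(1,2) subspace by (rule subspace_diff[rotated])
  then have "(x - y) \<bullet> (x - y) = 0" using assms(3) by (simp add: inner_diff_left)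
  then show ?thesis by simp
qed

lemma weak_solution_imp_fixed_point:
  assumes "weak_solution \<Omega> p \<phi>"
  shows "G \<phi> = \<phi>"
proof (rule eq_in_H)
  show \<phi>: "\<phi> \<in> H" using assms by (simp add: weak_solution_def)
  then show "G \<phi> \<in> H" by (rule G)
  fix v assume v: "v \<in> H"
  have [measurable]: "\<Omega> \<in> sets borel" using open_\<Omega> by simp
  have i: "integrable lborel (\<lambda>x. nonlin p \<phi> x * fn v x)"
    by (rule pairing_bound(1)[where a = 1 and u = \<phi> and h = \<phi> and b = 0 and w = \<phi>])
      (use \<phi> v in \<open>auto simp: abs_nonlin\<close>)
  have j: "integrable lborel (\<lambda>x. rep_l2 \<phi> x \<bullet> rep_l2 v x)"
    by (intro square_integrable_inner rep_l2_square_integrable)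
  have "0 = (\<integral>x. indicator \<Omega> x *\<^sub>R (grad \<phi> x \<bullet> grad v x + fn \<phi> x * fn v x
      - \<bar>fn \<phi> x\<bar> powr (p - 1) * fn \<phi> x * fn v x) \<partial>lborel)"
    using assms v by (simp add: weak_solution_def set_lebesgue_integral_def)
  also have "\<dots> = (\<integral>x. rep_l2 \<phi> x \<bullet> rep_l2 v x - nonlin p \<phi> x * fn v x \<partial>lborel)"
  proof (rule integral_cong_AE)
    show "AE x in lborel. indicator \<Omega> x *\<^sub>R (grad \<phi> x \<bullet> grad v x + fn \<phi> x * fn v x
      - \<bar>fn \<phi> x\<bar> powr (p - 1) * fn \<phi> x * fn v x) = rep_l2 \<phi> x \<bullet> rep_l2 v x - nonlin p \<phi> x * fn v x"
      by (rule eventually_mono[OF H10_outside[OF v]])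
        (auto simp: indicator_def fn_def grad_def nonlin_def inner_prod_def)
    have [measurable]: "grad w \<in> borel_measurable borel" for w :: "'a sobolev"
      unfolding grad_def[abs_def]
      by (rule measurable_compose[OF rep_l2_measurable borel_measurable_continuous_onI])
        (intro continuous_intros)
    show "(\<lambda>x. indicator \<Omega> x *\<^sub>R (grad \<phi> x \<bullet> grad v x + fn \<phi> x * fn v x
      - \<bar>fn \<phi> x\<bar> powr (p - 1) * fn \<phi> x * fn v x)) \<in> borel_measurable lborel" by measurable
  qed measurable
  also have "\<dots> = \<phi> \<bullet> v - G \<phi> \<bullet> v"
    using i j G(2)[OF \<phi> v] by (simp add: inner_l2.rep_eq)
  finally show "G \<phi> \<bullet> v = \<phi> \<bullet> v" by simp
qed

lemma Tphi:
  assumes \<phi>: "\<phi> \<in> H" and h: "h \<in> H"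
  shows "Tphi \<Omega> p \<phi> h \<in> H"
    and "\<And>v. v \<in> H \<Longrightarrow> Tphi \<Omega> p \<phi> h \<bullet> v = (\<integral>x. p * \<bar>fn \<phi> x\<bar> powr (p - 1) * fn h x * fn v x \<partial>lborel)"
    and "norm (Tphi \<Omega> p \<phi> h) \<le> 3 * K * p * norm \<phi> powr (p - 1) * norm h"
proof -
  have m: "(\<lambda>x. p * \<bar>fn \<phi> x\<bar> powr (p - 1) * fn h x) \<in> borel_measurable borel" by measurable
  have b: "AE x in lborel. \<bar>p * \<bar>fn \<phi> x\<bar> powr (p - 1) * fn h x\<bar> \<le> p * (\<bar>fn \<phi> x\<bar> powr (p - 1) * \<bar>fn h x\<bar>)"
    using p by (simp add: abs_mult)
  note L = Linv_of_pairing_bound[OF m b _ \<phi> h]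
  show "Tphi \<Omega> p \<phi> h \<in> H"
    and "\<And>v. v \<in> H \<Longrightarrow> Tphi \<Omega> p \<phi> h \<bullet> v = (\<integral>x. p * \<bar>fn \<phi> x\<bar> powr (p - 1) * fn h x * fn v x \<partial>lborel)"
    and "norm (Tphi \<Omega> p \<phi> h) \<le> 3 * K * p * norm \<phi> powr (p - 1) * norm h"
    unfolding Tphi_def using L p by (simp_all add: mult.assoc)
qed

lemma Tphi_integrable:
  assumes "\<phi> \<in> H" "h \<in> H" "v \<in> H"
  shows "integrable lborel (\<lambda>x. p * \<bar>fn \<phi> x\<bar> powr (p - 1) * fn h x * fn v x)"
  by (rule pairing_bound(1)[where a = p and u = \<phi> and h = h and b = 0 and w = h])
    (use assms p in \<open>auto simp: abs_mult\<close>)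

lemma symmetric_Tphi:
  assumes \<phi>: "\<phi> \<in> H"
  shows "symmetric_operator_on H (Tphi \<Omega> p \<phi>)"
proof unfold_locales
  note T = Tphi[OF \<phi>]
  note [simp] = subspace_add[OF subspace] subspace_scale[OF subspace]
  show "Tphi \<Omega> p \<phi> x \<in> H" if "x \<in> H" for x using T(1)[OF that] .
  show "Tphi \<Omega> p \<phi> (x + y) = Tphi \<Omega> p \<phi> x + Tphi \<Omega> p \<phi> y" if xy: "x \<in> H" "y \<in> H" for x y
  proof (rule eq_in_H)
    fix v assume v: "v \<in> H"
    have "Tphi \<Omega> p \<phi> (x + y) \<bullet> v = (\<integral>z. p * \<bar>fn \<phi> z\<bar> powr (p - 1) * fn (x + y) z * fn v z \<partial>lborel)"
      using xy v by (intro T(2)) auto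
    also have "\<dots> = (\<integral>z. p * \<bar>fn \<phi> z\<bar> powr (p - 1) * fn x z * fn v z
        + p * \<bar>fn \<phi> z\<bar> powr (p - 1) * fn y z * fn v z \<partial>lborel)"
      by (rule integral_cong_AE, measurable, rule eventually_mono[OF fn_add[of x y]]) (simp add: algebra_simps)
    finally show "Tphi \<Omega> p \<phi> (x + y) \<bullet> v = (Tphi \<Omega> p \<phi> x + Tphi \<Omega> p \<phi> y) \<bullet> v"
      using xy v Tphi_integrable[OF \<phi>] by (simp add: T(2) inner_add_left)
  qed (use xy T(1) in auto)
  show "Tphi \<Omega> p \<phi> (c *\<^sub>R x) = c *\<^sub>R Tphi \<Omega> p \<phi> x" if x: "x \<in> H" for c x
  proof (rule eq_in_H)
    fix v assume v: "v \<in> H"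
    have "Tphi \<Omega> p \<phi> (c *\<^sub>R x) \<bullet> v = (\<integral>z. p * \<bar>fn \<phi> z\<bar> powr (p - 1) * fn (c *\<^sub>R x) z * fn v z \<partial>lborel)"
      using x v by (intro T(2)) auto
    also have "\<dots> = (\<integral>z. c * (p * \<bar>fn \<phi> z\<bar> powr (p - 1) * fn x z * fn v z) \<partial>lborel)"
      by (rule integral_cong_AE, measurable, rule eventually_mono[OF fn_scaleR[of c x]]) (simp add: algebra_simps)
    finally show "Tphi \<Omega> p \<phi> (c *\<^sub>R x) \<bullet> v = (c *\<^sub>R Tphi \<Omega> p \<phi> x) \<bullet> v"
      using x v by (simp add: T(2))
  qed (use x T(1) in auto)
  show "Tphi \<Omega> p \<phi> x \<bullet> y = x \<bullet> Tphi \<Omega> p \<phi> y" if "x \<in> H" "y \<in> H" for x y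
    using T(2)[OF that] T(2)[OF that(2,1)] by (simp add: inner_commute mult_ac)
  show "\<exists>B. \<forall>x\<in>H. norm (Tphi \<Omega> p \<phi> x) \<le> B * norm x"
    using T(3) by blast
qed (rule subspace_H10 closed_H10)+

lemma Tphi_nonneg:
  assumes \<phi>: "\<phi> \<in> H" and h: "h \<in> H"
  shows "0 \<le> Tphi \<Omega> p \<phi> h \<bullet> h"
proof -
  have "0 \<le> p * \<bar>fn \<phi> x\<bar> powr (p - 1) * fn h x * fn h x" for x
    using p by (simp add: mult.assoc)
  then show ?thesis unfolding Tphi(2)[OF \<phi> h h] by (intro Bochner_Integration.integral_nonneg)
qed

lemma Tphi_self:
  assumes \<phi>: "\<phi> \<in> H"
  shows "Tphi \<Omega> p \<phi> \<phi> = p *\<^sub>R G \<phi>"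
proof (rule eq_in_H)
  fix v assume v: "v \<in> H"
  have "Tphi \<Omega> p \<phi> \<phi> \<bullet> v = (\<integral>x. p * (nonlin p \<phi> x * fn v x) \<partial>lborel)"
    unfolding Tphi(2)[OF \<phi> \<phi> v] by (simp add: nonlin_def mult.assoc)
  then show "Tphi \<Omega> p \<phi> \<phi> \<bullet> v = (p *\<^sub>R G \<phi>) \<bullet> v"
    using G(2)[OF \<phi> v] by simp
qed (use \<phi> Tphi G subspace in \<open>auto intro: subspace_scale\<close>)

text \<open>The norm of the error is that of the functional it represents. When the pointwise linearisation
  of the power is inserted, the first term of its error is small through its coefficient, and the
  second one is of order \<open>\<parallel>h\<parallel> powr p\<close> with \<open>p > 1\<close>. So \<open>Tphi\<close> is the derivative of \<open>G\<close> at \<open>\<phi>\<close>.\<close>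

lemma G_linearisation:
  assumes \<phi>: "\<phi> \<in> H" and "0 < e"
  shows "\<exists>\<delta>>0. \<forall>h\<in>H. norm h < \<delta> \<longrightarrow> norm (G (\<phi> + h) - G \<phi> - Tphi \<Omega> p \<phi> h) \<le> e * norm h"
proof -
  define A where "A = 3 * K * (norm \<phi> powr (p - 1) + 1)"
  have A: "0 < A" using K by (simp add: A_def add_nonneg_pos)
  define e1 where "e1 = e / (2 * A)"
  have e1: "0 < e1" using A \<open>0 < e\<close> by (simp add: e1_def)
  obtain C where C: "0 < C" "\<And>a b. \<bar>signed_power p (a + b) - signed_power p a - p * \<bar>a\<bar> powr (p - 1) * b\<bar>
    \<le> e1 * (\<bar>a\<bar> powr (p - 1) * \<bar>b\<bar>) + C * \<bar>b\<bar> powr p"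
    using signed_power_linearisation[OF p e1] by blast
  \<comment> \<open>Chosen so that \<open>3 * K * C * \<delta> powr (p - 1) = e / 2\<close>.\<close>
  define \<delta> where "\<delta> = (e / (2 * (3 * K * C))) powr (1 / (p - 1))"
  have \<delta>: "0 < \<delta>" using \<open>0 < e\<close> K C(1) by (simp add: \<delta>_def)
  have "norm (G (\<phi> + h) - G \<phi> - Tphi \<Omega> p \<phi> h) \<le> e * norm h" if h: "h \<in> H" "norm h < \<delta>" for h
  proof -
    have \<phi>h: "\<phi> + h \<in> H" using \<phi> h(1) subspace by (simp add: subspace_add)
    define w where "w = G (\<phi> + h) - G \<phi> - Tphi \<Omega> p \<phi> h"
    have w: "w \<in> H"
      unfolding w_def using \<phi> h(1) \<phi>h subspace by (intro subspace_diff G Tphi)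
    define g where "g x = nonlin p (\<phi> + h) x - nonlin p \<phi> x - p * \<bar>fn \<phi> x\<bar> powr (p - 1) * fn h x" for x
    have [measurable]: "g \<in> borel_measurable borel" unfolding g_def by measurable
    have gb: "AE x in lborel. \<bar>g x\<bar> \<le> e1 * (\<bar>fn \<phi> x\<bar> powr (p - 1) * \<bar>fn h x\<bar>) + C * \<bar>fn h x\<bar> powr p"
      using fn_add[of \<phi> h] by (rule eventually_mono) (use C(2) in \<open>simp add: g_def nonlin_eq\<close>)
    have i: "integrable lborel (\<lambda>x. nonlin p u x * fn w x)" if "u \<in> H" for u
      by (rule pairing_bound(1)[where a = 1 and u = u and h = u and b = 0 and w = u])
        (use that w in \<open>auto simp: abs_nonlin\<close>)
    have "w \<bullet> w = (\<integral>x. nonlin p (\<phi> + h) x * fn w x \<partial>lborel) - (\<integral>x. nonlin p \<phi> x * fn w x \<partial>lborel)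
        - (\<integral>x. p * \<bar>fn \<phi> x\<bar> powr (p - 1) * fn h x * fn w x \<partial>lborel)"
      using G(2)[OF \<phi>h w] G(2)[OF \<phi> w] Tphi(2)[OF \<phi> h(1) w]
      by (subst (1) w_def) (simp add: inner_diff_left)
    also have "\<dots> = (\<integral>x. g x * fn w x \<partial>lborel)"
      using i[OF \<phi>h] i[OF \<phi>] Tphi_integrable[OF \<phi> h(1) w] by (simp add: g_def left_diff_distrib)
    also have "\<dots> \<le> 3 * K * (e1 * (norm \<phi> powr (p - 1) * norm h) + C * norm h powr p) * norm w"
      using pairing_bound(2)[OF _ gb _ _ \<phi> h(1) h(1) w] e1 C(1) by simp
    finally have "norm w * norm w \<le> 3 * K * (e1 * (norm \<phi> powr (p - 1) * norm h) + C * norm h powr p) * norm w"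
      by (simp add: dot_square_norm power2_eq_square)
    then have "norm w \<le> 3 * K * (e1 * (norm \<phi> powr (p - 1) * norm h) + C * norm h powr p)"
      using K e1 C(1) by (cases "w = 0") (auto dest: mult_right_le_imp_le)
    also have "\<dots> = e1 * (3 * K * norm \<phi> powr (p - 1)) * norm h + 3 * K * C * norm h powr (p - 1) * norm h"
      using powr_minus_one_times_abs[of "norm h" p] by (simp add: algebra_simps)
    also have "\<dots> \<le> e / 2 * norm h + e / 2 * norm h"
    proof (intro add_mono mult_right_mono)
      have "e1 * (3 * K * norm \<phi> powr (p - 1)) \<le> e1 * A"
        using e1 K by (intro mult_left_mono) (auto simp: A_def)
      then show "e1 * (3 * K * norm \<phi> powr (p - 1)) \<le> e / 2" using A by (simp add: e1_def)
      have "norm h powr (p - 1) \<le> \<delta> powr (p - 1)"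
        using h(2) p by (intro powr_mono2) auto
      also have "\<dots> = e / (2 * (3 * K * C))"
        using p \<open>0 < e\<close> K C(1) by (simp add: \<delta>_def powr_powr)
      finally show "3 * K * C * norm h powr (p - 1) \<le> e / 2"
        using K C(1) by (simp add: field_simps)
    qed auto
    finally show ?thesis by (simp add: w_def)
  qed
  with \<delta> show ?thesis by blast
qed

end

section \<open>Spectral assumptions\<close>

lemma bounded_below_of_not_in_spectrum:
  assumes "subspace S" "\<And>x. x \<in> S \<Longrightarrow> T x \<in> S" "\<mu> \<notin> spectrum_on S T"
  shows "bounded_below_on S (\<lambda>x. T x - \<mu> *\<^sub>R x)"
proof -
  obtain R C where R: "\<And>x. x \<in> S \<Longrightarrow> R (T x - \<mu> *\<^sub>R x) = x" "\<And>x. x \<in> S \<Longrightarrow> norm (R x) \<le> C * norm x"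
    using assms(3) by (auto simp: spectrum_on_def)
  have "1 / (\<bar>C\<bar> + 1) * norm x \<le> norm (T x - \<mu> *\<^sub>R x)" if x: "x \<in> S" for x
  proof -
    have "T x - \<mu> *\<^sub>R x \<in> S" using x assms by (simp add: subspace_diff subspace_scale)
    then have "norm x \<le> C * norm (T x - \<mu> *\<^sub>R x)" using R(2)[of "T x - \<mu> *\<^sub>R x"] R(1)[OF x] by simp
    also have "\<dots> \<le> (\<bar>C\<bar> + 1) * norm (T x - \<mu> *\<^sub>R x)" by (intro mult_right_mono) auto
    finally show ?thesis by (simp add: field_simps)
  qed
  then show ?thesis unfolding bounded_below_on_def by (intro exI[of _ "1 / (\<bar>C\<bar> + 1)"]) simp
qed

text \<open>Eigenvectors are generalised eigenvectors, and these span a line.\<close>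

lemma eigenvector_in_span_of_simple_eigenvector:
  assumes "algebraic_multiplicity_on S T \<mu> = 1"
    and "\<phi> \<in> S" "\<phi> \<noteq> 0" "T \<phi> = \<mu> *\<^sub>R \<phi>" and "x \<in> S" "T x = \<mu> *\<^sub>R x"
  shows "x \<in> span {\<phi>}"
proof -
  define V where "V = {x \<in> S. \<exists>k. ((\<lambda>y. T y - \<mu> *\<^sub>R y) ^^ k) x = 0}"
  have V: "y \<in> V" if "y \<in> S" "T y = \<mu> *\<^sub>R y" for y
    unfolding V_def using that by (intro CollectI conjI exI[of _ 1]) simp_all
  obtain B where "B \<subseteq> V" "independent B" and B: "V \<subseteq> span B" "card B = dim V"
    by (rule basis_exists)
  have "dim V = 1" using assms(1) by (simp add: algebraic_multiplicity_on_def V_def)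
  then obtain b where b: "V \<subseteq> span {b}" using B by (metis card_1_singletonE)
  have "\<phi> \<in> span {b}" "x \<in> span {b}"
    using b V[OF assms(2,4)] V[OF assms(5,6)] by blast+
  then obtain j k where "\<phi> = j *\<^sub>R b" "x = k *\<^sub>R b"
    unfolding span_singleton by blast
  then have "x = (k / j) *\<^sub>R \<phi>" using assms(3) by auto
  then show ?thesis by (auto simp: span_singleton)
qed

section \<open>The iteration near the fixed point\<close>

context subcritical_power
begin

context
  fixes \<phi> :: "'a sobolev"
  assumes \<phi>: "\<phi> \<in> H" "\<phi> \<noteq> 0" "G \<phi> = \<phi>"
begin

abbreviation T where "T \<equiv> Tphi \<Omega> p \<phi>"

lemma T_phi: "T \<phi> = p *\<^sub>R \<phi>"
  using Tphi_self[OF \<phi>(1)] \<phi>(3) by simp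

text \<open>\<open>G u \<bullet> u\<close> is the integral of \<open>\<bar>u\<bar> powr (p + 1)\<close>; symmetry of \<open>T\<close> and \<open>T \<phi> = p \<phi>\<close> turn its
  derivative into a multiple of the inner product with \<open>\<phi>\<close>.\<close>

lemma potential_has_derivative:
  "((\<lambda>u. G u \<bullet> u) has_derivative (\<lambda>h. (p + 1) * (\<phi> \<bullet> h))) (at \<phi> within H)"
  unfolding has_derivative_within_alt
proof (intro conjI allI impI)
  show "bounded_linear (\<lambda>h. (p + 1) * (\<phi> \<bullet> h))"
    by (intro bounded_linear_const_mult bounded_linear_inner_right)
  fix e :: real assume e: "0 < e"
  interpret T: symmetric_operator_on H T by (rule symmetric_Tphi[OF \<phi>(1)])
  obtain B where B: "0 < B" "\<And>x. x \<in> H \<Longrightarrow> norm (T x) \<le> B * norm x" using T.pos_bound by blast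
  define n where "n = norm \<phi> + 1"
  have n: "0 < n" by (simp add: n_def add_nonneg_pos)
  define e1 where "e1 = e / (2 * n)"
  have e1: "0 < e1" using e n by (simp add: e1_def)
  obtain d where d: "0 < d" "\<And>h. h \<in> H \<Longrightarrow> norm h < d \<Longrightarrow> norm (G (\<phi> + h) - G \<phi> - T h) \<le> e1 * norm h"
    using G_linearisation[OF \<phi>(1) e1] by blast
  define d' where "d' = min (min d 1) (e / (2 * B))"
  have "0 < d'" using d(1) e B(1) by (simp add: d'_def)
  moreover have "norm (G y \<bullet> y - G \<phi> \<bullet> \<phi> - (p + 1) * (\<phi> \<bullet> (y - \<phi>))) \<le> e * norm (y - \<phi>)"
    if y: "y \<in> H" "norm (y - \<phi>) < d'" for y
  proof -
    define h where "h = y - \<phi>"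
    have h: "h \<in> H" "norm h < d" "norm h < 1" "norm h < e / (2 * B)"
      using y \<phi>(1) subspace by (auto simp: h_def d'_def subspace_diff)
    define r where "r = G (\<phi> + h) - \<phi> - T h"
    have r: "norm r \<le> e1 * norm h" using d(2)[OF h(1,2)] by (simp add: r_def \<phi>(3))
    have y': "y = \<phi> + h" and Gy: "G y = \<phi> + T h + r" by (simp_all add: h_def r_def)
    have "T h \<bullet> \<phi> = p * (\<phi> \<bullet> h)"
      using T.symmetric[OF h(1) \<phi>(1)] by (simp add: T_phi inner_commute)
    then have "G y \<bullet> y - G \<phi> \<bullet> \<phi> - (p + 1) * (\<phi> \<bullet> h) = T h \<bullet> h + r \<bullet> y"
      unfolding Gy \<phi>(3) unfolding y'
      by (simp add: inner_add_left inner_add_right distrib_right inner_commute)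
    also have "\<bar>\<dots>\<bar> \<le> norm (T h) * norm h + norm r * norm y"
      using Cauchy_Schwarz_ineq2[of "T h" h] Cauchy_Schwarz_ineq2[of r y] by linarith
    also have "\<dots> \<le> e / 2 * norm h + e / 2 * norm h"
    proof (rule add_mono)
      have "norm (T h) \<le> B * (e / (2 * B))"
        using order.trans[OF B(2)[OF h(1)] mult_left_mono[of "norm h" "e / (2 * B)" B]] h(4) B(1) by simp
      then show "norm (T h) * norm h \<le> e / 2 * norm h"
        using B(1) by (intro mult_right_mono) auto
      have "norm y \<le> n" using norm_triangle_ineq[of \<phi> h] h(3) y' by (simp add: n_def)
      then have "norm r * norm y \<le> (e1 * norm h) * n"
        using r e1 by (intro mult_mono) auto
      also have "\<dots> = e / 2 * norm h" using n by (simp add: e1_def)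
      finally show "norm r * norm y \<le> e / 2 * norm h" .
    qed
    finally show ?thesis by (simp add: h_def)
  qed
  ultimately show "\<exists>d>0. \<forall>y\<in>H. norm (y - \<phi>) < d \<longrightarrow>
      norm (G y \<bullet> y - G \<phi> \<bullet> \<phi> - (p + 1) * (\<phi> \<bullet> (y - \<phi>))) \<le> e * norm (y - \<phi>)"
    by blast
qed

definition multiplier :: "real \<Rightarrow> 'a sobolev \<Rightarrow> real" where
  "multiplier \<gamma> u = ((u \<bullet> u) / (G u \<bullet> u)) powr \<gamma>"

definition multiplier_slope :: "real \<Rightarrow> 'a sobolev \<Rightarrow> real" where
  "multiplier_slope \<gamma> h = \<gamma> * (1 - p) * (\<phi> \<bullet> h) / (\<phi> \<bullet> \<phi>)"

lemma multiplier_has_derivative: "(multiplier \<gamma> has_derivative multiplier_slope \<gamma>) (at \<phi> within H)"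
proof -
  have pos: "0 < \<phi> \<bullet> \<phi>" using \<phi>(2) by simp
  have "((\<lambda>u. u \<bullet> u) has_derivative (\<lambda>h. \<phi> \<bullet> h + h \<bullet> \<phi>)) (at \<phi> within H)"
    by (auto intro!: derivative_eq_intros)
  from has_derivative_divide'[OF this potential_has_derivative]
  have "((\<lambda>u. (u \<bullet> u) / (G u \<bullet> u)) has_derivative
      (\<lambda>h. ((\<phi> \<bullet> h + h \<bullet> \<phi>) * (\<phi> \<bullet> \<phi>) - (\<phi> \<bullet> \<phi>) * ((p + 1) * (\<phi> \<bullet> h))) / ((\<phi> \<bullet> \<phi>) * (\<phi> \<bullet> \<phi>)))) (at \<phi> within H)"
    using pos by (simp add: \<phi>(3))
  also have "(\<lambda>h. ((\<phi> \<bullet> h + h \<bullet> \<phi>) * (\<phi> \<bullet> \<phi>) - (\<phi> \<bullet> \<phi>) * ((p + 1) * (\<phi> \<bullet> h))) / ((\<phi> \<bullet> \<phi>) * (\<phi> \<bullet> \<phi>)))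
      = (\<lambda>h. (1 - p) * (\<phi> \<bullet> h) / (\<phi> \<bullet> \<phi>))"
  proof
    fix h
    have "(\<phi> \<bullet> h + h \<bullet> \<phi>) * (\<phi> \<bullet> \<phi>) - (\<phi> \<bullet> \<phi>) * ((p + 1) * (\<phi> \<bullet> h))
        = ((1 - p) * (\<phi> \<bullet> h)) * (\<phi> \<bullet> \<phi>)"
      unfolding inner_commute[of h \<phi>] by algebra
    then show "((\<phi> \<bullet> h + h \<bullet> \<phi>) * (\<phi> \<bullet> \<phi>) - (\<phi> \<bullet> \<phi>) * ((p + 1) * (\<phi> \<bullet> h))) / ((\<phi> \<bullet> \<phi>) * (\<phi> \<bullet> \<phi>))
        = (1 - p) * (\<phi> \<bullet> h) / (\<phi> \<bullet> \<phi>)"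
      using pos by simp
  qed
  finally have "((\<lambda>u. (u \<bullet> u) / (G u \<bullet> u)) has_derivative (\<lambda>h. (1 - p) * (\<phi> \<bullet> h) / (\<phi> \<bullet> \<phi>))) (at \<phi> within H)" .
  from has_derivative_powr[OF this has_derivative_const[of \<gamma>] _ \<phi>(1)]
  show ?thesis
    unfolding multiplier_def[abs_def] multiplier_slope_def[abs_def] using pos by (simp add: \<phi>(3) mult_ac)
qed

definition Aop_derivative :: "real \<Rightarrow> 'a sobolev \<Rightarrow> 'a sobolev" where
  "Aop_derivative \<gamma> h = T h + multiplier_slope \<gamma> h *\<^sub>R \<phi>"

text \<open>With \<open>m\<close> for the multiplier at \<open>\<phi> + h\<close> and \<open>m'\<close> for its slope in direction \<open>h\<close>, the error is
  \<open>(m - 1 - m') \<phi> + (m - 1) (G (\<phi> + h) - \<phi>) + (G (\<phi> + h) - \<phi> - T h)\<close>: the outer terms are errors of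
  linearisation, and the middle one is a product of two factors of order \<open>\<parallel>h\<parallel>\<close>.\<close>

lemma Aop_linearisation:
  assumes e: "0 < e"
  shows "\<exists>\<delta>>0. \<forall>h\<in>H. norm h < \<delta> \<longrightarrow> norm (Aop \<Omega> p \<gamma> (\<phi> + h) - \<phi> - Aop_derivative \<gamma> h) \<le> e * norm h"
proof -
  interpret T: symmetric_operator_on H T by (rule symmetric_Tphi[OF \<phi>(1)])
  obtain B where B: "0 < B" "\<And>x. x \<in> H \<Longrightarrow> norm (T x) \<le> B * norm x" using T.pos_bound by blast
  have multiplier_at: "multiplier \<gamma> \<phi> = 1" using \<phi> by (simp add: multiplier_def)
  obtain L where L: "0 < L" "\<And>h. \<bar>multiplier_slope \<gamma> h\<bar> \<le> norm h * L"
    using bounded_linear.pos_bounded[OF has_derivative_bounded_linear[OF multiplier_has_derivative[of \<gamma>]]]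
    by (auto simp: real_norm_def)
  define n where "n = norm \<phi> + 1"
  have n: "0 < n" "norm \<phi> \<le> n" by (simp_all add: n_def add_nonneg_pos)
  define e1 where "e1 = min 1 (e / (3 * n))"
  define e2 where "e2 = min 1 (e / 3)"
  have e12: "0 < e1" "0 < e2" using e n by (simp_all add: e1_def e2_def)
  obtain d1 where d1: "0 < d1" "\<And>y. y \<in> H \<Longrightarrow> norm (y - \<phi>) < d1 \<Longrightarrow>
      \<bar>multiplier \<gamma> y - multiplier \<gamma> \<phi> - multiplier_slope \<gamma> (y - \<phi>)\<bar> \<le> e1 * norm (y - \<phi>)"
    using multiplier_has_derivative[of \<gamma>] e12(1) unfolding has_derivative_within_alt real_norm_def by blast
  obtain d2 where d2: "0 < d2" "\<And>h. h \<in> H \<Longrightarrow> norm h < d2 \<Longrightarrow> norm (G (\<phi> + h) - G \<phi> - T h) \<le> e2 * norm h"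
    using G_linearisation[OF \<phi>(1) e12(2)] by blast
  define q where "q = (L + 1) * (B + 1)"
  have q: "0 < q" using L(1) B(1) by (simp add: q_def)
  define d3 where "d3 = e / (3 * q)"
  have d3: "0 < d3" "q * d3 = e / 3" using e q by (simp_all add: d3_def)
  have "norm (Aop \<Omega> p \<gamma> (\<phi> + h) - \<phi> - Aop_derivative \<gamma> h) \<le> e * norm h"
    if h: "h \<in> H" and small: "norm h < min d1 (min d2 d3)" for h
  proof -
    have \<phi>h: "\<phi> + h \<in> H" using \<phi>(1) h subspace by (simp add: subspace_add)
    define \<mu> where "\<mu> = multiplier \<gamma> (\<phi> + h) - 1 - multiplier_slope \<gamma> h"
    define r where "r = G (\<phi> + h) - \<phi> - T h"
    have \<mu>: "\<bar>\<mu>\<bar> \<le> e1 * norm h" using d1(2)[OF \<phi>h] small by (simp add: \<mu>_def multiplier_at)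
    have r: "norm r \<le> e2 * norm h" using d2(2)[OF h] small by (simp add: r_def \<phi>(3))
    have "Aop \<Omega> p \<gamma> (\<phi> + h) - \<phi> - Aop_derivative \<gamma> h = \<mu> *\<^sub>R \<phi> + (multiplier_slope \<gamma> h + \<mu>) *\<^sub>R (T h + r) + r"
    proof -
      have "Aop \<Omega> p \<gamma> (\<phi> + h) = (1 + multiplier_slope \<gamma> h + \<mu>) *\<^sub>R (\<phi> + T h + r)"
        unfolding Aop_eq[OF \<phi>h] multiplier_def[symmetric] by (simp add: \<mu>_def r_def)
      then show ?thesis by (simp add: Aop_derivative_def algebra_simps)
    qed
    also have "norm \<dots> \<le> \<bar>\<mu>\<bar> * norm \<phi> + \<bar>multiplier_slope \<gamma> h + \<mu>\<bar> * norm (T h + r) + norm r"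
      by (intro norm_triangle_le add_mono) (auto simp: norm_triangle_ineq)
    also have "\<dots> \<le> e / 3 * norm h + e / 3 * norm h + e / 3 * norm h"
    proof (intro add_mono)
      have "e1 * norm h \<le> e / (3 * n) * norm h" by (intro mult_right_mono) (auto simp: e1_def)
      then have "\<bar>\<mu>\<bar> * norm \<phi> \<le> (e / (3 * n) * norm h) * n"
        using \<mu> n e by (intro mult_mono) auto
      then show "\<bar>\<mu>\<bar> * norm \<phi> \<le> e / 3 * norm h" using n by simp
      have "\<bar>multiplier_slope \<gamma> h + \<mu>\<bar> \<le> (L + 1) * norm h"
      proof -
        have "e1 * norm h \<le> 1 * norm h" by (intro mult_right_mono) (auto simp: e1_def)
        then show ?thesis using L(2)[of h] \<mu> abs_triangle_ineq[of "multiplier_slope \<gamma> h" \<mu>] by (simp add: algebra_simps)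
      qed
      moreover have "norm (T h + r) \<le> (B + 1) * d3"
      proof -
        have "e2 * norm h \<le> 1 * norm h" by (intro mult_right_mono) (auto simp: e2_def)
        then have "norm (T h + r) \<le> (B + 1) * norm h"
          using B(2)[OF h] r norm_triangle_ineq[of "T h" r] by (simp add: algebra_simps)
        also have "\<dots> \<le> (B + 1) * d3" using small B(1) by (intro mult_left_mono) auto
        finally show ?thesis .
      qed
      ultimately have "\<bar>multiplier_slope \<gamma> h + \<mu>\<bar> * norm (T h + r) \<le> ((L + 1) * norm h) * ((B + 1) * d3)"
        using L(1) by (intro mult_mono) auto
      also have "\<dots> = (q * d3) * norm h" by (simp add: q_def)
      also have "\<dots> = e / 3 * norm h" by (simp only: d3(2))
      finally show "\<bar>multiplier_slope \<gamma> h + \<mu>\<bar> * norm (T h + r) \<le> e / 3 * norm h" .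
      show "norm r \<le> e / 3 * norm h"
        by (rule order.trans[OF r mult_right_mono]) (auto simp: e2_def)
    qed
    finally show ?thesis by simp
  qed
  then show ?thesis using d1(1) d2(1) d3(1) by (intro exI[of _ "min d1 (min d2 d3)"]) auto
qed

text \<open>The slope of the multiplier vanishes on the complement of \<open>\<phi>\<close>, so there the derivative is \<open>T\<close>. On \<open>\<phi>\<close>
  the eigenvalue \<open>p\<close> of \<open>T\<close> is corrected to \<open>p - \<gamma> (p - 1)\<close>. Both subspaces are invariant and
  orthogonal to each other, so the norm is the larger of the two.\<close>

lemma Aop_derivative_contraction:
  assumes a: "0 \<le> a" "\<And>y. y \<in> H \<Longrightarrow> y \<bullet> \<phi> = 0 \<Longrightarrow> norm (T y) \<le> a * norm y"
    and h: "h \<in> H"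
  shows "norm (Aop_derivative \<gamma> h) \<le> max a \<bar>p - \<gamma> * (p - 1)\<bar> * norm h"
proof -
  interpret T: symmetric_operator_on H T by (rule symmetric_Tphi[OF \<phi>(1)])
  define \<kappa> where "\<kappa> = p - \<gamma> * (p - 1)"
  define \<theta> where "\<theta> = max a \<bar>\<kappa>\<bar>"
  have pos: "\<phi> \<bullet> \<phi> \<noteq> 0" using \<phi>(2) by simp
  define t where "t = (\<phi> \<bullet> h) / (\<phi> \<bullet> \<phi>)"
  define y where "y = h - t *\<^sub>R \<phi>"
  have y: "y \<in> H" using h \<phi>(1) subspace by (simp add: y_def subspace_diff subspace_scale)
  have "y \<bullet> \<phi> = h \<bullet> \<phi> - t * (\<phi> \<bullet> \<phi>)" by (simp add: y_def inner_diff_left)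
  then have orth: "y \<bullet> \<phi> = 0" using pos by (simp add: t_def inner_commute)
  have hy: "h = t *\<^sub>R \<phi> + y" by (simp add: y_def)
  have "T h = (t * p) *\<^sub>R \<phi> + T y"
    unfolding hy using \<phi>(1) y subspace by (simp add: T.add T.scale subspace_scale T_phi)
  moreover have "multiplier_slope \<gamma> h = \<gamma> * (1 - p) * t" by (simp add: multiplier_slope_def t_def)
  ultimately have "Aop_derivative \<gamma> h = (t * p + \<gamma> * (1 - p) * t) *\<^sub>R \<phi> + T y"
    by (simp add: Aop_derivative_def scaleR_add_left)
  moreover have "t * p + \<gamma> * (1 - p) * t = t * \<kappa>" by (simp add: \<kappa>_def algebra_simps)
  ultimately have D: "Aop_derivative \<gamma> h = (t * \<kappa>) *\<^sub>R \<phi> + T y" by (simp only:)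
  have "T y \<bullet> \<phi> = 0" using T.symmetric[OF y \<phi>(1)] orth by (simp add: T_phi)
  then have "(norm (Aop_derivative \<gamma> h))\<^sup>2 = (\<kappa> * (t * norm \<phi>))\<^sup>2 + (norm (T y))\<^sup>2"
    unfolding D power2_norm_eq_inner
    by (simp add: inner_add_left inner_add_right inner_commute power_mult_distrib power2_norm_eq_inner)
      (simp add: power2_eq_square)
  also have "\<dots> \<le> (\<theta> * (t * norm \<phi>))\<^sup>2 + (\<theta> * norm y)\<^sup>2"
  proof (rule add_mono)
    show "(\<kappa> * (t * norm \<phi>))\<^sup>2 \<le> (\<theta> * (t * norm \<phi>))\<^sup>2"
      by (subst abs_le_square_iff[symmetric]) (auto simp: abs_mult \<theta>_def intro!: mult_right_mono)
    have "norm (T y) \<le> \<theta> * norm y"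
      by (rule order.trans[OF a(2)[OF y orth] mult_right_mono]) (auto simp: \<theta>_def)
    then show "(norm (T y))\<^sup>2 \<le> (\<theta> * norm y)\<^sup>2" by (intro power_mono) auto
  qed
  also have "\<dots> = (\<theta> * norm h)\<^sup>2"
  proof -
    have "(norm h)\<^sup>2 = (t * norm \<phi>)\<^sup>2 + (norm y)\<^sup>2"
      unfolding hy using orth
      by (simp add: power2_norm_eq_inner inner_add_left inner_add_right inner_commute power_mult_distrib)
        (simp add: power2_eq_square)
    then show ?thesis by (simp add: power_mult_distrib distrib_left)
  qed
  finally have "norm (Aop_derivative \<gamma> h) \<le> \<theta> * norm h"
    by (rule power2_le_imp_le) (use a(1) in \<open>simp add: \<theta>_def\<close>)
  then show ?thesis by (simp add: \<theta>_def \<kappa>_def)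
qed

text \<open>The admissible interval for \<open>\<gamma>\<close> is exactly the condition \<open>\<bar>p - \<gamma> (p - 1)\<bar> < 1\<close>.\<close>

lemma local_contraction:
  assumes a: "0 \<le> a" "a < 1" "\<And>y. y \<in> H \<Longrightarrow> y \<bullet> \<phi> = 0 \<Longrightarrow> norm (T y) \<le> a * norm y"
    and \<gamma>: "1 < \<gamma>" "\<gamma> < (p + 1) / (p - 1)"
  shows "\<exists>\<delta> \<theta>. 0 < \<delta> \<and> 0 < \<theta> \<and> \<theta> < 1 \<and>
    (\<forall>u\<in>H. norm (u - \<phi>) < \<delta> \<longrightarrow> norm (Aop \<Omega> p \<gamma> u - \<phi>) \<le> \<theta> * norm (u - \<phi>))"
proof -
  define \<theta>\<^sub>0 where "\<theta>\<^sub>0 = max a \<bar>p - \<gamma> * (p - 1)\<bar>"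
  have "\<gamma> * (p - 1) < p + 1" using \<gamma>(2) p by (simp add: field_simps)
  moreover have "p - 1 < \<gamma> * (p - 1)" using \<gamma>(1) p by simp
  ultimately have "\<bar>p - \<gamma> * (p - 1)\<bar> < 1" by linarith
  then have \<theta>\<^sub>0: "0 \<le> \<theta>\<^sub>0" "\<theta>\<^sub>0 < 1" using a by (auto simp: \<theta>\<^sub>0_def)
  \<comment> \<open>The difference \<open>\<theta> - \<theta>\<^sub>0\<close> is the room left for the error of linearisation.\<close>
  define \<theta> where "\<theta> = (1 + \<theta>\<^sub>0) / 2"
  have "0 < \<theta> - \<theta>\<^sub>0" using \<theta>\<^sub>0 by (simp add: \<theta>_def)
  then obtain \<delta> where \<delta>: "0 < \<delta>" "\<And>h. h \<in> H \<Longrightarrow> norm h < \<delta> \<Longrightarrow>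
      norm (Aop \<Omega> p \<gamma> (\<phi> + h) - \<phi> - Aop_derivative \<gamma> h) \<le> (\<theta> - \<theta>\<^sub>0) * norm h"
    using Aop_linearisation[of "\<theta> - \<theta>\<^sub>0" \<gamma>] by blast
  have "norm (Aop \<Omega> p \<gamma> u - \<phi>) \<le> \<theta> * norm (u - \<phi>)" if u: "u \<in> H" "norm (u - \<phi>) < \<delta>" for u
  proof -
    have h: "u - \<phi> \<in> H" using u(1) \<phi>(1) subspace by (simp add: subspace_diff)
    have "norm (Aop \<Omega> p \<gamma> u - \<phi> - Aop_derivative \<gamma> (u - \<phi>)) \<le> (\<theta> - \<theta>\<^sub>0) * norm (u - \<phi>)"
      using \<delta>(2)[OF h u(2)] by simp
    moreover have "norm (Aop_derivative \<gamma> (u - \<phi>)) \<le> \<theta>\<^sub>0 * norm (u - \<phi>)"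
      using Aop_derivative_contraction[OF a(1,3) h] by (simp add: \<theta>\<^sub>0_def)
    ultimately show ?thesis
      using norm_triangle_ineq[of "Aop \<Omega> p \<gamma> u - \<phi> - Aop_derivative \<gamma> (u - \<phi>)" "Aop_derivative \<gamma> (u - \<phi>)"]
      by (simp add: left_diff_distrib)
  qed
  then show ?thesis using \<delta>(1) \<theta>\<^sub>0 by (intro exI[of _ \<delta>] exI[of _ \<theta>]) (auto simp: \<theta>_def)
qed

end

end

section \<open>Geometric convergence of the iteration\<close>

theorem theorem1p1:
  fixes \<Omega> :: "'a::euclidean_space set"
    and p \<gamma> :: real
    and \<phi> :: "'a sobolev"
  assumes "bounded \<Omega>" and "convex \<Omega>" and "open \<Omega>" and "\<Omega> \<noteq> {}"
    and "1 < p"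
    and "DIM('a) \<ge> 3 \<longrightarrow> p < (real DIM('a) + 2) / (real DIM('a) - 2)"
    and "1 < \<gamma>" and "\<gamma> < (p + 1) / (p - 1)"
    and "\<phi> \<in> H10 \<Omega>" and "\<phi> \<noteq> 0"
    and "weak_solution \<Omega> p \<phi>"
    and "spectrum_on (H10 \<Omega>) (Tphi \<Omega> p \<phi>) - {..<1} = {p}"
    and "algebraic_multiplicity_on (H10 \<Omega>) (Tphi \<Omega> p \<phi>) p = 1"
  shows "\<exists>N \<theta>. openin (top_of_set (H10 \<Omega>)) N \<and> \<phi> \<in> N \<and> 0 < \<theta> \<and> \<theta> < 1 \<and>
    (\<forall>u. u 0 \<in> N \<and> (\<forall>n. u (Suc n) = Aop \<Omega> p \<gamma> (u n)) \<longrightarrow>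
      (\<forall>n. u n \<in> H10 \<Omega> \<and> u n \<noteq> 0 \<and>
        norm (u n - \<phi>) \<le> \<theta> ^ n * norm (u 0 - \<phi>)))"
proof -
  let ?d = "real DIM('a)"
  note p = \<open>1 < p\<close> and \<phi> = \<open>\<phi> \<in> H10 \<Omega>\<close> \<open>\<phi> \<noteq> 0\<close>
  have "p + 1 < 2 + 2 * (p + 1) / ?d"
  proof (cases "DIM('a) \<ge> 3")
    case True
    then have "p < (?d + 2) / (?d - 2)" using assms(6) by blast
    with True show ?thesis by (simp add: field_simps)
  next
    case False
    then have "?d \<le> 2" by simp
    then have "(p + 1) * ?d \<le> (p + 1) * 2" using p by (intro mult_left_mono) auto
    moreover have "0 < ?d" by simp
    ultimately have "p + 1 \<le> 2 * (p + 1) / ?d" by (simp add: field_simps)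
    then show ?thesis by simp
  qed
  then obtain K where K: "0 < K" "\<forall>\<Omega>. \<forall>u\<in>H10 (\<Omega> :: 'a set).
    (\<integral>\<^sup>+x. ennreal (\<bar>fn u x\<bar> powr (p + 1)) \<partial>lborel) \<le> ennreal (K * norm u powr (p + 1))"
    using Sobolev_inequality[of "p + 1", where 'a = 'a] p by auto
  interpret subcritical_power \<Omega> p K
    using K \<open>open \<Omega>\<close> p by unfold_locales auto
  have G\<phi>: "G \<phi> = \<phi>" using \<open>weak_solution \<Omega> p \<phi>\<close> by (rule weak_solution_imp_fixed_point)
  have T\<phi>: "Tphi \<Omega> p \<phi> \<phi> = p *\<^sub>R \<phi>" using \<phi> G\<phi> by (rule T_phi)
  interpret T: symmetric_operator_on "H10 \<Omega>" "Tphi \<Omega> p \<phi>" using \<phi>(1) by (rule symmetric_Tphi)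
  have regular: "bounded_below_on (H10 \<Omega>) (\<lambda>x. Tphi \<Omega> p \<phi> x - \<mu> *\<^sub>R x)" if "1 \<le> \<mu>" "\<mu> \<noteq> p" for \<mu>
  proof (rule bounded_below_of_not_in_spectrum[where T = "Tphi \<Omega> p \<phi>"])
    show "Tphi \<Omega> p \<phi> x \<in> H10 \<Omega>" if "x \<in> H10 \<Omega>" for x using that by (rule T.maps)
    show "\<mu> \<notin> spectrum_on (H10 \<Omega>) (Tphi \<Omega> p \<phi>)"
    proof
      assume "\<mu> \<in> spectrum_on (H10 \<Omega>) (Tphi \<Omega> p \<phi>)"
      then have "\<mu> \<in> spectrum_on (H10 \<Omega>) (Tphi \<Omega> p \<phi>) - {..<1}" using that by simp
      then show False unfolding assms(12) using that by simp
    qed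
  qed (rule subspace_H10)
  have simple: "x \<in> span {\<phi>}" if "x \<in> H10 \<Omega>" "Tphi \<Omega> p \<phi> x = p *\<^sub>R x" for x
    using eigenvector_in_span_of_simple_eigenvector[OF assms(13) \<phi> T\<phi> that] .
  obtain a where a: "0 \<le> a" "a < 1"
    "\<And>y. y \<in> H10 \<Omega> \<Longrightarrow> y \<bullet> \<phi> = 0 \<Longrightarrow> norm (Tphi \<Omega> p \<phi> y) \<le> a * norm y"
    by (rule T.contraction_on_complement_of_simple_eigenvector[OF _ \<phi> T\<phi> p])
      (use Tphi_nonneg[OF \<phi>(1)] regular simple in blast)+
  obtain \<delta> \<theta> where \<delta>: "0 < \<delta>" and \<theta>: "0 < \<theta>" "\<theta> < 1"
    and step: "\<And>u. u \<in> H10 \<Omega> \<Longrightarrow> norm (u - \<phi>) < \<delta> \<Longrightarrow>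
      norm (Aop \<Omega> p \<gamma> u - \<phi>) \<le> \<theta> * norm (u - \<phi>)"
    using local_contraction[OF \<phi> G\<phi> a assms(7,8)] by blast
  \<comment> \<open>Within distance \<open>\<parallel>\<phi>\<parallel>\<close> of \<open>\<phi>\<close> no iterate vanishes.\<close>
  define r where "r = min \<delta> (norm \<phi>)"
  have r: "0 < r" using \<delta> \<phi>(2) by (simp add: r_def)
  define N where "N = H10 \<Omega> \<inter> ball \<phi> r"
  have "u n \<in> H10 \<Omega> \<and> u n \<noteq> 0 \<and> norm (u n - \<phi>) \<le> \<theta> ^ n * norm (u 0 - \<phi>)"
    if u: "u 0 \<in> N" "\<And>n. u (Suc n) = Aop \<Omega> p \<gamma> (u n)" for u :: "nat \<Rightarrow> 'a sobolev" and n
  proof -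
    have u0: "u 0 \<in> H10 \<Omega>" "norm (u 0 - \<phi>) < r"
      using u(1) by (auto simp: N_def dist_norm norm_minus_commute)
    have small: "norm (w - \<phi>) < r" if "norm (w - \<phi>) \<le> \<theta> ^ k * norm (u 0 - \<phi>)" for w k
    proof -
      have "\<theta> ^ k * norm (u 0 - \<phi>) \<le> 1 * norm (u 0 - \<phi>)"
        using \<theta> by (intro mult_right_mono power_le_one) auto
      with that u0(2) show ?thesis by simp
    qed
    have *: "u n \<in> H10 \<Omega> \<and> norm (u n - \<phi>) \<le> \<theta> ^ n * norm (u 0 - \<phi>)"
    proof (induction n)
      case 0
      then show ?case using u0 by simp
    next
      case (Suc n)
      then have un: "u n \<in> H10 \<Omega>" "norm (u n - \<phi>) < \<delta>" using small[of "u n" n] by (auto simp: r_def)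
      have "u (Suc n) \<in> H10 \<Omega>"
        unfolding u(2) Aop_eq[OF un(1)] using G(1)[OF un(1)] subspace by (simp add: subspace_scale)
      moreover have "norm (u (Suc n) - \<phi>) \<le> \<theta> * (\<theta> ^ n * norm (u 0 - \<phi>))"
        unfolding u(2) using step[OF un] Suc.IH \<theta>(1) by (auto intro: order.trans mult_left_mono)
      ultimately show ?case by (simp add: mult.assoc)
    qed
    moreover have "u n \<noteq> 0"
      using small[of "u n" n] * by (auto simp: r_def)
    ultimately show ?thesis by blast
  qed
  moreover have "openin (top_of_set (H10 \<Omega>)) N" unfolding N_def by (rule openin_open_Int) simp
  moreover have "\<phi> \<in> N" using \<phi>(1) r by (simp add: N_def)
  ultimately show ?thesis using \<theta> by blast
qed

end
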